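(* Let $n\ge1$ and let $w\in\widetilde{\mathrm{Sp}(2n)}$ lie in the closure of $\widetilde{\mathrm{Sp}_{\mathrm{ell}}^+(2n)}$, with eigenvalues (i.e. the eigenvalues, counted with algebraic multiplicity, of the projection of $w$ to $\mathrm{Sp}(2n)$) $\{e^{\pm i\theta_1},\dots,e^{\pm i\theta_n}\}$, where $\theta_k\in[0,\pi]$. Then $$\mathrm{dist}_G(id,w)=\sqrt[n]{\theta_1\cdots\theta_n}.$$
   Context: Let $\omega=\sum_{i=1}^n dx_i\wedge dy_i$ be the canonical symplectic form on $\mathbb{R}^{2n}$ and $\mathrm{Sp}(2n)$ the Lie group of linear maps of $\mathbb{R}^{2n}$ preserving $\omega$, with Lie algebra $\mathfrak{sp}(2n)=\{X\in \mathrm{Mat}(2n,\mathbb{R}) : \omega(\cdot,X\cdot)\text{ is symmetric}\}$. Cone structure: $C(id)=\{X\in\mathfrak{sp}(2n)\setminus\{0\} : \omega(\cdot,X\cdot)\text{ is positive semi-definite}\}$, and $C(W)=W\,C(id)=C(id)\,W\subset T_W\mathrm{Sp}(2n)$; $C=\bigcup_W C(W)$. The interior of $C(id)$ is $\mathfrak{sp}^+(2n)=\{X\in\mathfrak{sp}(2n) : \omega(\cdot,X\cdot)\text{ positive definite}\}$. Positively elliptic region: extend $\omega$ to a skew-Hermitian form on $\mathbb{C}^{2n}$ (linear in the first, antilinear in the second argument), and let $\kappa=-i\omega$. $\mathrm{Sp}_{\mathrm{ell}}^+(2n)$ is the set of $W\in\mathrm{Sp}(2n)$ all of whose complex eigenvalues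 lie in $S^1\setminus\{\pm1\}$ and such that, for eigenvalues $\lambda$ of $W$, $\kappa$ is positive definite on the generalised eigenspace $E_\lambda\subset\mathbb{C}^{2n}$ if and only if $\lambda$ has positive imaginary part. Equivalently, $W\in \mathrm{Sp}_{\mathrm{ell}}^+(2n)$ iff there are an $\omega$-orthogonal splitting of $\mathbb{R}^{2n}$ into symplectic planes $V_1,\dots,V_n$, complex structures $J_k$ on $V_k$ that are $\omega$-compatible (i.e. $\omega(\cdot,J_k\cdot)$ is a positive definite inner product on $V_k$), and $\theta_k\in(0,\pi)$ with $W=\bigoplus_{k=1}^n e^{\theta_kJ_k}$. It is open in $\mathrm{Sp}(2n)$. Universal cover: $\widetilde{\mathrm{Sp}(2n)}$ is the universal cover of $\mathrm{Sp}(2n)$ with its group structure, and its neutral element is denoted $id$. $\widetilde{\mathrm{Sp}_{\mathrm{ell}}^+(2n)}$ is the unique lift of $\mathrm{Sp}_{\mathrm{ell}}^+(2n)$ to $\widetilde{\mathrm{Sp}(2n)}$ whose boundary contains $id$. The cone structure $C$ is lifted to $\widetilde{\mathrm{Sp}(2n)}$ via the covering map. Lorentz-Finsler metric and distance: on $C(id)$ put $G(X)=\det(X)^{\frac1{2n}}$ (this vanishes on $\partial C(id)$), and extend $G$ to $C$ by bi-invariance: $G(XW)=G(WX)=G(X)$ for $X\in C(id)$, $W\in\mathrm{Sp}(2n)$; lift $G$ to $\widetilde{\mathrm{Sp}(2n)}$. The Lorentzian length of a curve $\gamma:[a,b]\to\widetilde{\mathrm{Sp}(2n)}$ tangent to $C$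 (i.e. a smooth curve with $\gamma'(t)\in C(\gamma(t))$ for all $t$) is $\int_a^b G(\gamma'(t))\,dt$. For $w_1,w_2\in\widetilde{\mathrm{Sp}(2n)}$, $\mathrm{dist}_G(w_1,w_2)$ is the supremum of the lengths of all curves tangent to $C$ from $w_1$ to $w_2$ (and $0$ if there are no such curves). *)

theory Defs
  imports
    "HOL-Analysis.Analysis"
    "HOL-Computational_Algebra.Computational_Algebra"
    "HOL-Algebra.Group"
begin

text \<open>The space of dimension \<open>2n\<close> is \<open>real ^ ('n + 'n)\<close> with \<open>n = CARD('n)\<close>: the coordinate
  \<open>x\<^sub>i\<close> has index \<open>Inl i\<close>, the coordinate \<open>y\<^sub>i\<close> has index \<open>Inr i\<close>.\<close>

type_synonym 'n rmat = "real ^ ('n + 'n) ^ ('n + 'n)"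
type_synonym 'n cmat = "complex ^ ('n + 'n) ^ ('n + 'n)"

definition omega :: "real ^ ('n::finite + 'n) \<Rightarrow> real ^ ('n + 'n) \<Rightarrow> real"
  where "omega u v = (\<Sum>i\<in>UNIV. u $ Inl i * v $ Inr i - u $ Inr i * v $ Inl i)"

definition Sp :: "('n::finite) rmat set"
  where "Sp = {W. \<forall>u v. omega (W *v u) (W *v v) = omega u v}"

definition Sp_group :: "('n::finite) rmat monoid"
  where "Sp_group = \<lparr>carrier = Sp, monoid.mult = (**), one = mat 1\<rparr>"

definition sp :: "('n::finite) rmat set"
  where "sp = {X. \<forall>u v. omega u (X *v v) = omega v (X *v u)}"


subsection \<open>The cone structure and the Lorentz-Finsler metric\<close>

definition cone_id :: "('n::finite) rmat set"
  where "cone_id = {X \<in> sp - {0}. \<forall>u. 0 \<le> omega u (X *v u)}"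

definition cone :: "('n::finite) rmat \<Rightarrow> 'n rmat set"
  where "cone W = (\<lambda>X. X ** W) ` cone_id"

definition G_id :: "('n::finite) rmat \<Rightarrow> real"
  where "G_id X = root (2 * CARD('n)) (det X)"

text \<open>\<open>G_at W V\<close> is the value of the metric at the vector \<open>V \<in> cone W\<close>, which is \<open>X ** W\<close>
  for a unique \<open>X \<in> cone_id\<close>.\<close>

definition G_at :: "('n::finite) rmat \<Rightarrow> 'n rmat \<Rightarrow> real"
  where "G_at W V = G_id (V ** matrix_inv W)"


subsection \<open>Eigenvalues and the positively elliptic region\<close>

definition complexify :: "('n::finite) rmat \<Rightarrow> 'n cmat"
  where "complexify W = map_matrix complex_of_real W"

definition charpoly :: "('n::finite) cmat \<Rightarrow> complex poly"
  where "charpoly A = det (mat [:0, 1:] - map_matrix (\<lambda>a. [:a:]) A)"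

text \<open>The multiset of complex eigenvalues, with algebraic multiplicities.\<close>

definition eigenvalues :: "('n::finite) rmat \<Rightarrow> complex multiset"
  where "eigenvalues W = proots (charpoly (complexify W))"

definition gen_eigenspace :: "('n::finite) rmat \<Rightarrow> complex \<Rightarrow> (complex ^ ('n + 'n)) set"
  where "gen_eigenspace W z =
    {v. \<exists>m. ((\<lambda>u. complexify W *v u - z *s u) ^^ m) v = 0}"

definition kappa :: "complex ^ ('n::finite + 'n) \<Rightarrow> complex ^ ('n + 'n) \<Rightarrow> complex"
  where "kappa u v =
    - \<i> * (\<Sum>i\<in>UNIV. u $ Inl i * cnj (v $ Inr i) - u $ Inr i * cnj (v $ Inl i))"

text \<open>\<open>kappa\<close> is Hermitian, so \<open>kappa v v\<close> is real.\<close>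

definition kappa_pos_def_on :: "(complex ^ ('n::finite + 'n)) set \<Rightarrow> bool"
  where "kappa_pos_def_on E \<longleftrightarrow> (\<forall>v\<in>E. v \<noteq> 0 \<longrightarrow> 0 < Re (kappa v v))"

definition Sp_ell_plus :: "('n::finite) rmat set"
  where "Sp_ell_plus = {W \<in> Sp. \<forall>z. z \<in># eigenvalues W \<longrightarrow>
    cmod z = 1 \<and> z \<noteq> 1 \<and> z \<noteq> -1 \<and>
    (kappa_pos_def_on (gen_eigenspace W z) \<longleftrightarrow> 0 < Im z)}"


subsection \<open>The universal cover\<close>

text \<open>The universal cover is unique up to isomorphism, and is given here by an arbitrary simply
  connected topological group \<open>S\<close> with a homomorphic covering map \<open>p\<close> onto \<open>Sp\<close>. Note that
  \<open>simply_connected\<close> (all loops are freely homotopic, constant loops included) entails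
  path-connectedness. The neutral element is \<open>\<one>\<^bsub>S\<^esub>\<close>.\<close>

definition universal_cover_Sp ::
    "('a::topological_space) monoid \<Rightarrow> ('a \<Rightarrow> ('n::finite) rmat) \<Rightarrow> bool"
  where "universal_cover_Sp S p \<longleftrightarrow>
    group S \<and>
    continuous_on (carrier S \<times> carrier S) (\<lambda>(x, y). x \<otimes>\<^bsub>S\<^esub> y) \<and>
    continuous_on (carrier S) (\<lambda>x. inv\<^bsub>S\<^esub> x) \<and>
    simply_connected (carrier S) \<and>
    covering_space (carrier S) p Sp \<and>
    p \<in> hom S Sp_group"

text \<open>\<open>U\<close> is the lift of the positively elliptic region to the universal cover, that is, the image
  of a continuous section of \<open>p\<close> over it, which has the neutral element in its boundary.\<close>

definition is_Sp_ell_plus_lift ::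
    "('a::topological_space) monoid \<Rightarrow> ('a \<Rightarrow> ('n::finite) rmat) \<Rightarrow> 'a set \<Rightarrow> bool"
  where "is_Sp_ell_plus_lift S p U \<longleftrightarrow>
    U \<subseteq> carrier S \<and>
    (\<exists>q. homeomorphism U Sp_ell_plus p q) \<and>
    \<one>\<^bsub>S\<^esub> \<in> top_of_set (carrier S) frontier_of U"


subsection \<open>Length and distance\<close>

text \<open>Infinite differentiability on a compact interval, with one-sided derivatives at the ends.\<close>

definition smooth_on_Icc :: "real \<Rightarrow> real \<Rightarrow> (real \<Rightarrow> 'b::real_normed_vector) \<Rightarrow> bool"
  where "smooth_on_Icc a b c \<longleftrightarrow>
    (\<exists>D :: nat \<Rightarrow> real \<Rightarrow> 'b. (\<forall>t\<in>{a..b}. D 0 t = c t) \<and>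
      (\<forall>k. \<forall>t\<in>{a..b}. (D k has_vector_derivative D (Suc k) t) (at t within {a..b})))"

definition velocity :: "real \<Rightarrow> real \<Rightarrow> (real \<Rightarrow> 'b::real_normed_vector) \<Rightarrow> real \<Rightarrow> 'b"
  where "velocity a b c t = vector_derivative c (at t within {a..b})"

text \<open>The smooth structure, the cone structure and the metric on the cover are pulled back along the
  local diffeomorphism \<open>p\<close>. A continuous curve in the cover is therefore smooth, or tangent to the
  cone structure, if and only if its projection is, and it has the same length.\<close>

definition tangent_curve ::
    "('a::topological_space) monoid \<Rightarrow> ('a \<Rightarrow> ('n::finite) rmat) \<Rightarrow> real \<Rightarrow> real \<Rightarrow> (real \<Rightarrow> 'a) \<Rightarrow> bool"
  where "tangent_curve S p a b \<gamma> \<longleftrightarrow>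
    a < b \<and> continuous_on {a..b} \<gamma> \<and> \<gamma> ` {a..b} \<subseteq> carrier S \<and>
    smooth_on_Icc a b (p \<circ> \<gamma>) \<and>
    (\<forall>t\<in>{a..b}. velocity a b (p \<circ> \<gamma>) t \<in> cone (p (\<gamma> t)))"

definition curve_length ::
    "('a \<Rightarrow> ('n::finite) rmat) \<Rightarrow> real \<Rightarrow> real \<Rightarrow> (real \<Rightarrow> 'a) \<Rightarrow> real"
  where "curve_length p a b \<gamma> =
    integral {a..b} (\<lambda>t. G_at (p (\<gamma> t)) (velocity a b (p \<circ> \<gamma>) t))"

definition curve_lengths ::
    "('a::topological_space) monoid \<Rightarrow> ('a \<Rightarrow> ('n::finite) rmat) \<Rightarrow> 'a \<Rightarrow> 'a \<Rightarrow> real set"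
  where "curve_lengths S p w1 w2 = {curve_length p a b \<gamma> | a b \<gamma>.
    tangent_curve S p a b \<gamma> \<and> \<gamma> a = w1 \<and> \<gamma> b = w2}"

definition dist_G ::
    "('a::topological_space) monoid \<Rightarrow> ('a \<Rightarrow> ('n::finite) rmat) \<Rightarrow> 'a \<Rightarrow> 'a \<Rightarrow> ereal"
  where "dist_G S p w1 w2 =
    (if curve_lengths S p w1 w2 = {} then 0
     else (SUP l \<in> curve_lengths S p w1 w2. ereal l))"

end

theory Submission
  imports Defs
begin

text \<open>
  Write a matrix \<open>W\<close> without the eigenvalue -1 as \<open>W = (1 + M) (1 - M)\<^sup>-\<^sup>1\<close> and let \<open>B\<close> be the
  symmetric form \<open>\<omega>(\<cdot>, M \<cdot>)\<close>. In this Cayley chart the identity is \<open>B = 0\<close>, the positively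
  elliptic region is the set of positive definite \<open>B\<close>, and a curve with \<open>W' = X W\<close> moves \<open>B\<close> by half
  of a congruence transform of \<open>\<omega>(\<cdot>, X \<cdot>)\<close>. So curves tangent to the cone are the curves along
  which \<open>B\<close> increases.

  Upper bound. On the elliptic region put \<open>Y = log W\<close> and \<open>\<tau> = (det Y)\<^bsup>1/2n\<^esup>\<close>. The eigenvalues
  of \<open>Y\<close> are \<open>\<plusminus>i \<theta>\<^sub>k\<close>, so \<open>\<tau>\<close> is the \<open>n\<close>-th root of \<open>\<theta>\<^sub>1 \<cdots> \<theta>\<^sub>n\<close>. Although \<open>X\<close> and \<open>Y\<close> need not
  commute, \<open>(log det Y)' = tr (Y\<^sup>-\<^sup>1 X)\<close> (\<open>trace_time_derivative\<close>), and the inequality of arithmetic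
  and geometric means for the eigenvalues of \<open>Y\<^sup>-\<^sup>1 X\<close> gives
  \<open>\<tau>' = \<tau> tr (Y\<^sup>-\<^sup>1 X) / 2n \<ge> (det X)\<^bsup>1/2n\<^esup>\<close>. Hence \<open>\<tau>\<close> grows at least as fast as the length
  (\<open>length_le_time_increase\<close>, \<open>length_le_eigprod\<close>).

  This needs the curve to stay in the chart, and here the universal cover enters. For \<open>s > 0\<close> the
  function \<open>det ((W + 1) + i s \<Omega> (W - 1))\<close>, \<open>\<Omega>\<close> being the matrix of \<open>\<omega>\<close>, has no zero on the
  symplectic group, and its argument does not decrease along curves tangent to the cone. On a simply
  connected space the total increase of the argument depends only on the end points; for a curve from
  the identity to a point of the lifted elliptic region it is therefore the increase along
  the ray of the forms \<open>t B\<close>, which is \<open>\<Sum> arctan (s b\<^sub>j)\<close> for the eigenvalues \<open>b\<^sub>j\<close> of \<open>B\<close> at the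
  end point. It tends to 0 with \<open>s\<close>. If the curve reached the eigenvalue -1, then \<open>B\<close> would become
  unbounded and the increase would be at least \<open>\<pi>/2\<close> for every \<open>s\<close> (\<open>no_crossing\<close>).

  For an end point on the boundary of the lift, a curve of positive length is multiplied by a small
  curve, at a speed controlled by the smallest eigenvalue of \<open>\<omega>(\<cdot>, X \<cdot>)\<close>, so that it ends in
  the lift and loses only a small fraction of its length (\<open>perturbed_curve\<close>). Since the eigenvalue
  angles depend continuously on \<open>W\<close> (\<open>eigprod_limit\<close>), the bound passes to the limit
  (\<open>curve_length_le\<close>).

  Lower bound. If some \<open>\<theta>\<^sub>k\<close> is 0, then so is the right-hand side. Otherwise 1 is not an eigenvalue, and
  a small backward rotation moves \<open>w\<close> to a point \<open>u\<close> of the lifted elliptic region. The product of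
  the one-parameter curve \<open>exp (t log u)\<close> with the rotation is tangent to the cone, leads to \<open>w\<close>, and
  is at least as long as \<open>\<tau>(u)\<close>, which tends to \<open>\<tau>(w)\<close> (\<open>long_curves_exist\<close>).
\<close>

no_notation fps_nth (infixl \<open>$\<close> 75)

section \<open>Matrix algebra and calculus\<close>

lemma matrix_sub_ldistrib: "(A::'a::ring_1^'n^'m) ** (B - C) = A ** B - A ** C"
  by (vector matrix_matrix_mult_def sum_subtractf right_diff_distrib)

lemma matrix_sub_rdistrib: "((A::'a::ring_1^'n^'m) - B) ** C = A ** C - B ** C"
  by (vector matrix_matrix_mult_def sum_subtractf left_diff_distrib)

lemma matrix_add_rdistrib: "((A::'a::semiring_1^'n^'m) + B) ** C = A ** C + B ** C"
  by (vector matrix_matrix_mult_def sum.distrib distrib_right)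

lemma matrix_minus_left: "(- (A::'a::ring_1^'n^'m)) ** B = - (A ** B)"
  by (vector matrix_matrix_mult_def sum_negf)

lemma matrix_minus_right: "(A::'a::ring_1^'n^'m) ** (- B) = - (A ** B)"
  by (vector matrix_matrix_mult_def sum_negf)

lemma matrix_vector_minus_left: "(- (A::'a::ring_1^'n^'m)) *v x = - (A *v x)"
  by (vector matrix_vector_mult_def sum_negf)

lemma matrix_vector_minus_right: "(A::'a::ring_1^'n^'m) *v (- x) = - (A *v x)"
  by (vector matrix_vector_mult_def sum_negf)

lemma scaleR_matrix_left: "(c *\<^sub>R (A::'a::real_algebra_1^'n^'m)) ** B = c *\<^sub>R (A ** B)"
  by (simp add: scalar_matrix_assoc)

lemma scaleR_matrix_right: "(A::'a::real_algebra_1^'n^'m) ** (c *\<^sub>R B) = c *\<^sub>R (A ** B)"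
  by (simp add: matrix_matrix_mult_def vec_eq_iff scaleR_sum_right)

lemma scaleR_matrix_vector: "(c *\<^sub>R (A::'a::real_algebra_1^'n^'m)) *v x = c *\<^sub>R (A *v x)"
  by (simp add: matrix_vector_mult_def vec_eq_iff scaleR_sum_right)

lemmas mring = matrix_add_ldistrib matrix_add_rdistrib matrix_sub_ldistrib matrix_sub_rdistrib
  matrix_minus_left matrix_minus_right scaleR_matrix_left scaleR_matrix_right
  matrix_mul_assoc

lemmas mvec = matrix_vector_right_distrib matrix_vector_mult_diff_distrib
  matrix_vector_mult_add_rdistrib matrix_vector_mult_diff_rdistrib
  matrix_vector_minus_left matrix_vector_minus_right scaleR_matrix_vector
  matrix_vector_mult_scaleR

lemma transpose_add: "transpose (A + B) = transpose A + transpose (B::'a::plus^'n^'m)"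
  by (vector transpose_def)

lemma transpose_diff: "transpose (A - B) = transpose A - transpose (B::'a::minus^'n^'m)"
  by (vector transpose_def)

lemma transpose_minus: "transpose (- A) = - transpose (A::'a::uminus^'n^'m)"
  by (vector transpose_def)

lemmas mtrans = transpose_add transpose_diff transpose_minus transpose_scalar matrix_transpose_mul

lemma trace_scaleR: "trace (c *\<^sub>R (A::'a::real_algebra_1^'n^'n)) = c *\<^sub>R trace A"
  by (simp add: trace_def scaleR_sum_right)

lemma det_scaleR: "det (c *\<^sub>R (A::real^'n^'n)) = c ^ CARD('n) * det A"
proof -
  have "c *\<^sub>R A = (\<chi> i. c *s A $ i)"
    by (simp add: vec_eq_iff)
  then show ?thesis
    using det_rows_mul[of "\<lambda>_. c" "\<lambda>i. A $ i"] by simp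
qed

lemma matrix_inv_right: "invertible (A::'a::field^'n^'n) \<Longrightarrow> A ** matrix_inv A = mat 1"
  unfolding invertible_def matrix_inv_def by (metis (mono_tags, lifting) someI_ex)

lemma matrix_inv_left: "invertible (A::'a::field^'n^'n) \<Longrightarrow> matrix_inv A ** A = mat 1"
  by (simp add: matrix_inv_right matrix_left_right_inverse)

lemma invertibleI: "(A::'a::field^'n^'n) ** B = mat 1 \<Longrightarrow> invertible A"
  using invertible_right_inverse by blast

lemma matrix_inv_eqI:
  assumes "(A::'a::field^'n^'n) ** B = mat 1"
  shows "matrix_inv A = B"
  by (metis assms invertibleI matrix_inv_left matrix_mul_assoc matrix_mul_lid matrix_mul_rid)

lemma matrix_inv_mult:
  assumes "invertible (A::'a::field^'n^'n)" "invertible (B::'a::field^'n^'n)"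
  shows "matrix_inv (A ** B) = matrix_inv B ** matrix_inv A"
  by (rule matrix_inv_eqI) (metis assms matrix_inv_right matrix_mul_assoc matrix_mul_lid)

lemma invertible_matrix_inv: "invertible (A::'a::field^'n^'n) \<Longrightarrow> invertible (matrix_inv A)"
  using matrix_inv_left invertibleI by blast

lemma invertible_iff_ker:
  "invertible (A::'a::field^'n^'n) \<longleftrightarrow> (\<forall>x. A *v x = 0 \<longrightarrow> x = 0)"
  by (metis invertible_left_inverse matrix_left_invertible_ker)

lemma det_matrix_inv: "invertible (A::'a::field^'n^'n) \<Longrightarrow> det (matrix_inv A) = inverse (det A)"
  by (metis det_I det_mul inverse_unique matrix_inv_right)

text \<open>Both real and complex matrices are needed; over either field matrix multiplication is
  bilinear between finite-dimensional real vector spaces.\<close>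

lemma bounded_bilinear_matrix_mult:
  "bounded_bilinear ((**) :: 'a::{real_normed_field,euclidean_space}^'k^'m \<Rightarrow> 'a^'n^'k \<Rightarrow> 'a^'n^'m)"
proof -
  have "bilinear ((**) :: 'a^'k^'m \<Rightarrow> 'a^'n^'k \<Rightarrow> 'a^'n^'m)"
    unfolding bilinear_def
    by (auto intro!: linearI simp: matrix_add_ldistrib matrix_add_rdistrib scaleR_matrix_left scaleR_matrix_right)
  then show ?thesis
    by (simp add: bilinear_conv_bounded_bilinear)
qed

lemma bounded_bilinear_matrix_vector_mult:
  "bounded_bilinear ((*v) :: 'a::{real_normed_field,euclidean_space}^'k^'m \<Rightarrow> 'a^'k \<Rightarrow> 'a^'m)"
proof -
  have "bilinear ((*v) :: 'a^'k^'m \<Rightarrow> 'a^'k \<Rightarrow> 'a^'m)"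
    unfolding bilinear_def
    by (auto intro!: linearI simp: mvec vec_eq_iff matrix_vector_mult_def scaleR_sum_right
       sum.distrib algebra_simps)
  then show ?thesis
    by (simp add: bilinear_conv_bounded_bilinear)
qed

lemmas has_vector_derivative_matrix_mult =
  bounded_bilinear.has_vector_derivative[OF bounded_bilinear_matrix_mult]
lemmas tendsto_matrix_mult [tendsto_intros] =
  bounded_bilinear.tendsto[OF bounded_bilinear_matrix_mult]
lemmas continuous_on_matrix_mult [continuous_intros] =
  bounded_bilinear.continuous_on[OF bounded_bilinear_matrix_mult]
lemmas tendsto_matrix_vector_mult [tendsto_intros] =
  bounded_bilinear.tendsto[OF bounded_bilinear_matrix_vector_mult]
lemmas continuous_on_matrix_vector_mult [continuous_intros] =
  bounded_bilinear.continuous_on[OF bounded_bilinear_matrix_vector_mult]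

lemma continuous_on_trace [continuous_intros]:
  "continuous_on S f \<Longrightarrow> continuous_on S (\<lambda>x. trace (f x :: 'a::real_normed_field^'n^'n))"
  unfolding trace_def by (intro continuous_intros)

lemma tendsto_det [tendsto_intros]:
  fixes A :: "'a::real_normed_field^'n^'n"
  shows "(f \<longlongrightarrow> A) F \<Longrightarrow> ((\<lambda>x. det (f x)) \<longlongrightarrow> det A) F"
  unfolding det_def by (intro tendsto_intros)

lemma continuous_on_det [continuous_intros]:
  fixes f :: "_ \<Rightarrow> 'a::real_normed_field^'n^'n"
  shows "continuous_on S f \<Longrightarrow> continuous_on S (\<lambda>x. det (f x))"
  unfolding continuous_on_def by (auto intro: tendsto_det)

lemma matrix_inv_cramer:
  assumes "invertible (A::'a::field^'n^'n)"
  shows "matrix_inv A = (\<chi> k l. det (\<chi> i j. if j = k then axis l 1 $ i else A $ i $ j) / det A)"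
proof -
  have "matrix_inv A $ k $ l = det (\<chi> i j. if j = k then axis l 1 $ i else A $ i $ j) / det A" for k l
  proof -
    have "A *v (matrix_inv A *v axis l 1) = axis l 1"
      by (simp add: matrix_vector_mul_assoc matrix_inv_right assms)
    then have "matrix_inv A *v axis l 1 = (\<chi> k. det (\<chi> i j. if j = k then axis l 1 $ i else A $ i $ j) / det A)"
      using assms by (subst cramer[symmetric]) (simp_all add: invertible_det_nz)
    moreover have "matrix_inv A $ k $ l = (matrix_inv A *v axis l 1) $ k"
      by (simp add: matrix_vector_mult_def axis_def if_distrib cong: if_cong)
    ultimately show ?thesis by simp
  qed
  then show ?thesis by (simp add: vec_eq_iff)
qed

lemma tendsto_matrix_inv [tendsto_intros]:
  fixes A :: "'a::real_normed_field^'n^'n"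
  assumes f: "(f \<longlongrightarrow> A) F" and A: "invertible A"
  shows "((\<lambda>x. matrix_inv (f x)) \<longlongrightarrow> matrix_inv A) F"
proof -
  let ?g = "\<lambda>A::'a^'n^'n. (\<chi> k l. det (\<chi> i j. if j = k then axis l 1 $ i else A $ i $ j) / det A)"
  have dA: "det A \<noteq> 0" using A by (simp add: invertible_det_nz)
  have *: "((\<lambda>x. if j = k then axis l 1 $ i else f x $ i $ j) \<longlongrightarrow> (if j = k then axis l 1 $ i else A $ i $ j)) F"
    for i j k l using f by (cases "j = k") (auto intro: tendsto_intros)
  have "((\<lambda>x. ?g (f x)) \<longlongrightarrow> ?g A) F"
    using f dA by (intro tendsto_intros *) auto
  moreover have "\<forall>\<^sub>F x in F. ?g (f x) = matrix_inv (f x)"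
  proof -
    have "\<forall>\<^sub>F x in F. det (f x) \<noteq> 0"
      using tendsto_det[OF f] dA by (rule tendsto_imp_eventually_ne)
    then show ?thesis
      by eventually_elim (simp add: matrix_inv_cramer invertible_det_nz)
  qed
  ultimately show ?thesis
    using A by (simp add: matrix_inv_cramer[OF A]) (erule Lim_transform_eventually)
qed

lemma continuous_on_matrix_inv [continuous_intros]:
  fixes f :: "_ \<Rightarrow> 'a::real_normed_field^'n^'n"
  assumes "continuous_on S f" "\<And>x. x \<in> S \<Longrightarrow> invertible (f x)"
  shows "continuous_on S (\<lambda>x. matrix_inv (f x))"
  using assms unfolding continuous_on_def by (auto intro: tendsto_matrix_inv)

text \<open>With the derivative as a limit of difference quotients, the product and inverse of matrices can be
  differentiated by algebraic identities between the quotients.\<close>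

lemma has_vector_derivative_iff_slope:
  "(f has_vector_derivative f') (at x within S) \<longleftrightarrow>
    ((\<lambda>y. (1 / (y - x)) *\<^sub>R (f y - f x)) \<longlongrightarrow> f') (at x within S)"
proof -
  have "(f has_vector_derivative f') (at x within S) \<longleftrightarrow>
     ((\<lambda>y. (1 / norm (y - x)) *\<^sub>R (f y - (f x + (y - x) *\<^sub>R f'))) \<longlongrightarrow> 0) (at x within S)"
    by (simp add: has_vector_derivative_def has_derivative_within bounded_linear_scaleR_left)
  also have "\<dots> \<longleftrightarrow> ((\<lambda>y. norm ((1 / norm (y - x)) *\<^sub>R (f y - (f x + (y - x) *\<^sub>R f')))) \<longlongrightarrow> 0) (at x within S)"
    by (rule tendsto_norm_zero_iff[symmetric])
  also have "\<dots> \<longleftrightarrow> ((\<lambda>y. norm ((1 / (y - x)) *\<^sub>R (f y - f x) - f')) \<longlongrightarrow> 0) (at x within S)"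
  proof (rule tendsto_cong)
    have "norm ((1 / norm (y - x)) *\<^sub>R (f y - (f x + (y - x) *\<^sub>R f'))) = norm ((1 / (y - x)) *\<^sub>R (f y - f x) - f')"
      if "y \<noteq> x" for y
    proof -
      have "(1 / (y - x)) *\<^sub>R (f y - f x) - f' = (1 / (y - x)) *\<^sub>R (f y - (f x + (y - x) *\<^sub>R f'))"
        using that by (simp add: scaleR_diff_right scaleR_add_right)
      then show ?thesis by simp
    qed
    then show "\<forall>\<^sub>F y in at x within S. norm ((1 / norm (y - x)) *\<^sub>R (f y - (f x + (y - x) *\<^sub>R f'))) = norm ((1 / (y - x)) *\<^sub>R (f y - f x) - f')"
      by (simp add: eventually_at_filter)
  qed
  also have "\<dots> \<longleftrightarrow> ((\<lambda>y. (1 / (y - x)) *\<^sub>R (f y - f x)) \<longlongrightarrow> f') (at x within S)"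
    by (simp only: tendsto_norm_zero_iff Lim_null[symmetric, of _ f'])
  finally show ?thesis .
qed

lemma has_vector_derivative_matrix_inv:
  fixes f :: "real \<Rightarrow> 'a::{real_normed_field,euclidean_space}^'n^'n"
  assumes f: "(f has_vector_derivative f') (at x within S)" and inv: "invertible (f x)"
  shows "((\<lambda>x. matrix_inv (f x)) has_vector_derivative - (matrix_inv (f x) ** f' ** matrix_inv (f x))) (at x within S)"
proof -
  have cf: "(f \<longlongrightarrow> f x) (at x within S)"
    using has_vector_derivative_continuous[OF f] by (simp add: continuous_within)
  have "((\<lambda>y. - (matrix_inv (f y) ** ((1 / (y - x)) *\<^sub>R (f y - f x)) ** matrix_inv (f x)))
      \<longlongrightarrow> - (matrix_inv (f x) ** f' ** matrix_inv (f x))) (at x within S)"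
    using f cf inv by (intro tendsto_intros) (simp_all add: has_vector_derivative_iff_slope)
  moreover have "\<forall>\<^sub>F y in at x within S. - (matrix_inv (f y) ** ((1 / (y - x)) *\<^sub>R (f y - f x)) ** matrix_inv (f x))
     = (1 / (y - x)) *\<^sub>R (matrix_inv (f y) - matrix_inv (f x))"
  proof -
    have "\<forall>\<^sub>F y in at x within S. det (f y) \<noteq> 0"
      using tendsto_det[OF cf] inv by (intro tendsto_imp_eventually_ne) (simp_all add: invertible_det_nz)
    then show ?thesis
    proof eventually_elim
      case (elim y)
      then have iy: "invertible (f y)" by (simp add: invertible_det_nz)
      have "matrix_inv (f y) ** (f y - f x) ** matrix_inv (f x) = matrix_inv (f x) - matrix_inv (f y)"
        by (simp add: mring matrix_inv_left[OF iy])
          (simp add: matrix_mul_assoc[symmetric] matrix_inv_right[OF inv])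
      then show ?case
        by (simp only: scaleR_matrix_left scaleR_matrix_right minus_diff_eq[symmetric, of "matrix_inv (f y)"] scaleR_minus_right minus_minus)
    qed
  qed
  ultimately show ?thesis
    unfolding has_vector_derivative_iff_slope by (rule Lim_transform_eventually)
qed

text \<open>Jacobi's formula. At the identity matrix only the identity permutation contributes to the
  derivative of the determinant; the general case follows by multiplicativity.\<close>

lemma has_vector_derivative_det_at_id:
  fixes f :: "real \<Rightarrow> 'a::real_normed_field^'n^'n"
  assumes f: "(f has_vector_derivative f') (at x within S)" and fx: "f x = mat 1"
  shows "((\<lambda>x. det (f x)) has_vector_derivative trace f') (at x within S)"
proof -
  have ent: "((\<lambda>x. f x $ i $ j) has_derivative (\<lambda>h. h *\<^sub>R f' $ i $ j)) (at x within S)" for i j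
  proof -
    have bl: "bounded_linear (\<lambda>A::'a^'n^'n. A $ i $ j)"
      using bounded_linear_compose[OF bounded_linear_vec_nth bounded_linear_vec_nth] by blast
    show ?thesis
      using bounded_linear.has_derivative[OF bl f[unfolded has_vector_derivative_def]] by simp
  qed
  define P where "P = {p. p permutes (UNIV::'n set)}"
  have finP: "finite P" unfolding P_def by (simp add: finite_permutations)
  have "((\<lambda>x. det (f x)) has_derivative (\<lambda>h. \<Sum>p\<in>P. of_int (sign p) * (\<Sum>i\<in>UNIV. (h *\<^sub>R f' $ i $ p i) * (\<Prod>j\<in>UNIV - {i}. f x $ j $ p j)))) (at x within S)"
    unfolding det_def P_def
    by (intro has_derivative_sum has_derivative_mult_right has_derivative_prod ent)
  moreover have "(\<Sum>p\<in>P. of_int (sign p) * (\<Sum>i\<in>UNIV. (h *\<^sub>R f' $ i $ p i) * (\<Prod>j\<in>UNIV - {i}. f x $ j $ p j))) = h *\<^sub>R trace f'" for h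
  proof -
    have z: "(\<Prod>j\<in>UNIV - {i}. f x $ j $ p j) = (if p = id then 1 else 0)" if "p \<in> P" for i p
    proof (cases "p = id")
      case False
      have pp: "p permutes UNIV" using that by (simp add: P_def)
      have "\<exists>j. j \<noteq> i \<and> p j \<noteq> j"
      proof (rule ccontr)
        assume "\<not> ?thesis"
        then have *: "\<And>j. j \<noteq> i \<Longrightarrow> p j = j" by blast
        have "p i = i" using * permutes_inj[OF pp] by (metis injD)
        then have "p = id" using * by (intro ext) (metis id_apply)
        with False show False by simp
      qed
      then show ?thesis using False by (auto simp: fx mat_def)
    qed (simp add: fx mat_def)
    have "(\<Sum>p\<in>P. of_int (sign p) * (\<Sum>i\<in>UNIV. (h *\<^sub>R f' $ i $ p i) * (\<Prod>j\<in>UNIV - {i}. f x $ j $ p j)))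
       = (\<Sum>p\<in>P. if p = id then h *\<^sub>R trace f' else 0)"
      by (rule sum.cong) (simp_all add: z trace_def scaleR_sum_right)
    also have "\<dots> = h *\<^sub>R trace f'"
      using finP by (simp add: P_def permutes_id)
    finally show ?thesis .
  qed
  ultimately show ?thesis
    unfolding has_vector_derivative_def by simp
qed

lemma has_vector_derivative_det:
  fixes f :: "real \<Rightarrow> 'a::{real_normed_field,euclidean_space}^'n^'n"
  assumes f: "(f has_vector_derivative f') (at x within S)" and inv: "invertible (f x)"
  shows "((\<lambda>x. det (f x)) has_vector_derivative det (f x) * trace (matrix_inv (f x) ** f')) (at x within S)"
proof -
  have "((\<lambda>y. matrix_inv (f x) ** f y) has_vector_derivative matrix_inv (f x) ** f') (at x within S)"
    using has_vector_derivative_matrix_mult[OF has_vector_derivative_const f] by simp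
  then have "((\<lambda>y. det (matrix_inv (f x) ** f y)) has_vector_derivative trace (matrix_inv (f x) ** f')) (at x within S)"
    by (rule has_vector_derivative_det_at_id) (simp add: matrix_inv_left inv)
  then have "((\<lambda>y. det (f x) * det (matrix_inv (f x) ** f y)) has_vector_derivative det (f x) * trace (matrix_inv (f x) ** f')) (at x within S)"
    by (rule has_vector_derivative_mult_right)
  moreover have "det (f x) * det (matrix_inv (f x) ** f y) = det (f y)" for y
    by (metis det_mul inv matrix_inv_right matrix_mul_assoc matrix_mul_lid)
  ultimately show ?thesis by simp
qed

section \<open>Symmetric matrices\<close>

definition psd :: "real^'n^'n \<Rightarrow> bool"
  where "psd A \<longleftrightarrow> transpose A = A \<and> (\<forall>x. 0 \<le> x \<bullet> (A *v x))"

definition pd :: "real^'n^'n \<Rightarrow> bool"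
  where "pd A \<longleftrightarrow> transpose A = A \<and> (\<forall>x. x \<noteq> 0 \<longrightarrow> 0 < x \<bullet> (A *v x))"

definition diagmat :: "'a::zero^'n \<Rightarrow> 'a^'n^'n"
  where "diagmat d = (\<chi> i j. if i = j then d $ i else 0)"

lemma diagmat_mult_vec: "diagmat d *v x = (\<chi> i. d $ i * (x $ i :: 'a::semiring_1))"
  by (simp add: diagmat_def matrix_vector_mult_def vec_eq_iff if_distrib[of "\<lambda>z. z * _"] cong: if_cong)

lemma diagmat_mult: "diagmat a ** diagmat b = diagmat (\<chi> i. a $ i * (b $ i :: 'a::semiring_1))"
  by (simp add: diagmat_def matrix_matrix_mult_def vec_eq_iff if_distrib[of "\<lambda>z. z * _"] cong: if_cong)

lemma det_diagmat: "det (diagmat d) = (\<Prod>i\<in>UNIV. d $ i)"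
  by (subst det_diagonal) (simp_all add: diagmat_def)

lemma trace_diagmat: "trace (diagmat d) = (\<Sum>i\<in>UNIV. d $ i)"
  by (simp add: trace_def diagmat_def)

lemma transpose_diagmat: "transpose (diagmat d) = diagmat d"
  by (simp add: diagmat_def transpose_def vec_eq_iff)

lemma diagmat_one: "diagmat (\<chi> i. 1) = mat 1"
  by (simp add: diagmat_def mat_def vec_eq_iff)

lemma inner_transpose: "(x::real^'n) \<bullet> (A *v y) = (transpose A *v x) \<bullet> y"
  by (simp add: dot_lmul_matrix[symmetric] transpose_matrix_vector)

lemma inner_symmetric: "transpose A = A \<Longrightarrow> (x::real^'n) \<bullet> (A *v y) = y \<bullet> (A *v x)"
  by (metis inner_commute inner_transpose)

lemma inner_vector_matrix: "(x::real^'n) \<bullet> (y v* A) = (A *v x) \<bullet> y"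
  by (metis dot_lmul_matrix inner_commute)

lemma pd_imp_psd: "pd A \<Longrightarrow> psd A"
  unfolding pd_def psd_def by (metis inner_zero_left less_eq_real_def)

lemma pd_invertible: "pd A \<Longrightarrow> invertible A"
  by (auto simp: invertible_iff_ker pd_def)

lemma pd_mat_1: "pd (mat 1)"
  by (simp add: pd_def)

lemma psd_congruence: "psd A \<Longrightarrow> psd (transpose T ** A ** T)"
  by (auto simp: psd_def mtrans matrix_mul_assoc matrix_vector_mul_assoc[symmetric] inner_vector_matrix)

lemma pd_congruence:
  assumes "pd A" "invertible (T::real^'n^'n)" shows "pd (transpose T ** A ** T)"
proof -
  have "T *v x \<noteq> 0" if "x \<noteq> 0" for x using assms(2) that by (auto simp: invertible_iff_ker)
  with assms(1) show ?thesis
    by (auto simp: pd_def mtrans matrix_mul_assoc matrix_vector_mul_assoc[symmetric] inner_vector_matrix)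
qed

lemma pd_scaleR: "pd A \<Longrightarrow> 0 < c \<Longrightarrow> pd (c *\<^sub>R A)"
  by (auto simp: pd_def mtrans scaleR_matrix_vector)

lemma psd_scaleR: "psd A \<Longrightarrow> 0 \<le> c \<Longrightarrow> psd (c *\<^sub>R A)"
  by (auto simp: psd_def mtrans scaleR_matrix_vector)

lemma pd_add: "pd A \<Longrightarrow> psd B \<Longrightarrow> pd (A + B)"
  by (auto simp: pd_def psd_def mtrans mvec inner_add_right add_pos_nonneg)

text \<open>A maximum of the quadratic form on the unit sphere of an invariant subspace is an
  eigenvector.\<close>

lemma symmetric_eigenvector_in_subspace:
  fixes A :: "real^'n^'n"
  assumes sym: "transpose A = A" and V: "subspace V" and inv: "\<And>v. v \<in> V \<Longrightarrow> A *v v \<in> V"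
    and ne: "v0 \<in> V" "v0 \<noteq> 0"
  obtains x l where "x \<in> V" "norm x = 1" "A *v x = l *\<^sub>R x"
proof -
  let ?f = "\<lambda>x. x \<bullet> (A *v x)"
  let ?K = "V \<inter> sphere 0 1"
  have "compact ?K"
    using closed_subspace[OF V] by (simp add: closed_Int_compact)
  moreover have "(1 / norm v0) *\<^sub>R v0 \<in> ?K"
    using ne V by (simp add: subspace_scale)
  then have "?K \<noteq> {}" by blast
  moreover have "continuous_on ?K ?f"
    by (intro continuous_intros)
  ultimately obtain x where x: "x \<in> ?K" and mx: "\<And>y. y \<in> ?K \<Longrightarrow> ?f y \<le> ?f x"
    using continuous_attains_sup[of ?K ?f] by blast
  define l where "l = ?f x"
  have xV: "x \<in> V" and nx: "norm x = 1" using x by auto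
  have le: "?f v \<le> l * (v \<bullet> v)" if "v \<in> V" for v
  proof (cases "v = 0")
    case False
    have "(1 / norm v) *\<^sub>R v \<in> ?K" using False that V by (simp add: subspace_scale)
    from mx[OF this] have "?f v / (norm v)\<^sup>2 \<le> l"
      by (simp add: l_def mvec power2_eq_square)
    then show ?thesis using False
      by (simp add: field_simps power2_norm_eq_inner)
  qed simp
  have "x \<bullet> (A *v v) = l * (x \<bullet> v)" if v: "v \<in> V" for v
  proof -
    \<comment> \<open>The polynomial \<open>t b + t\<^sup>2 c\<close> is nonnegative and vanishes at 0, hence its linear
      coefficient \<open>b\<close> is 0; the value at \<open>t = - b / (c + 1)\<close> shows it.\<close>
    define b where "b = 2 * (l * (x \<bullet> v) - x \<bullet> (A *v v))"
    define c where "c = l * (v \<bullet> v) - ?f v"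
    have c: "c \<ge> 0" using le[OF v] by (simp add: c_def)
    have q: "0 \<le> t * b + t\<^sup>2 * c" for t
    proof -
      have "x + t *\<^sub>R v \<in> V" using xV v V by (simp add: subspace_add subspace_scale)
      from le[OF this] have "l * (x \<bullet> x + 2 * t * (x \<bullet> v) + t\<^sup>2 * (v \<bullet> v)) - (?f x + 2 * t * (x \<bullet> (A *v v)) + t\<^sup>2 * ?f v) \<ge> 0"
        by (simp add: mvec inner_add_left inner_add_right inner_symmetric[OF sym, of v x] inner_commute[of v x] power2_eq_square algebra_simps)
      moreover have "x \<bullet> x = 1" using nx by (simp add: norm_eq_1)
      ultimately show ?thesis
        by (simp add: b_def c_def l_def[symmetric] algebra_simps)
    qed
    define k where "k = b / (c + 1)"
    have b: "b = k * (c + 1)" using c by (simp add: k_def)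
    have "(- k) * b + (- k)\<^sup>2 * c = - k\<^sup>2"
      unfolding b by (simp add: algebra_simps power2_eq_square)
    with q[of "- k"] have "k\<^sup>2 \<le> 0" by linarith
    then have "b = 0" by (simp add: b)
    then show ?thesis by (simp add: b_def)
  qed
  then have orth: "(A *v x - l *\<^sub>R x) \<bullet> v = 0" if "v \<in> V" for v
    using that inner_symmetric[OF sym, of x v] by (simp add: inner_diff_left inner_commute[of "A *v x"])
  have "A *v x - l *\<^sub>R x \<in> V"
    using inv[OF xV] xV V by (simp add: subspace_diff subspace_scale)
  from orth[OF this] have "A *v x = l *\<^sub>R x" by simp
  with that xV nx show ?thesis by blast
qed

text \<open>The spectral theorem: a largest orthonormal set of eigenvectors spans, since its orthogonal
  complement is invariant and would otherwise contain one more eigenvector.\<close>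

theorem spectral_theorem:
  fixes A :: "real^'n^'n"
  assumes sym: "transpose A = A"
  obtains T d where "orthogonal_matrix T" "A = T ** diagmat d ** transpose T"
proof -
  define good where "good S \<longleftrightarrow> pairwise orthogonal S \<and> (\<forall>x\<in>S. norm x = 1 \<and> (\<exists>l. A *v x = l *\<^sub>R x))"
    for S :: "(real^'n) set"
  have ind: "independent S" if "good S" for S
    using that by (intro pairwise_orthogonal_independent) (auto simp: good_def)
  have bound: "card S \<le> CARD('n)" and fin: "finite S" if "good S" for S
    using independent_bound[OF ind[OF that]] by (simp_all add: DIM_cart)
  have "\<exists>S. good S \<and> (\<forall>S'. good S' \<longrightarrow> card S' \<le> card S)"
  proof -
    have "good {}" by (simp add: good_def)
    then show ?thesis
      using ex_has_greatest_nat[of good "{}" card "Suc CARD('n)"] bound by (auto simp: less_Suc_eq_le)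
  qed
  then obtain S where S: "good S" and mx: "\<And>S'. good S' \<Longrightarrow> card S' \<le> card S" by blast
  have "span S = UNIV"
  proof (rule ccontr)
    assume "span S \<noteq> UNIV"
    then have "dim S < DIM(real^'n)"
      by (metis dim_eq_full dim_subset_UNIV le_neq_implies_less)
    then obtain v0 where v0: "v0 \<noteq> 0" "\<And>y. y \<in> span S \<Longrightarrow> orthogonal v0 y"
      using orthogonal_to_subspace_exists by metis
    define V where "V = {v. \<forall>s\<in>S. orthogonal v s}"
    have sV: "subspace V" by (auto simp: V_def subspace_def orthogonal_clauses)
    have invV: "A *v v \<in> V" if "v \<in> V" for v
      unfolding V_def
    proof clarify
      fix s assume s: "s \<in> S"
      then obtain l where "A *v s = l *\<^sub>R s" using S by (auto simp: good_def)
      then have "(A *v v) \<bullet> s = l * (v \<bullet> s)"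
        by (metis inner_commute inner_scaleR_right inner_symmetric[OF sym])
      then show "orthogonal (A *v v) s"
        using that s by (simp add: V_def orthogonal_def)
    qed
    have "v0 \<in> V" using v0 by (simp add: V_def span_base)
    with symmetric_eigenvector_in_subspace[OF sym sV invV _ v0(1)]
    obtain x l where x: "x \<in> V" "norm x = 1" "A *v x = l *\<^sub>R x" by metis
    have nS: "x \<notin> S"
    proof
      assume "x \<in> S"
      with x(1) have "orthogonal x x" by (simp add: V_def)
      with x(2) show False by (simp add: orthogonal_self)
    qed
    have "good (insert x S)"
      using S x by (auto simp: good_def V_def pairwise_insert orthogonal_commute)
    from mx[OF this] show False using nS fin[OF S] by simp
  qed
  then have "card S = CARD('n)"
    using ind[OF S] by (metis DIM_cart DIM_real dim_UNIV dim_eq_card dim_span mult.right_neutral)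
  then obtain f where f: "bij_betw f (UNIV::'n set) S"
    using finite_same_card_bij[of "UNIV::'n set" S] fin[OF S] by auto
  have fS: "f j \<in> S" for j using f bij_betwE by blast
  then have "\<forall>j. \<exists>l. A *v f j = l *\<^sub>R f j" using S by (auto simp: good_def)
  then obtain d where d: "\<And>j. A *v f j = d j *\<^sub>R f j" by metis
  define T where "T = (\<chi> i j. f j $ i)"
  have colT: "column j T = f j" for j by (simp add: column_def T_def)
  have T: "orthogonal_matrix T"
    unfolding orthogonal_matrix_orthonormal_columns colT
  proof (intro conjI allI impI)
    show "norm (f i) = 1" for i using fS S by (auto simp: good_def)
    show "orthogonal (f i) (f j)" if "i \<noteq> j" for i j
      using that fS[of i] fS[of j] S f unfolding good_def pairwise_def bij_betw_def inj_on_def by blast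
  qed
  have "A ** T = T ** diagmat (\<chi> j. d j)"
  proof -
    have "(A ** T) $ i $ j = (A *v f j) $ i" for i j
      by (simp add: matrix_matrix_mult_def matrix_vector_mult_def T_def)
    moreover have "(T ** diagmat (\<chi> j. d j)) $ i $ j = d j * f j $ i" for i j
      by (simp add: matrix_matrix_mult_def diagmat_def T_def if_distrib[of "\<lambda>z. _ * z"] cong: if_cong)
    ultimately show ?thesis by (simp add: d vec_eq_iff)
  qed
  then have "A = T ** diagmat (\<chi> j. d j) ** transpose T"
    by (metis T matrix_mul_assoc matrix_mul_rid orthogonal_matrix_def)
  with T that show ?thesis by blast
qed

lemma diag_entry: "(A::real^'n^'n) $ i $ i = axis i 1 \<bullet> (A *v axis i 1)"
proof -
  have "(A *v axis i 1) $ i = A $ i $ i"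
    by (simp add: matrix_vector_mult_def axis_def if_distrib cong: if_cong)
  then show ?thesis by (simp add: inner_axis')
qed

text \<open>Two applications of the spectral theorem: the first turns \<open>P\<close> into the identity, the second
  is orthogonal and does not change that any more.\<close>

theorem simultaneous_diagonalization:
  fixes P H :: "real^'n^'n"
  assumes P: "pd P" and H: "transpose H = H"
  obtains T :: "real^'n^'n" and d where "invertible T" "transpose T ** P ** T = mat 1" "transpose T ** H ** T = diagmat d"
proof -
  obtain U p where U: "orthogonal_matrix U" and Pe: "P = U ** diagmat p ** transpose U"
    using spectral_theorem P by (metis pd_def)
  have UU: "transpose U ** U = mat 1" using U by (simp add: orthogonal_matrix)
  have invU: "invertible U" using UU invertible_left_inverse by blast
  have "transpose U ** P ** U = diagmat p"
    unfolding Pe using UU by (metis matrix_mul_assoc matrix_mul_lid matrix_mul_rid)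
  with pd_congruence[OF P invU] have "pd (diagmat p)" by simp
  then have "0 < diagmat p $ i $ i" for i
    unfolding diag_entry pd_def by (metis axis_eq_0_iff zero_neq_one)
  then have pp: "p $ i > 0" for i by (simp add: diagmat_def)
  define S where "S = U ** diagmat (\<chi> i. 1 / sqrt (p $ i))"
  have S1: "transpose S ** P ** S = mat 1"
  proof -
    have "transpose S ** P ** S = diagmat (\<chi> i. 1 / sqrt (p $ i)) ** (transpose U ** P ** U) ** diagmat (\<chi> i. 1 / sqrt (p $ i))"
      by (simp add: S_def mtrans transpose_diagmat matrix_mul_assoc)
    also have "\<dots> = diagmat (\<chi> i. 1)"
      unfolding \<open>transpose U ** P ** U = diagmat p\<close> diagmat_mult
      by (rule arg_cong[where f = diagmat]) (auto simp: vec_eq_iff field_simps pp less_imp_le less_imp_neq[OF pp, symmetric])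
    finally show ?thesis by (simp add: diagmat_one)
  qed
  have "transpose (transpose S ** H ** S) = transpose S ** H ** S"
    by (simp add: mtrans H matrix_mul_assoc)
  then obtain V d where V: "orthogonal_matrix V" and Ve: "transpose S ** H ** S = V ** diagmat d ** transpose V"
    using spectral_theorem by metis
  have VV: "transpose V ** V = mat 1" using V by (simp add: orthogonal_matrix)
  define T where "T = S ** V"
  have "transpose T ** P ** T = transpose V ** (transpose S ** P ** S) ** V"
    by (simp add: T_def mtrans matrix_mul_assoc)
  then have T1: "transpose T ** P ** T = mat 1" by (simp add: S1 VV)
  have "transpose T ** H ** T = transpose V ** (transpose S ** H ** S) ** V"
    by (simp add: T_def mtrans matrix_mul_assoc)
  also have "\<dots> = (transpose V ** V) ** diagmat d ** (transpose V ** V)"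
    unfolding Ve by (simp add: matrix_mul_assoc)
  finally have T2: "transpose T ** H ** T = diagmat d" by (simp add: VV)
  have "invertible T"
    using T1 invertible_left_inverse by blast
  with T1 T2 that show ?thesis by blast
qed

lemma congruence_diag_entry:
  assumes "transpose T ** H ** T = diagmat d"
  shows "d $ i = (T *v axis i 1) \<bullet> (H *v (T *v axis i 1))"
proof -
  have "d $ i = axis i 1 \<bullet> (diagmat d *v axis i 1)"
    using diag_entry[of "diagmat d" i] by (simp add: diagmat_def)
  then show ?thesis
    by (simp add: assms[symmetric] matrix_vector_mul_assoc[symmetric] inner_vector_matrix)
qed

lemma pd_det_pos: assumes P: "pd (P::real^'n^'n)" shows "0 < det P"
proof -
  obtain T :: "real^'n^'n" and d where T: "transpose T ** P ** T = mat 1"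
    using simultaneous_diagonalization[OF P] P unfolding pd_def by metis
  have "det T * det P * det T = 1"
    using arg_cong[OF T, of det] by (simp add: det_mul)
  then have "(det T)\<^sup>2 * det P = 1" by (simp add: power2_eq_square mult_ac)
  then show ?thesis by (metis zero_less_mult_pos zero_less_one zero_less_power2 mult_zero_left power_zero_numeral)
qed

lemma psd_not_pd_det: assumes "psd (H::real^'n^'n)" "\<not> pd H" shows "det H = 0"
proof -
  obtain T :: "real^'n^'n" and d where T: "invertible T" and T2: "transpose T ** H ** T = diagmat d"
    using simultaneous_diagonalization[OF pd_mat_1] assms(1) unfolding psd_def by metis
  obtain x where x: "x \<noteq> 0" "x \<bullet> (H *v x) = 0"
    using assms unfolding psd_def pd_def by (metis less_le)
  have "\<exists>i. d $ i = 0"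
  proof (rule ccontr)
    assume nz: "\<not> ?thesis"
    have dp: "d $ i > 0" for i
      using congruence_diag_entry[OF T2, of i] assms(1) nz by (metis less_le psd_def)
    have "pd (diagmat d)"
      unfolding pd_def transpose_diagmat diagmat_mult_vec
    proof (intro conjI allI impI refl)
      fix y :: "real^'n" assume "y \<noteq> 0"
      then obtain i where "y $ i \<noteq> 0" by (auto simp: vec_eq_iff)
      then have "0 < y $ i * (d $ i * y $ i)" using dp[of i] by (simp add: mult.left_commute[of "y $ i"])
           (metis mult_pos_pos not_real_square_gt_zero)
      then show "0 < y \<bullet> (\<chi> i. d $ i * y $ i)"
        unfolding inner_vec_def using dp
        by (intro sum_pos2[where i = i]) (auto simp: mult.left_commute[of "y $ _"] less_imp_le)
    qed
    then have "pd (transpose (matrix_inv T) ** diagmat d ** matrix_inv T)"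
      using T by (intro pd_congruence invertible_matrix_inv)
    moreover have "transpose (matrix_inv T) ** diagmat d ** matrix_inv T = transpose (T ** matrix_inv T) ** H ** (T ** matrix_inv T)"
      by (simp add: T2[symmetric] mtrans matrix_mul_assoc)
    ultimately have "pd H" by (simp add: matrix_inv_right[OF T])
    with assms show False by blast
  qed
  then have "det (diagmat d) = 0" by (simp add: det_diagmat)
  then have "det T * det H * det T = 0" by (simp add: T2[symmetric] det_mul)
  with T show ?thesis by (simp add: invertible_det_nz)
qed

lemma psd_det_nonneg: "psd H \<Longrightarrow> 0 \<le> det H"
  using psd_not_pd_det pd_det_pos by (metis less_imp_le order_refl)

text \<open>In a basis which is orthonormal for \<open>H\<close> and diagonalizes \<open>K\<close>, every diagonal entry of \<open>K\<close>
  is at least \<open>c\<close>. If there is no such basis, then \<open>det H\<close> is zero.\<close>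

lemma psd_det_mono:
  fixes H K :: "real^'n^'n"
  assumes H: "psd H" and K: "transpose K = K" and c: "0 \<le> c"
    and le: "\<And>x. c * (x \<bullet> (H *v x)) \<le> x \<bullet> (K *v x)"
  shows "c ^ CARD('n) * det H \<le> det K"
proof (cases "pd H")
  case False
  have "psd K" using H K le c unfolding psd_def by (meson mult_nonneg_nonneg order_trans)
  then show ?thesis using psd_not_pd_det[OF H False] psd_det_nonneg by simp
next
  case True
  obtain T :: "real^'n^'n" and d where T: "invertible T" and T1: "transpose T ** H ** T = mat 1" and T2: "transpose T ** K ** T = diagmat d"
    using simultaneous_diagonalization[OF True K] by metis
  have T1': "transpose T ** H ** T = diagmat (\<chi> i. 1)" using T1 by (simp add: diagmat_one)
  have "c \<le> d $ i" for i
    using le[of "T *v axis i 1"] congruence_diag_entry[OF T1', of i] congruence_diag_entry[OF T2, of i] by simp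
  then have "c ^ CARD('n) \<le> (\<Prod>i\<in>UNIV. d $ i)"
    using prod_mono[of UNIV "\<lambda>_. c" "\<lambda>i. d $ i"] c by simp
  moreover have "(det T)\<^sup>2 * det H = 1" "(det T)\<^sup>2 * det K = (\<Prod>i\<in>UNIV. d $ i)"
    using arg_cong[OF T1, of det] arg_cong[OF T2, of det] by (simp_all add: det_mul det_diagmat power2_eq_square mult_ac)
  ultimately have "(det T)\<^sup>2 * (c ^ CARD('n) * det H) \<le> (det T)\<^sup>2 * det K"
    by (simp add: mult.left_commute)
  moreover have "(det T)\<^sup>2 > 0" using T by (simp add: invertible_det_nz)
  ultimately show ?thesis by simp
qed

text \<open>The inequality of arithmetic and geometric means, applied to the eigenvalues of \<open>H\<close> with
  respect to \<open>P\<close>.\<close>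

lemma det_le_trace_power:
  fixes P H :: "real^'n^'n"
  assumes P: "pd P" and H: "psd H"
  shows "0 \<le> trace (matrix_inv P ** H)"
    and "det H / det P \<le> (trace (matrix_inv P ** H) / real CARD('n)) ^ CARD('n)"
proof -
  obtain T :: "real^'n^'n" and d where T: "invertible T" and T1: "transpose T ** P ** T = mat 1" and T2: "transpose T ** H ** T = diagmat d"
    using simultaneous_diagonalization[OF P] H unfolding psd_def by metis
  have d: "d $ i \<ge> 0" for i
    using congruence_diag_entry[OF T2, of i] H by (simp add: psd_def)
  have "T ** (transpose T ** P) = mat 1"
    using T1 matrix_left_right_inverse[of "transpose T ** P" T] by simp
  then have "matrix_inv P = T ** transpose T"
    using matrix_inv_eqI[of P "T ** transpose T"] matrix_left_right_inverse[of "T ** transpose T" P]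
    by (simp add: matrix_mul_assoc)
  then have "trace (matrix_inv P ** H) = trace (T ** (transpose T ** H))"
    by (simp add: matrix_mul_assoc)
  also have "\<dots> = trace (transpose T ** H ** T)" by (rule trace_mul_sym)
  finally have tr: "trace (matrix_inv P ** H) = (\<Sum>i\<in>UNIV. d $ i)"
    by (simp add: T2 trace_diagmat)
  then show "0 \<le> trace (matrix_inv P ** H)" using d by (simp add: sum_nonneg)
  have Td: "(det T)\<^sup>2 * det P = 1" "(det T)\<^sup>2 * det H = (\<Prod>i\<in>UNIV. d $ i)"
    using arg_cong[OF T1, of det] arg_cong[OF T2, of det] by (simp_all add: det_mul det_diagmat power2_eq_square mult_ac)
  have "det H / det P = ((det T)\<^sup>2 * det H) / ((det T)\<^sup>2 * det P)"
    using T by (simp add: invertible_det_nz)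
  then have q: "det H / det P = (\<Prod>i\<in>UNIV. d $ i)"
    unfolding Td by simp
  show "det H / det P \<le> (trace (matrix_inv P ** H) / real CARD('n)) ^ CARD('n)"
  proof -
    have "(\<Prod>i\<in>UNIV. d $ i) \<le> ((\<Sum>i\<in>UNIV. d $ i) / real CARD('n)) ^ CARD('n)"
    proof -
      have r: "root CARD('n) (\<Prod>i\<in>UNIV. d $ i) \<le> (\<Sum>i\<in>UNIV. d $ i / real CARD('n))"
        using arith_geom_mean[of "UNIV::'n set" "\<lambda>i. d $ i"] d
        by (simp add: root_powr_inverse prod_nonneg)
      have "(\<Prod>i\<in>UNIV. d $ i) = root CARD('n) (\<Prod>i\<in>UNIV. d $ i) ^ CARD('n)"
        using d by (simp add: prod_nonneg)
      also have "\<dots> \<le> (\<Sum>i\<in>UNIV. d $ i / real CARD('n)) ^ CARD('n)"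
        by (intro power_mono r) (simp add: d prod_nonneg)
      finally show ?thesis by (simp add: sum_divide_distrib)
    qed
    then show ?thesis by (simp add: tr q)
  qed
qed

section \<open>Symplectic matrices and the Cayley transform\<close>

text \<open>The matrix of \<open>omega\<close> with respect to the Euclidean inner product.\<close>

definition Om :: "real ^ ('n::finite + 'n) ^ ('n + 'n)"
  where "Om = (\<chi> a b. case a of
      Inl i \<Rightarrow> (case b of Inl j \<Rightarrow> 0 | Inr j \<Rightarrow> if i = j then 1 else 0)
    | Inr i \<Rightarrow> (case b of Inl j \<Rightarrow> if i = j then - 1 else 0 | Inr j \<Rightarrow> 0))"

lemma sum_UNIV_sum:
  "(\<Sum>a\<in>UNIV. f (a :: 'a::finite + 'b::finite)) = (\<Sum>i\<in>UNIV. f (Inl i)) + (\<Sum>i\<in>UNIV. f (Inr i))"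
  by (subst UNIV_Plus_UNIV[symmetric], subst sum.Plus) simp_all

lemma Om_mv: "(Om *v v) $ Inl i = v $ Inr i" "(Om *v v) $ Inr i = - v $ Inl i"
  by (simp_all add: Om_def matrix_vector_mult_def sum_UNIV_sum if_distrib[of "\<lambda>z. z * _"] cong: if_cong)

lemma omega_eq: "omega u v = u \<bullet> (Om *v v)"
  by (simp add: omega_def inner_vec_def sum_UNIV_sum Om_mv sum_subtractf sum_negf)

lemma vec_sum_eqI: "(\<And>i. x $ Inl i = y $ Inl i) \<Longrightarrow> (\<And>i. x $ Inr i = y $ Inr i) \<Longrightarrow> x = y"
  by (metis obj_sumE vec_eq_iff)

lemma Om_Om: "Om ** Om = - mat 1"
  by (auto simp: matrix_eq matrix_vector_mul_assoc[symmetric] Om_mv matrix_vector_minus_left intro!: vec_sum_eqI)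

lemma transpose_Om: "transpose Om = - Om"
  by (auto simp: vec_eq_iff transpose_def Om_def split: sum.split)

lemma invertible_Om: "invertible Om"
  by (rule invertibleI[of _ "- Om"]) (simp add: matrix_minus_right Om_Om)

text \<open>The square of \<open>1 + Om\<close> is \<open>2 Om\<close>, hence the determinant of \<open>Om\<close>, which is 1 or -1, is
  positive.\<close>

lemma det_Om: "det (Om :: real ^ ('n::finite + 'n) ^ ('n + 'n)) = 1"
proof -
  have "(mat 1 + Om) ** (mat 1 + Om) = 2 *\<^sub>R (Om :: real ^ ('n + 'n) ^ ('n + 'n))"
    by (simp add: mring Om_Om scaleR_2)
  then have "(det (mat 1 + Om :: real ^ ('n + 'n) ^ ('n + 'n)))\<^sup>2 = 2 ^ CARD('n + 'n) * det (Om :: real ^ ('n + 'n) ^ ('n + 'n))"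
    by (metis det_mul det_scaleR power2_eq_square)
  then have "0 \<le> 2 ^ CARD('n + 'n) * det (Om :: real ^ ('n + 'n) ^ ('n + 'n))"
    by (metis zero_le_power2)
  then have nonneg: "0 \<le> det (Om :: real ^ ('n + 'n) ^ ('n + 'n))"
    by (auto simp: zero_le_mult_iff power_le_zero_eq)
  have "det (Om ** transpose (Om :: real ^ ('n + 'n) ^ ('n + 'n))) = 1"
    by (simp add: transpose_Om matrix_minus_right Om_Om)
  then have "(det (Om :: real ^ ('n + 'n) ^ ('n + 'n)))\<^sup>2 = 1"
    by (simp add: det_mul power2_eq_square)
  with nonneg show ?thesis by (metis abs_of_nonneg abs_square_eq_1)
qed

lemma inner_matrix_ext:
  fixes A B :: "real^'n^'n"
  assumes "\<And>u v. u \<bullet> (A *v v) = u \<bullet> (B *v v)" shows "A = B"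
  by (simp add: matrix_eq) (metis assms inner_commute vector_eq_ldot)

lemma Sp_iff: "W \<in> Sp \<longleftrightarrow> transpose W ** Om ** W = Om"
proof -
  have "omega (W *v u) (W *v v) = u \<bullet> ((transpose W ** Om ** W) *v v)" for u v
    by (simp add: omega_eq matrix_vector_mul_assoc[symmetric] inner_vector_matrix)
  then show ?thesis
    unfolding Sp_def by (auto simp: omega_eq intro: inner_matrix_ext)
qed

lemma sp_iff: "X \<in> sp \<longleftrightarrow> transpose (Om ** X) = Om ** X"
proof -
  have "omega u (X *v v) = u \<bullet> ((Om ** X) *v v)" for u v
    by (simp add: omega_eq matrix_vector_mul_assoc)
  moreover have "omega v (X *v u) = u \<bullet> (transpose (Om ** X) *v v)" for u v
    by (simp add: omega_eq matrix_vector_mul_assoc inner_vector_matrix inner_commute)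
  ultimately have "X \<in> sp \<longleftrightarrow> (\<forall>u v. u \<bullet> (transpose (Om ** X) *v v) = u \<bullet> ((Om ** X) *v v))"
    unfolding sp_def by (auto simp del: transpose_matrix_vector) 
  then show ?thesis
    by (auto intro!: inner_matrix_ext simp del: transpose_matrix_vector)
qed

lemma cone_id_iff: "X \<in> cone_id \<longleftrightarrow> X \<noteq> 0 \<and> psd (Om ** X)"
  by (auto simp: cone_id_def sp_iff psd_def omega_eq matrix_vector_mul_assoc)

lemma det_sp: "det (Om ** X) = det X"
  by (simp add: det_mul det_Om)

lemma mat_1_Sp: "mat 1 \<in> Sp"
  by (simp add: Sp_def)

lemma Sp_mult: "A \<in> Sp \<Longrightarrow> B \<in> Sp \<Longrightarrow> A ** B \<in> Sp"
  by (simp add: Sp_def matrix_vector_mul_assoc[symmetric])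

lemma Sp_invertible: "W \<in> Sp \<Longrightarrow> invertible W"
proof -
  assume "W \<in> Sp"
  then have "(- (Om ** transpose W ** Om)) ** W = mat 1"
    unfolding Sp_iff by (simp add: matrix_minus_left matrix_mul_assoc[symmetric] Om_Om)
  then show ?thesis using invertible_left_inverse by blast
qed

lemma Sp_inv: assumes W: "W \<in> Sp" shows "matrix_inv W \<in> Sp"
proof -
  let ?V = "matrix_inv W"
  have "transpose ?V ** Om ** ?V = transpose ?V ** (transpose W ** Om ** W) ** ?V"
    using W by (simp add: Sp_iff)
  also have "\<dots> = transpose (W ** ?V) ** Om ** (W ** ?V)"
    by (simp add: mtrans matrix_mul_assoc)
  finally show ?thesis using W by (simp add: Sp_iff matrix_inv_right Sp_invertible)
qed

lemma Sp_inv_eq: "W \<in> Sp \<Longrightarrow> matrix_inv W = - (Om ** transpose W ** Om)"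
proof -
  assume "W \<in> Sp"
  then have "(- (Om ** transpose W ** Om)) ** W = mat 1"
    unfolding Sp_iff by (simp add: matrix_minus_left matrix_mul_assoc[symmetric] Om_Om)
  then show ?thesis by (meson matrix_inv_eqI matrix_left_right_inverse)
qed

lemma Om_conj:
  assumes "W \<in> Sp"
  shows "Om ** (W ** X ** matrix_inv W) = transpose (matrix_inv W) ** (Om ** X) ** matrix_inv W"
proof -
  have "transpose (matrix_inv W) ** Om = transpose (matrix_inv W) ** (transpose W ** Om ** W)"
    using assms by (simp add: Sp_iff)
  also have "\<dots> = transpose (W ** matrix_inv W) ** Om ** W"
    by (simp add: mtrans matrix_mul_assoc)
  finally have "Om ** W = transpose (matrix_inv W) ** Om"
    using assms by (simp add: matrix_inv_right Sp_invertible)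
  then show ?thesis by (simp add: matrix_mul_assoc)
qed

lemma psd_conj: "W \<in> Sp \<Longrightarrow> psd (Om ** X) \<Longrightarrow> psd (Om ** (W ** X ** matrix_inv W))"
  unfolding Om_conj by (rule psd_congruence)

lemma det_conj: "invertible W \<Longrightarrow> det (W ** X ** matrix_inv (W::real^'n^'n)) = det X"
  by (simp add: det_mul det_matrix_inv invertible_det_nz)

definition cayley :: "real^'n^'n \<Rightarrow> real^'n^'n"
  where "cayley M = (mat 1 + M) ** matrix_inv (mat 1 - M)"

definition cayley_inv :: "real^'n^'n \<Rightarrow> real^'n^'n"
  where "cayley_inv W = (W - mat 1) ** matrix_inv (W + mat 1)"

lemma cayley_plus_one:
  assumes "invertible (mat 1 - M)"
  shows "cayley M + mat 1 = 2 *\<^sub>R matrix_inv (mat 1 - M)"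
    and "cayley M - mat 1 = 2 *\<^sub>R (M ** matrix_inv (mat 1 - M))"
    and "invertible (cayley M + mat 1)"
proof -
  let ?R = "matrix_inv (mat 1 - M)"
  have R: "?R - M ** ?R = mat 1"
    using matrix_inv_right[OF assms] by (simp add: mring)
  have c: "cayley M = ?R + M ** ?R" by (simp add: cayley_def mring)
  show 1: "cayley M + mat 1 = 2 *\<^sub>R ?R"
    unfolding c by (subst R[symmetric]) (simp add: scaleR_2)
  show "cayley M - mat 1 = 2 *\<^sub>R (M ** ?R)"
    unfolding c by (subst R[symmetric]) (simp add: scaleR_2)
  show "invertible (cayley M + mat 1)"
    unfolding 1 by (rule invertibleI[of _ "(1/2) *\<^sub>R (mat 1 - M)"])
      (simp add: scaleR_matrix_left scaleR_matrix_right matrix_inv_left assms)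
qed

lemma cayley_inv_cayley:
  assumes "invertible (mat 1 - M)"
  shows "cayley_inv (cayley M) = M"
proof -
  have "matrix_inv (cayley M + mat 1) = (1/2) *\<^sub>R (mat 1 - M)"
    by (rule matrix_inv_eqI)
      (simp add: cayley_plus_one(1)[OF assms] scaleR_matrix_left scaleR_matrix_right matrix_inv_left assms)
  then show ?thesis
    unfolding cayley_inv_def cayley_plus_one(2)[OF assms]
    by (simp add: scaleR_matrix_left scaleR_matrix_right matrix_mul_assoc[symmetric] matrix_inv_left assms)
qed

lemma cayley_inv_one_minus:
  assumes "invertible (W + mat 1)"
  shows "mat 1 - cayley_inv W = 2 *\<^sub>R matrix_inv (W + mat 1)"
    and "mat 1 + cayley_inv W = 2 *\<^sub>R (W ** matrix_inv (W + mat 1))"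
    and "invertible (mat 1 - cayley_inv W)"
proof -
  let ?R = "matrix_inv (W + mat 1)"
  have R: "W ** ?R + ?R = mat 1"
    using matrix_inv_right[OF assms] by (simp add: mring)
  have c: "cayley_inv W = W ** ?R - ?R" by (simp add: cayley_inv_def mring)
  show 1: "mat 1 - cayley_inv W = 2 *\<^sub>R ?R"
    unfolding c by (subst R[symmetric]) (simp add: scaleR_2)
  show "mat 1 + cayley_inv W = 2 *\<^sub>R (W ** ?R)"
    unfolding c by (subst R[symmetric]) (simp add: scaleR_2)
  show "invertible (mat 1 - cayley_inv W)"
    unfolding 1 by (rule invertibleI[of _ "(1/2) *\<^sub>R (W + mat 1)"])
      (simp add: scaleR_matrix_left scaleR_matrix_right matrix_inv_left assms)
qed

lemma cayley_cayley_inv: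
  assumes "invertible (W + mat 1)"
  shows "cayley (cayley_inv W) = W"
proof -
  have "matrix_inv (mat 1 - cayley_inv W) = (1/2) *\<^sub>R (W + mat 1)"
    by (rule matrix_inv_eqI)
      (simp add: cayley_inv_one_minus(1)[OF assms] scaleR_matrix_left scaleR_matrix_right matrix_inv_left assms)
  then show ?thesis
    unfolding cayley_def cayley_inv_one_minus(2)[OF assms]
    by (simp add: scaleR_matrix_left scaleR_matrix_right matrix_mul_assoc[symmetric] matrix_inv_left assms)
qed

lemma sp_transpose: "X \<in> sp \<longleftrightarrow> transpose X ** Om = - (Om ** X)"
  by (auto simp: sp_iff mtrans transpose_Om matrix_minus_right) (metis minus_minus)

lemma sp_one_plus_transpose:
  "X \<in> sp \<Longrightarrow> transpose (mat 1 + X) ** Om = Om ** (mat 1 - X)"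
  by (simp add: sp_transpose mtrans mring)

lemma sp_one_minus_transpose:
  "X \<in> sp \<Longrightarrow> transpose (mat 1 - X) ** Om = Om ** (mat 1 + X)"
  by (simp add: sp_transpose mtrans mring)

lemma cayley_Sp:
  assumes M: "M \<in> sp" and inv: "invertible (mat 1 - M)"
  shows "cayley M \<in> Sp"
proof -
  let ?R = "matrix_inv (mat 1 - M)"
  have comm: "(mat 1 - M) ** (mat 1 + M) = (mat 1 + M) ** (mat 1 - M)" by (simp add: mring)
  have "transpose (cayley M) ** Om ** cayley M = transpose ?R ** (transpose (mat 1 + M) ** Om) ** (mat 1 + M) ** ?R"
    by (simp add: cayley_def mtrans matrix_mul_assoc)
  also have "\<dots> = transpose ?R ** Om ** ((mat 1 - M) ** (mat 1 + M)) ** ?R"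
    unfolding sp_one_plus_transpose[OF M] by (simp only: matrix_mul_assoc)
  also have "\<dots> = transpose ?R ** (Om ** (mat 1 + M)) ** ((mat 1 - M) ** ?R)"
    unfolding comm by (simp only: matrix_mul_assoc)
  also have "\<dots> = transpose ((mat 1 - M) ** ?R) ** Om ** ((mat 1 - M) ** ?R)"
    unfolding sp_one_minus_transpose[OF M, symmetric] by (simp only: matrix_transpose_mul matrix_mul_assoc)
  finally show ?thesis unfolding Sp_iff matrix_inv_right[OF inv] by simp
qed

lemma cayley_inv_sp:
  assumes W: "W \<in> Sp" and inv: "invertible (W + mat 1)"
  shows "cayley_inv W \<in> sp"
proof -
  let ?R = "matrix_inv (W + mat 1)"
  define S where "S = transpose (W + mat 1) ** Om ** (W - mat 1)"
  have S: "transpose S = S"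
    using W unfolding Sp_iff S_def by (simp add: mtrans mring transpose_Om)
  have "(W + mat 1) ** ?R = mat 1" by (rule matrix_inv_right[OF inv])
  then have "transpose ?R ** transpose (W + mat 1) = mat 1"
    by (metis matrix_transpose_mul transpose_mat)
  then have "Om ** cayley_inv W = transpose ?R ** S ** ?R"
    unfolding cayley_inv_def S_def by (simp add: matrix_mul_assoc)
  then show ?thesis
    unfolding sp_iff by (simp add: matrix_transpose_mul S) (simp add: matrix_mul_assoc)
qed

text \<open>A fixed vector of \<open>M\<close> or \<open>- M\<close> would be isotropic, since \<open>Om\<close> is skew.\<close>

lemma pd_one_minus_invertible:
  assumes "pd (Om ** M)" shows "invertible (mat 1 - M)" "invertible (mat 1 + M)"
proof -
  have *: "v = 0" if "M *v v = c *\<^sub>R v" for v c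
  proof (rule ccontr)
    assume "v \<noteq> 0"
    with assms have "0 < v \<bullet> ((Om ** M) *v v)" by (simp add: pd_def)
    also have "\<dots> = c * omega v v" by (simp add: omega_eq matrix_vector_mul_assoc[symmetric] that mvec)
    finally show False by (simp add: omega_def mult.commute)
  qed
  show "invertible (mat 1 - M)" "invertible (mat 1 + M)"
    unfolding invertible_iff_ker using *[of _ 1] *[of _ "-1"]
    by (auto simp: mvec add_eq_0_iff)
qed

text \<open>In the Cayley chart a curve with generator \<open>X\<close> moves the quadratic form \<open>Om ** M\<close> by a
  congruence transform of the form \<open>Om ** X\<close>: curves tangent to the cone are the curves of
  symmetric matrices which increase.\<close>

lemma has_vector_derivative_cayley_inv:
  assumes W: "(W has_vector_derivative X ** W t) (at t within S)" and inv: "invertible (W t + mat 1)"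
  shows "((\<lambda>t. cayley_inv (W t)) has_vector_derivative
     (1/2) *\<^sub>R ((mat 1 - cayley_inv (W t)) ** X ** (mat 1 + cayley_inv (W t)))) (at t within S)"
proof -
  let ?R = "matrix_inv (W t + mat 1)"
  have Wp: "((\<lambda>t. W t + mat 1) has_vector_derivative X ** W t) (at t within S)"
    using has_vector_derivative_add[OF W has_vector_derivative_const] by simp
  have Wm: "((\<lambda>t. W t - mat 1) has_vector_derivative X ** W t) (at t within S)"
    using has_vector_derivative_diff[OF W has_vector_derivative_const] by simp
  have "((\<lambda>t. cayley_inv (W t)) has_vector_derivative
     (W t - mat 1) ** (- (?R ** (X ** W t) ** ?R)) + X ** W t ** ?R) (at t within S)"
    unfolding cayley_inv_def
    by (rule has_vector_derivative_matrix_mult[OF Wm has_vector_derivative_matrix_inv[OF Wp inv]])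
  moreover have "(W t - mat 1) ** (- (?R ** (X ** W t) ** ?R)) + X ** W t ** ?R
    = (mat 1 - cayley_inv (W t)) ** (X ** W t ** ?R)"
    by (simp add: cayley_inv_def mring)
  moreover have "X ** W t ** ?R = (1/2) *\<^sub>R (X ** (mat 1 + cayley_inv (W t)))"
    unfolding cayley_inv_one_minus(2)[OF inv] by (simp add: scaleR_matrix_right matrix_mul_assoc)
  ultimately show ?thesis
    by (simp only: scaleR_matrix_right matrix_mul_assoc)
qed

lemma Om_cayley_derivative:
  assumes "M \<in> sp"
  shows "Om ** ((1/2) *\<^sub>R ((mat 1 - M) ** X ** (mat 1 + M)))
    = (1/2) *\<^sub>R (transpose (mat 1 + M) ** (Om ** X) ** (mat 1 + M))"
  using sp_one_plus_transpose[OF assms] by (simp add: scaleR_matrix_right matrix_mul_assoc)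

section \<open>The positively elliptic region in the Cayley chart\<close>

text \<open>A real matrix acts separately on the real and imaginary parts of a complex vector, which reduces
  the computations with complex vectors to real ones.\<close>

definition re_part :: "complex^'n \<Rightarrow> real^'n" where "re_part v = (\<chi> i. Re (v $ i))"
definition im_part :: "complex^'n \<Rightarrow> real^'n" where "im_part v = (\<chi> i. Im (v $ i))"
definition conj_vec :: "complex^'n \<Rightarrow> complex^'n" where "conj_vec v = (\<chi> i. cnj (v $ i))"

lemma complex_vec_eq_iff: "u = v \<longleftrightarrow> re_part u = re_part v \<and> im_part u = im_part v"
  by (auto simp: re_part_def im_part_def vec_eq_iff complex_eq_iff)

lemma parts_zero [simp]: "re_part 0 = 0" "im_part 0 = 0"
  by (simp_all add: re_part_def im_part_def vec_eq_iff)

lemma parts_complexify [simp]: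
  "re_part (complexify W *v v) = W *v re_part v"
  "im_part (complexify W *v v) = W *v im_part v"
  by (simp_all add: re_part_def im_part_def complexify_def map_matrix_def matrix_vector_mult_def vec_eq_iff)

lemma parts_conj [simp]: "re_part (conj_vec v) = re_part v" "im_part (conj_vec v) = - im_part v"
  by (simp_all add: re_part_def im_part_def conj_vec_def vec_eq_iff)

lemma complexify_mult: "complexify (A ** B) = complexify A ** complexify B"
  by (simp add: complexify_def map_matrix_def matrix_matrix_mult_def vec_eq_iff)

lemma complexify_add: "complexify (A + B) = complexify A + complexify B"
  by (simp add: complexify_def map_matrix_def vec_eq_iff)

lemma complexify_diff: "complexify (A - B) = complexify A - complexify B"
  by (simp add: complexify_def map_matrix_def vec_eq_iff)

lemma complexify_minus: "complexify (- A) = - complexify A"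
  by (simp add: complexify_def map_matrix_def vec_eq_iff)

lemma complexify_scaleR: "complexify (c *\<^sub>R A) = c *\<^sub>R complexify A"
  by (simp add: complexify_def map_matrix_def vec_eq_iff scaleR_conv_of_real[where 'a = complex])

lemma complexify_mat_1: "complexify (mat 1) = mat 1"
  by (simp add: complexify_def map_matrix_def vec_eq_iff mat_def)

lemma complexify_diagmat: "complexify (diagmat d) = diagmat (\<chi> i. complex_of_real (d $ i))"
  by (simp add: complexify_def map_matrix_def vec_eq_iff diagmat_def)

lemma complexify_transpose: "complexify (transpose A) = transpose (complexify A)"
  by (simp add: complexify_def map_matrix_def vec_eq_iff transpose_def)

lemma complexify_invertible: "invertible A \<Longrightarrow> invertible (complexify A)"
  by (rule invertibleI[of _ "complexify (matrix_inv A)"])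
    (simp add: complexify_mult[symmetric] complexify_mat_1 matrix_inv_right)

lemma det_complexify: "det (complexify A) = complex_of_real (det A)"
  by (simp add: det_def complexify_def map_matrix_def)

lemma kappa_eq:
  "kappa u v = Complex (omega (im_part u) (re_part v) - omega (re_part u) (im_part v))
     (- (omega (re_part u) (re_part v) + omega (im_part u) (im_part v)))"
  by (simp add: complex_eq_iff kappa_def omega_def re_part_def im_part_def sum_subtractf[symmetric]
      sum.distrib[symmetric] sum_negf[symmetric] algebra_simps)

lemma kappa_linear:
  "kappa (u + u') v = kappa u v + kappa u' v" "kappa (z *s u) v = z * kappa u v"
  "kappa u (v + v') = kappa u v + kappa u v'" "kappa u (z *s v) = cnj z * kappa u v"
  by (simp_all add: kappa_def sum_distrib_left sum.distrib sum_subtractf sum_negf algebra_simps)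

lemma kappa_self_real: "kappa v v = complex_of_real (Re (kappa v v))"
  by (simp add: kappa_eq complex_eq_iff omega_def sum_subtractf sum.distrib mult.commute)

lemma kappa_conj: "kappa (conj_vec v) (conj_vec v) = - kappa v v"
  by (simp add: kappa_eq complex_eq_iff omega_def sum_subtractf sum.distrib sum_negf mult.commute)

lemma kappa_Sp: "W \<in> Sp \<Longrightarrow> kappa (complexify W *v u) (complexify W *v v) = kappa u v"
  by (simp add: kappa_eq Sp_def)

lemma kappa_sp: "X \<in> sp \<Longrightarrow> kappa (complexify X *v u) v = - kappa u (complexify X *v v)"
proof -
  assume "X \<in> sp"
  then have "omega (X *v a) b = - omega a (X *v b)" for a b
  proof -
    have "omega (X *v a) b = - omega b (X *v a)"
      by (simp add: omega_def sum_subtractf mult.commute)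
    then show ?thesis using \<open>X \<in> sp\<close> by (simp add: sp_def)
  qed
  then show ?thesis by (simp add: kappa_eq complex_eq_iff)
qed

text \<open>The quadratic form of \<open>M\<close>, extended to a Hermitian form.\<close>

definition herm :: "('n::finite) rmat \<Rightarrow> complex ^ ('n + 'n) \<Rightarrow> real"
  where "herm M v = re_part v \<bullet> ((Om ** M) *v re_part v) + im_part v \<bullet> ((Om ** M) *v im_part v)"

lemma kappa_herm: "M \<in> sp \<Longrightarrow> kappa v (complexify M *v v) = - \<i> * herm M v"
  by (simp add: kappa_eq complex_eq_iff herm_def sp_def omega_eq matrix_vector_mul_assoc)

lemma herm_pos: "pd (Om ** M) \<Longrightarrow> v \<noteq> 0 \<Longrightarrow> 0 < herm M v"
proof -
  assume M: "pd (Om ** M)" and v: "v \<noteq> 0"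
  have nn: "0 \<le> x \<bullet> ((Om ** M) *v x)" for x
    using pd_imp_psd[OF M] by (simp add: psd_def)
  have "re_part v \<noteq> 0 \<or> im_part v \<noteq> 0" using v by (auto simp: complex_vec_eq_iff)
  then show ?thesis
    unfolding herm_def using M nn unfolding pd_def by (metis add_nonneg_pos add_pos_nonneg)
qed

lemma poly_det: "poly (det (A :: complex poly^'n^'n)) z = det (\<chi> i j. poly (A $ i $ j) z)"
proof -
  have [simp]: "poly (of_int k) z = of_int k" for k by (cases k) simp_all
  show ?thesis by (simp add: det_def poly_sum poly_prod)
qed

lemma poly_charpoly: "poly (charpoly A) z = det (mat z - A)"
proof -
  have "(\<chi> i j. poly ((mat [:0, 1:] - map_matrix (\<lambda>a. [:a:]) A) $ i $ j) z) = mat z - A"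
    by (simp add: vec_eq_iff mat_def map_matrix_def)
  then show ?thesis by (simp add: charpoly_def poly_det)
qed

lemma mat_mult_vec: "mat z *v v = z *s (v :: 'a::comm_semiring_1^'n)"
  by (simp add: matrix_vector_mult_def mat_def vec_eq_iff if_distrib[of "\<lambda>z. z * _"] cong: if_cong)

lemma det_eigen: "det (mat z - A) = 0 \<longleftrightarrow> (\<exists>v. v \<noteq> 0 \<and> A *v v = z *s (v :: 'a::field^'n))"
proof -
  have "det (mat z - A) = 0 \<longleftrightarrow> \<not> invertible (mat z - A)" by (simp add: invertible_det_nz)
  then show ?thesis unfolding invertible_iff_ker
    by (auto simp: matrix_vector_mult_diff_rdistrib mat_mult_vec eq_commute[of "_ *s _"])
qed

text \<open>A zero characteristic polynomial would make every number an eigenvalue, also those above the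
  operator norm.\<close>

lemma charpoly_nonzero: "charpoly (A :: ('n::finite) cmat) \<noteq> 0"
proof
  assume "charpoly A = 0"
  then have *: "det (mat z - A) = 0" for z by (simp add: poly_charpoly[symmetric])
  have bl: "bounded_linear ((*v) A)" by simp
  obtain K where K: "\<And>v. norm (A *v v) \<le> norm v * K"
    using bounded_linear.bounded[OF bl] by blast
  obtain v where v: "v \<noteq> 0" "A *v v = of_real (\<bar>K\<bar> + 1) *s v"
    using *[of "of_real (\<bar>K\<bar> + 1)"] by (auto simp: det_eigen)
  have "of_real (\<bar>K\<bar> + 1) *s v = (\<bar>K\<bar> + 1) *\<^sub>R v"
    by (simp add: vec_eq_iff scaleR_conv_of_real[where 'a = complex] ring_distribs)
  with K[of v] v have "(\<bar>K\<bar> + 1) * norm v \<le> norm v * K" by simp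
  then have "(\<bar>K\<bar> + 1 - K) * norm v \<le> 0" by (simp add: algebra_simps)
  then have "(\<bar>K\<bar> + 1 - K) \<le> 0" using v(1) by (simp add: mult_le_0_iff)
  then show False by linarith
qed

lemma eigenvalues_iff: "z \<in># eigenvalues W \<longleftrightarrow> (\<exists>v. v \<noteq> 0 \<and> complexify W *v v = z *s v)"
  unfolding eigenvalues_def
  by (simp add: set_count_proots charpoly_nonzero poly_charpoly det_eigen)

text \<open>The vector \<open>p(A) v\<close>. It serves to find an eigenvector in an invariant subspace: take a polynomial of
  least degree which annihilates a nonzero vector of the subspace, and split off a linear factor.\<close>

definition poly_act :: "complex^'n^'n \<Rightarrow> complex poly \<Rightarrow> complex^'n \<Rightarrow> complex^'n"
  where "poly_act A p v = fold_coeffs (\<lambda>a w. a *s v + A *v w) p 0"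

lemma poly_act_0 [simp]: "poly_act A 0 v = 0"
  by (simp add: poly_act_def)

lemma poly_act_pCons [simp]: "poly_act A (pCons a p) v = a *s v + A *v poly_act A p v"
  by (cases "p = 0 \<and> a = 0") (auto simp: poly_act_def fold_coeffs_pCons_coeff_not_0_eq fold_coeffs_pCons_not_0_0_eq)

lemma matrix_vector_smult: "A *v (c *s v) = c *s (A *v (v :: 'a::comm_semiring_1^'n))"
  by (simp add: matrix_vector_mult_def vec_eq_iff sum_distrib_left mult_ac)

lemma poly_act_add: "poly_act A (p + q) v = poly_act A p v + poly_act A q v"
  by (induction p q rule: poly_induct2) (simp_all add: mvec vector_sadd_rdistrib add_ac)

lemma poly_act_smult: "poly_act A (smult c p) v = c *s poly_act A p v"
  by (induction p) (simp_all add: mvec matrix_vector_smult vector_add_ldistrib vector_smult_assoc)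

lemma poly_act_diff: "poly_act A (p - q) v = poly_act A p v - poly_act A q v"
  using poly_act_add[of A p "smult (-1) q" v] by (simp only: poly_act_smult) simp

lemma poly_act_linear_factor:
  "poly_act A ([:- z, 1:] * p) v = A *v poly_act A p v - z *s poly_act A p v"
  by (simp add: poly_act_diff poly_act_smult)

lemma poly_act_monom: "poly_act A (monom c k) v = c *s (((*v) A ^^ k) v)"
  by (induction k) (simp_all add: monom_0 monom_Suc matrix_vector_smult)

lemma poly_act_sum: "finite I \<Longrightarrow> poly_act A (\<Sum>i\<in>I. p i) v = (\<Sum>i\<in>I. poly_act A (p i) v)"
  by (induction I rule: finite_induct) (simp_all add: poly_act_add)

lemma annihilating_poly_exists:
  fixes A :: "complex^'n^'n"
  shows "\<exists>p. p \<noteq> 0 \<and> poly_act A p v = 0"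
proof (cases "inj_on (\<lambda>k. ((*v) A ^^ k) v) {..CARD('n)}")
  case False
  then obtain i j where ij: "i \<noteq> j" "((*v) A ^^ i) v = ((*v) A ^^ j) v"
    by (auto simp: inj_on_def)
  then have "poly_act A (monom 1 i + monom (-1) j) v = 0"
    by (simp add: poly_act_add poly_act_monom)
  moreover have "coeff (monom 1 i + monom (-1) j) i = (1::complex)"
    using ij(1) by simp
  then have "monom 1 i + monom (-1::complex) j \<noteq> 0"
    by (metis coeff_0 zero_neq_one)
  ultimately show ?thesis by blast
next
  case True
  let ?w = "\<lambda>k. ((*v) A ^^ k) v"
  let ?S = "?w ` {..CARD('n)}"
  have "card ?S = Suc CARD('n)" using True by (simp add: card_image)
  then have "vec.dependent ?S"
    using vec.independent_card_le_dim[of ?S UNIV] by (auto simp: vec.dim_UNIV card_cart_basis)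
  then obtain c x0 where c: "(\<Sum>x\<in>?S. c x *s x) = 0" "x0 \<in> ?S" "c x0 \<noteq> 0"
    by (auto simp: vec.dependent_finite)
  define p where "p = (\<Sum>k\<le>CARD('n). monom (c (?w k)) k)"
  have "poly_act A p v = (\<Sum>k\<le>CARD('n). c (?w k) *s ?w k)"
    by (simp add: p_def poly_act_sum poly_act_monom)
  also have "\<dots> = 0"
    using c(1) by (simp add: sum.reindex[OF True] o_def)
  finally have "poly_act A p v = 0" .
  moreover obtain k where "k \<le> CARD('n)" "c (?w k) \<noteq> 0" using c by auto
  then have "coeff p k \<noteq> 0"
    by (simp add: p_def coeff_sum)
  then have "p \<noteq> 0" by auto
  ultimately show ?thesis by blast
qed

lemma eigenvector_in_invariant_subspace:
  fixes A :: "complex^'n^'n"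
  assumes T: "vec.subspace T" and inv: "\<And>v. v \<in> T \<Longrightarrow> A *v v \<in> T" and ne: "v0 \<in> T" "v0 \<noteq> 0"
  obtains v z where "v \<in> T" "v \<noteq> 0" "A *v v = z *s v"
proof -
  define P where "P p \<longleftrightarrow> p \<noteq> 0 \<and> (\<exists>v\<in>T. v \<noteq> 0 \<and> poly_act A p v = 0)" for p
  have "\<exists>p. P p" using annihilating_poly_exists[of A v0] ne by (auto simp: P_def)
  then obtain p where p: "P p" and mn: "\<And>q. P q \<Longrightarrow> degree p \<le> degree q"
    using ex_has_least_nat[of P _ degree] by metis
  then obtain v where v: "v \<in> T" "v \<noteq> 0" "poly_act A p v = 0" by (auto simp: P_def)
  have "degree p \<noteq> 0"
  proof
    assume "degree p = 0"
    then obtain a where "p = [:a:]" by (metis degree_eq_zeroE)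
    with p v show False by (auto simp: P_def vec_eq_iff)
  qed
  then obtain z where "poly p z = 0"
    using fundamental_theorem_of_algebra[of p] by (metis constant_degree)
  then obtain q where q: "p = [:- z, 1:] * q" by (metis dvdE poly_eq_0_iff_dvd)
  have qn: "q \<noteq> 0" using p q by (auto simp: P_def)
  then have "degree q < degree p" unfolding q by (subst degree_mult_eq) auto
  then have "poly_act A q v \<noteq> 0" using mn[of q] qn v by (auto simp: P_def)
  moreover have "poly_act A q v \<in> T"
    using T v(1) by (induction q) (auto simp: vec.subspace_0 intro!: vec.subspace_add vec.subspace_scale inv)
  moreover have "A *v poly_act A q v = z *s poly_act A q v"
    using v(3) unfolding q poly_act_linear_factor by simp
  ultimately show ?thesis using that by blast
qed

lemma Sp_eigenvalue_nonzero:
  "W \<in> Sp \<Longrightarrow> complexify W *v v = z *s v \<Longrightarrow> v \<noteq> 0 \<Longrightarrow> z \<noteq> 0"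
  using complexify_invertible[OF Sp_invertible] invertible_iff_ker by fastforce

text \<open>A symplectic matrix whose eigenvectors are all of the correct Krein sign has a positive
  definite Cayley transform: one splits off one eigenvector after the other, since the
  \<open>kappa\<close>-orthogonal complement of an eigenvector is invariant.\<close>

lemma herm_pos_on_invariant:
  fixes W :: "('n::finite) rmat"
  assumes W: "W \<in> Sp" and M: "M \<in> sp"
    and eig: "\<And>v z. v \<noteq> 0 \<Longrightarrow> complexify W *v v = z *s v \<Longrightarrow>
      0 < herm M v \<and> kappa v v \<noteq> 0 \<and> (\<exists>\<mu>. complexify M *v v = \<mu> *s v)"
  shows "vec.subspace T \<Longrightarrow> (\<forall>v\<in>T. complexify W *v v \<in> T) \<Longrightarrow> x \<in> T \<Longrightarrow> x \<noteq> 0 \<Longrightarrow> 0 < herm M x"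
proof (induction "vec.dim T" arbitrary: T x rule: less_induct)
  case less
  obtain v z where v: "v \<in> T" "v \<noteq> 0" and Wv: "complexify W *v v = z *s v"
    using eigenvector_in_invariant_subspace[OF less.prems(1) _ less.prems(3,4)] less.prems(2) by metis
  obtain \<mu> where Mv: "complexify M *v v = \<mu> *s v" and hv: "0 < herm M v" and kv: "kappa v v \<noteq> 0"
    using eig[OF v(2) Wv] by blast
  have z0: "z \<noteq> 0" using Sp_eigenvalue_nonzero[OF W Wv v(2)] .
  define T' where "T' = {u\<in>T. kappa u v = 0}"
  have sub: "vec.subspace T'"
    using less.prems(1) by (auto simp: T'_def vec.subspace_def kappa_linear kappa_def[of 0])
  have inv': "\<forall>u\<in>T'. complexify W *v u \<in> T'"
  proof
    fix u assume u: "u \<in> T'"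
    have "cnj z * kappa (complexify W *v u) v = kappa (complexify W *v u) (complexify W *v v)"
      by (simp add: Wv kappa_linear)
    also have "\<dots> = 0" using u by (simp add: kappa_Sp[OF W] T'_def)
    finally show "complexify W *v u \<in> T'" using u z0 less.prems(2) by (auto simp: T'_def)
  qed
  have "T' \<subset> T" using v(1) kv by (auto simp: T'_def)
  then have dim: "vec.dim T' < vec.dim T"
    using vec.dim_psubset[of T' T] sub less.prems(1) by (simp add: vec.span_eq_iff[THEN iffD2])
  define c where "c = kappa x v / kappa v v"
  define u where "u = x - c *s v"
  have xu: "x = c *s v + u" by (simp add: u_def)
  have "kappa u v = 0"
    using kv kappa_linear(1)[of u "c *s v" v] by (simp add: u_def kappa_linear c_def)
  then have u: "u \<in> T'"
    using less.prems(1,3) v(1) by (auto simp: T'_def u_def vec.subspace_diff vec.subspace_scale)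
  have "kappa v (complexify M *v u) = - kappa (complexify M *v v) u" by (simp add: kappa_sp[OF M])
  also have "\<dots> = - \<mu> * kappa v u" by (simp add: Mv kappa_linear)
  also have "kappa v u = 0"
  proof -
    have "kappa v u = cnj (kappa u v)"
      by (simp add: kappa_eq complex_eq_iff omega_def sum_subtractf mult.commute)
    then show ?thesis using u by (simp add: T'_def)
  qed
  finally have c1: "kappa v (complexify M *v u) = 0" by simp
  have c2: "kappa u (complexify M *v v) = 0" using u by (simp add: Mv kappa_linear T'_def)
  have "kappa x (complexify M *v x) = c * cnj c * kappa v (complexify M *v v) + kappa u (complexify M *v u)"
    unfolding xu by (simp add: mvec matrix_vector_smult kappa_linear c1 c2)
  moreover have "c * cnj c = complex_of_real ((cmod c)\<^sup>2)" by (rule complex_norm_square[symmetric])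
  ultimately have "- \<i> * herm M x = - \<i> * ((cmod c)\<^sup>2 * herm M v + herm M u)"
    unfolding kappa_herm[OF M] by (simp add: algebra_simps)
  then have eq: "herm M x = (cmod c)\<^sup>2 * herm M v + herm M u"
    by (simp add: complex_eq_iff)
  show ?case
  proof (cases "u = 0")
    case True
    then have "c \<noteq> 0" using xu less.prems(4) by auto
    then show ?thesis using eq True hv by (simp add: herm_def)
  next
    case False
    have "0 < herm M u" by (rule less.hyps[OF dim sub inv' u False])
    then show ?thesis using eq hv by (simp add: add_nonneg_pos)
  qed
qed

text \<open>The Cayley transform maps \<open>cis \<theta>\<close> to \<open>i tan (\<theta> / 2)\<close>.\<close>

lemma unit_circle_cayley:
  assumes "cmod z = 1" "z \<noteq> -1"
  shows "(z - 1) / (z + 1) = \<i> * complex_of_real (Im z / (1 + Re z))" "0 < 1 + Re z"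
proof -
  have q: "(Re z)\<^sup>2 + (Im z)\<^sup>2 = 1" using assms(1) by (simp add: cmod_def)
  have "Re z \<noteq> - 1"
  proof
    assume "Re z = - 1"
    with q have "Im z = 0" by simp
    with \<open>Re z = -1\<close> assms(2) show False by (simp add: complex_eq_iff)
  qed
  moreover have "\<bar>Re z\<bar> \<le> 1" using assms(1) abs_Re_le_cmod[of z] by simp
  ultimately show pos: "0 < 1 + Re z" by linarith
  have nz: "z + 1 \<noteq> 0" using assms(2) by (metis add_diff_cancel_right' diff_0)
  have "\<i> * complex_of_real (Im z / (1 + Re z)) * (z + 1) = z - 1"
    using pos q by (simp add: complex_eq_iff field_simps power2_eq_square)
  with nz show "(z - 1) / (z + 1) = \<i> * complex_of_real (Im z / (1 + Re z))"
    by (simp add: field_simps)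
qed

lemma Sp_ell_plus_plus_one_invertible:
  assumes "W \<in> Sp_ell_plus"
  shows "invertible (W + mat 1)"
proof (rule ccontr)
  assume "\<not> invertible (W + mat 1)"
  then obtain x where x: "x \<noteq> 0" "W *v x = - x"
    by (auto simp: invertible_iff_ker mvec add_eq_0_iff2)
  define v where "v = (\<chi> i. complex_of_real (x $ i))"
  have vp: "re_part v = x" "im_part v = 0" by (simp_all add: v_def re_part_def im_part_def vec_eq_iff)
  have "complexify W *v v = (-1) *s v"
    using x(2) by (simp add: complex_vec_eq_iff vp) (simp add: re_part_def im_part_def v_def vec_eq_iff)
  moreover have "v \<noteq> 0" using x vp by auto
  ultimately have "- 1 \<in># eigenvalues W" by (auto simp: eigenvalues_iff)
  then show False using assms by (auto simp: Sp_ell_plus_def)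
qed

lemma eigenvector_cayley_inv:
  assumes inv: "invertible (W + mat 1)" and Wv: "complexify W *v v = z *s v" and v: "v \<noteq> 0"
  shows "z \<noteq> -1" "complexify (cayley_inv W) *v v = ((z - 1) / (z + 1)) *s v"
proof -
  have W1: "complexify (W + mat 1) *v v = (z + 1) *s v"
    by (simp add: complexify_add complexify_mat_1 mvec Wv vec_eq_iff algebra_simps)
  have "(z + 1) *s v \<noteq> 0"
    using complexify_invertible[OF inv] v unfolding W1[symmetric] invertible_iff_ker by blast
  then have z1: "z + 1 \<noteq> 0" by (metis vector_smult_lzero)
  then show "z \<noteq> -1" by auto
  have "complexify (matrix_inv (W + mat 1)) *v ((z + 1) *s v) = v"
    unfolding W1[symmetric] by (simp add: matrix_vector_mul_assoc complexify_mult[symmetric] matrix_inv_left inv complexify_mat_1)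
  then have "(1 / (z + 1)) *s ((z + 1) *s (complexify (matrix_inv (W + mat 1)) *v v)) = (1 / (z + 1)) *s v"
    by (simp only: matrix_vector_smult)
  then have R: "complexify (matrix_inv (W + mat 1)) *v v = (1 / (z + 1)) *s v"
    using z1 by (simp only: vector_smult_assoc) simp
  have Wm: "complexify (W - mat 1) *v v = (z - 1) *s v"
    by (simp add: complexify_diff complexify_mat_1 mvec Wv vec_eq_iff algebra_simps)
  show "complexify (cayley_inv W) *v v = ((z - 1) / (z + 1)) *s v"
    unfolding cayley_inv_def complexify_mult matrix_vector_mul_assoc[symmetric] R matrix_vector_smult Wm
      vector_smult_assoc by simp
qed

text \<open>On an eigenvector \<open>v\<close> with eigenvalue \<open>cis \<theta>\<close> the Cayley transform acts as \<open>i tan (\<theta> / 2)\<close>, so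
  \<open>herm M v = tan (\<theta> / 2) * kappa v v\<close>, and the condition on the signs says that this is
  positive.\<close>

lemma Sp_ell_plus_imp_pd:
  assumes E: "W \<in> Sp_ell_plus"
  shows "pd (Om ** cayley_inv W)"
proof -
  have W: "W \<in> Sp" using E by (simp add: Sp_ell_plus_def)
  have inv: "invertible (W + mat 1)" by (rule Sp_ell_plus_plus_one_invertible[OF E])
  define M where "M = cayley_inv W"
  have M: "M \<in> sp" unfolding M_def by (rule cayley_inv_sp[OF W inv])
  have eigv: "v \<in> gen_eigenspace W z" if "complexify W *v v = z *s v" for v z
    unfolding gen_eigenspace_def using that by (auto intro: exI[of _ 1])
  have eig: "0 < herm M v \<and> kappa v v \<noteq> 0 \<and> (\<exists>\<mu>. complexify M *v v = \<mu> *s v)"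
    if v: "v \<noteq> 0" and Wv: "complexify W *v v = z *s v" for v z
  proof -
    have z: "cmod z = 1" "z \<noteq> 1" "z \<noteq> -1" "kappa_pos_def_on (gen_eigenspace W z) \<longleftrightarrow> 0 < Im z"
      using E v Wv eigenvalues_iff[of z W] by (auto simp: Sp_ell_plus_def)
    have "Im z \<noteq> 0"
    proof
      assume "Im z = 0"
      with z(1) have "\<bar>Re z\<bar> = 1" by (simp add: cmod_def)
      with \<open>Im z = 0\<close> z(2,3) show False by (auto simp: complex_eq_iff abs_if split: if_splits)
    qed
    define k where "k = Re (kappa v v)"
    have kk: "kappa v v = complex_of_real k" unfolding k_def by (rule kappa_self_real)
    have sgn: "0 < k * Im z"
    proof (cases "0 < Im z")
      case True
      then have "0 < k" using z(4) eigv[OF Wv] v by (auto simp: kappa_pos_def_on_def k_def)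
      with True show ?thesis by simp
    next
      case False
      \<comment> \<open>For \<open>Im z < 0\<close> the definition states only that \<open>kappa\<close> is not positive definite; the
        conjugate eigenvector, for which \<open>kappa\<close> has the opposite sign, gives the negativity.\<close>
      have cW: "complexify W *v conj_vec v = cnj z *s conj_vec v"
      proof -
        have "complexify W *v conj_vec v = conj_vec (complexify W *v v)"
          by (simp add: complex_vec_eq_iff matrix_vector_minus_right)
        then show ?thesis by (simp add: Wv conj_vec_def vec_eq_iff)
      qed
      have cv: "conj_vec v \<noteq> 0" using v by (simp add: conj_vec_def vec_eq_iff)
      have "0 < Im (cnj z)" using False \<open>Im z \<noteq> 0\<close> by simp
      moreover have "kappa_pos_def_on (gen_eigenspace W (cnj z)) \<longleftrightarrow> 0 < Im (cnj z)"
        using E cv cW eigenvalues_iff[of "cnj z" W] by (auto simp: Sp_ell_plus_def)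
      ultimately have "0 < Re (kappa (conj_vec v) (conj_vec v))"
        using eigv[OF cW] cv by (auto simp: kappa_pos_def_on_def)
      then have "k < 0" by (simp add: kappa_conj k_def)
      then show ?thesis using False \<open>Im z \<noteq> 0\<close> by (simp add: mult_neg_neg)
    qed
    define m where "m = Im z / (1 + Re z)"
    have Mv: "complexify M *v v = (\<i> * complex_of_real m) *s v"
      using eigenvector_cayley_inv(2)[OF inv Wv v] unit_circle_cayley(1)[OF z(1,3)] by (simp add: M_def m_def)
    have "- \<i> * herm M v = cnj (\<i> * complex_of_real m) * kappa v v"
      using kappa_herm[OF M, of v] by (simp add: Mv kappa_linear)
    then have "herm M v = m * k" by (simp add: kk complex_eq_iff)
    moreover have "0 < m * k"
      using sgn unit_circle_cayley(2)[OF z(1,3)] by (simp add: m_def mult.commute zero_less_mult_iff divide_simps)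
    ultimately show ?thesis using Mv kk by auto
  qed
  have "0 < x \<bullet> ((Om ** M) *v x)" if "x \<noteq> 0" for x
  proof -
    define v where "v = (\<chi> i. complex_of_real (x $ i))"
    have vp: "re_part v = x" "im_part v = 0" by (simp_all add: v_def re_part_def im_part_def vec_eq_iff)
    have "v \<noteq> 0" using that vp by auto
    have "0 < herm M v"
      by (rule herm_pos_on_invariant[OF W M eig, where T = UNIV]) (use \<open>v \<noteq> 0\<close> in auto)
    then show ?thesis by (simp add: herm_def vp)
  qed
  then show ?thesis using M unfolding M_def pd_def sp_iff by blast
qed

text \<open>The same identity on eigenvectors, read backwards, puts the eigenvalues on the unit circle and
  determines the signs. It has to be extended to generalised eigenvectors: these are eigenvectors,
  because a nontrivial Jordan block for a unimodular eigenvalue would contain an eigenvector which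
  is isotropic for \<open>kappa\<close>.\<close>

lemma pd_imp_Sp_ell_plus:
  assumes B: "pd (Om ** M)"
  shows "cayley M \<in> Sp_ell_plus"
proof -
  have M: "M \<in> sp" using B by (simp add: sp_iff pd_def)
  have inv: "invertible (mat 1 - M)" by (rule pd_one_minus_invertible[OF B])
  define W where "W = cayley M"
  have W: "W \<in> Sp" unfolding W_def by (rule cayley_Sp[OF M inv])
  have inv1: "invertible (W + mat 1)" unfolding W_def by (rule cayley_plus_one[OF inv])
  have MW: "cayley_inv W = M" unfolding W_def by (rule cayley_inv_cayley[OF inv])
  have eig: "cmod z = 1 \<and> z \<noteq> 1 \<and> z \<noteq> -1 \<and> 0 < Re (kappa v v) * Im z"
    if v: "v \<noteq> 0" and Wv: "complexify W *v v = z *s v" for v z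
  proof -
    define \<mu> where "\<mu> = (z - 1) / (z + 1)"
    have z1: "z \<noteq> -1" by (rule eigenvector_cayley_inv[OF inv1 Wv v])
    have Mv: "complexify M *v v = \<mu> *s v"
      using eigenvector_cayley_inv(2)[OF inv1 Wv v] by (simp add: MW \<mu>_def)
    define k where "k = Re (kappa v v)"
    have kk: "kappa v v = complex_of_real k" unfolding k_def by (rule kappa_self_real)
    have h: "0 < herm M v" by (rule herm_pos[OF B v])
    have "cnj \<mu> * complex_of_real k = - \<i> * herm M v"
      using kappa_herm[OF M, of v] by (simp add: Mv kappa_linear kk)
    then have "Re \<mu> * k = 0" "Im \<mu> * k = herm M v" by (simp_all add: complex_eq_iff)
    with h have k0: "k \<noteq> 0" and \<mu>r: "Re \<mu> = 0" and \<mu>i: "Im \<mu> * k > 0" by auto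
    define m where "m = Im \<mu>"
    have \<mu>e: "\<mu> = \<i> * complex_of_real m" using \<mu>r by (simp add: complex_eq_iff m_def)
    have m0: "m \<noteq> 0" using \<mu>i by (auto simp: m_def)
    have zp: "z + 1 \<noteq> 0" using z1 by (metis add_diff_cancel_right' diff_0)
    have "\<mu> * (z + 1) = z - 1" using zp by (simp add: \<mu>_def)
    then have zz: "z * (1 - \<mu>) = 1 + \<mu>" by (simp add: algebra_simps)
    have pos: "1 + m\<^sup>2 > 0" by (simp add: add_pos_nonneg)
    have zRe: "Re z = (1 - m\<^sup>2) / (1 + m\<^sup>2)" and zIm: "Im z = 2 * m / (1 + m\<^sup>2)"
    proof -
      have e: "Re z + m * Im z = 1" "Im z - m * Re z = m"
        using arg_cong[OF zz, of Re] arg_cong[OF zz, of Im] by (simp_all add: \<mu>e algebra_simps)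
      have "Re z * (1 + m\<^sup>2) = (Re z + m * Im z) - m * (Im z - m * Re z)" by (simp add: power2_eq_square algebra_simps)
      then have "Re z * (1 + m\<^sup>2) = 1 - m\<^sup>2" unfolding e by (simp add: power2_eq_square)
      then show "Re z = (1 - m\<^sup>2) / (1 + m\<^sup>2)" using pos by (simp add: field_simps)
      have "Im z * (1 + m\<^sup>2) = (Im z - m * Re z) + m * (Re z + m * Im z)" by (simp add: power2_eq_square algebra_simps)
      then have "Im z * (1 + m\<^sup>2) = 2 * m" unfolding e by simp
      then show "Im z = 2 * m / (1 + m\<^sup>2)" using pos by (simp add: field_simps)
    qed
    have "(1 - m\<^sup>2)\<^sup>2 + (2 * m)\<^sup>2 = (1 + m\<^sup>2)\<^sup>2" by (simp add: power2_eq_square algebra_simps)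
    then have "(Re z)\<^sup>2 + (Im z)\<^sup>2 = 1"
      unfolding zRe zIm power_divide using pos by (simp add: add_divide_distrib[symmetric])
    then have "cmod z = 1" by (simp add: cmod_def)
    moreover have "Im z \<noteq> 0" using m0 pos by (simp add: zIm)
    then have "z \<noteq> 1" by auto
    moreover have "0 < k * Im z"
      using \<mu>i pos by (simp add: zIm m_def[symmetric] zero_less_mult_iff zero_less_divide_iff) linarith
    ultimately show ?thesis using z1 by (simp add: k_def)
  qed
  have semisimple: "complexify W *v v = z *s v" if v: "v \<in> gen_eigenspace W z" for v z
  proof -
    define f where "f = (\<lambda>u. complexify W *v u - z *s u)"
    have ff: "f v = 0" if "f (f v) = 0" for v
    proof (rule ccontr)
      define u where "u = f v"
      assume "f v \<noteq> 0"
      then have u0: "u \<noteq> 0" by (simp add: u_def)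
      have Wu: "complexify W *v u = z *s u" using that by (simp add: f_def u_def)
      have zc: "z * cnj z = 1" using eig[OF u0 Wu] by (metis complex_norm_square of_real_1 one_power2)
      have "complexify W *v v = u + z *s v" by (simp add: u_def f_def)
      then have "kappa v u = kappa (u + z *s v) (z *s u)"
        using kappa_Sp[OF W, of v u] by (simp add: Wu)
      also have "\<dots> = cnj z * kappa u u + (z * cnj z) * kappa v u"
        by (simp add: kappa_linear algebra_simps)
      finally have "cnj z * kappa u u = 0" by (simp add: zc)
      then have "kappa u u = 0" using zc by auto
      then show False using eig[OF u0 Wu] by simp
    qed
    have "f v = 0" if "(f ^^ m) v = 0" for m v
      using that
    proof (induction m arbitrary: v)
      case 0
      then show ?case by (simp add: f_def)
    next
      case (Suc m)
      then have "f (f v) = 0" by (simp add: funpow_Suc_right del: funpow.simps)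
      then show ?case by (rule ff)
    qed
    then show ?thesis using v unfolding gen_eigenspace_def f_def[symmetric] by (auto simp: f_def)
  qed
  have "kappa_pos_def_on (gen_eigenspace W z) \<longleftrightarrow> 0 < Im z" if zE: "z \<in># eigenvalues W" for z
  proof -
    obtain v where v: "v \<noteq> 0" "complexify W *v v = z *s v" using eigenvalues_iff[THEN iffD1, OF zE] by blast
    have vg: "v \<in> gen_eigenspace W z"
      unfolding gen_eigenspace_def using v by (auto intro: exI[of _ 1])
    show ?thesis
    proof
      assume "kappa_pos_def_on (gen_eigenspace W z)"
      then have "0 < Re (kappa v v)" using vg v by (auto simp: kappa_pos_def_on_def)
      then show "0 < Im z" using eig[OF v] by (simp add: zero_less_mult_iff)
    next
      assume "0 < Im z"
      then show "kappa_pos_def_on (gen_eigenspace W z)"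
        unfolding kappa_pos_def_on_def using eig semisimple by (fastforce simp: zero_less_mult_iff)
    qed
  qed
  then show ?thesis
    using W eig unfolding W_def[symmetric] Sp_ell_plus_def by (auto simp: eigenvalues_iff)
qed

section \<open>Normal form and functional calculus\<close>

text \<open>The columns of \<open>T\<close> are an orthonormal basis for the form of \<open>M\<close>, in which \<open>- M\<^sup>2\<close>, which is
  self-adjoint for this form, is diagonal. \<open>M\<close> itself has the imaginary eigenvalues
  \<open>\<plusminus>i sqrt (d $ i)\<close> and is not diagonalizable over the reals, but an odd function of \<open>M\<close> is the product
  of \<open>M\<close> with a function of \<open>- M\<^sup>2\<close>.\<close>

locale normal_form =
  fixes M :: "('n::finite) rmat" and T :: "'n rmat" and d :: "real ^ ('n + 'n)"
  assumes pdM: "pd (Om ** M)" and invT: "invertible T"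
    and TBT: "transpose T ** (Om ** M) ** T = mat 1"
    and d_pos: "0 < d $ i"
    and MM: "M ** M = T ** diagmat (\<chi> i. - (d $ i)) ** matrix_inv T"
begin

text \<open>The function \<open>g\<close> of \<open>- M\<^sup>2\<close>.\<close>

definition fc :: "(real \<Rightarrow> real) \<Rightarrow> 'n rmat"
  where "fc g = T ** diagmat (\<chi> i. g (d $ i)) ** matrix_inv T"

lemma M_sp: "M \<in> sp"
  using pdM by (simp add: pd_def sp_iff)

lemma TT: "T ** matrix_inv T = mat 1" "matrix_inv T ** T = mat 1"
  using invT by (simp_all add: matrix_inv_right matrix_inv_left)

lemma fc_mult: "fc g ** fc h = fc (\<lambda>x. g x * h x)"
proof -
  have "fc g ** fc h = T ** diagmat (\<chi> i. g (d $ i)) ** (matrix_inv T ** T) ** diagmat (\<chi> i. h (d $ i)) ** matrix_inv T"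
    by (simp add: fc_def matrix_mul_assoc)
  also have "\<dots> = T ** (diagmat (\<chi> i. g (d $ i)) ** diagmat (\<chi> i. h (d $ i))) ** matrix_inv T"
    by (simp add: TT matrix_mul_assoc)
  finally show ?thesis by (simp add: fc_def diagmat_mult)
qed

lemma diagmat_add: "diagmat a + diagmat b = diagmat (\<chi> i. a $ i + (b $ i :: real))"
  by (simp add: diagmat_def vec_eq_iff)

lemma diagmat_scale: "c *\<^sub>R diagmat a = diagmat (\<chi> i. c * (a $ i :: real))"
  by (simp add: diagmat_def vec_eq_iff)

lemma fc_add: "fc g + fc h = fc (\<lambda>x. g x + h x)"
proof -
  have "fc g + fc h = T ** (diagmat (\<chi> i. g (d $ i)) + diagmat (\<chi> i. h (d $ i))) ** matrix_inv T"
    by (simp add: fc_def mring)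
  then show ?thesis by (simp add: diagmat_add fc_def)
qed

lemma fc_scale: "c *\<^sub>R fc g = fc (\<lambda>x. c * g x)"
proof -
  have "c *\<^sub>R fc g = T ** (c *\<^sub>R diagmat (\<chi> i. g (d $ i))) ** matrix_inv T"
    by (simp add: fc_def mring)
  then show ?thesis by (simp add: diagmat_scale fc_def)
qed

lemma fc_minus: "- fc g = fc (\<lambda>x. - g x)"
  using fc_scale[of "-1" g] by simp

lemma fc_diff: "fc g - fc h = fc (\<lambda>x. g x - h x)"
  using fc_add[of g "\<lambda>x. - h x"] by (simp add: fc_minus[symmetric])

lemma fc_one: "fc (\<lambda>x. 1) = mat 1"
  by (simp add: fc_def diagmat_one TT)

lemma fc_cong: "(\<And>x. 0 < x \<Longrightarrow> g x = h x) \<Longrightarrow> fc g = fc h"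
  by (simp add: fc_def d_pos)

lemma M_squared: "M ** M = - fc (\<lambda>x. x)"
  unfolding fc_minus unfolding fc_def by (rule MM)

text \<open>\<open>M\<close> commutes with \<open>- M\<^sup>2\<close>, so in the basis \<open>T\<close> its entries between different eigenvalues
  of \<open>- M\<^sup>2\<close> vanish.\<close>

lemma fc_commute: "M ** fc g = fc g ** M"
proof -
  define N where "N = matrix_inv T ** M ** T"
  have M: "M = T ** N ** matrix_inv T"
  proof -
    have "T ** N ** matrix_inv T = (T ** matrix_inv T) ** M ** (T ** matrix_inv T)"
      by (simp add: N_def matrix_mul_assoc)
    then show ?thesis by (simp add: TT)
  qed
  have NN: "matrix_inv T ** (M ** M) ** T = diagmat (\<chi> i. - (d $ i))"
  proof -
    have "matrix_inv T ** (M ** M) ** T = (matrix_inv T ** T) ** diagmat (\<chi> i. - (d $ i)) ** (matrix_inv T ** T)"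
      by (simp add: MM matrix_mul_assoc)
    then show ?thesis by (simp add: TT)
  qed
  have "N ** (matrix_inv T ** (M ** M) ** T) = matrix_inv T ** M ** (T ** matrix_inv T) ** M ** M ** T"
    by (simp add: N_def matrix_mul_assoc)
  also have "\<dots> = matrix_inv T ** M ** M ** (T ** matrix_inv T) ** M ** T"
    by (simp add: TT)
  also have "\<dots> = (matrix_inv T ** (M ** M) ** T) ** N"
    by (simp add: N_def matrix_mul_assoc)
  finally have *: "N ** diagmat (\<chi> i. - (d $ i)) = diagmat (\<chi> i. - (d $ i)) ** N"
    unfolding NN .
  have R: "(N ** diagmat v) $ i $ j = N $ i $ j * v $ j" and L: "(diagmat v ** N) $ i $ j = v $ i * N $ i $ j" for v i j
    by (simp_all add: matrix_matrix_mult_def diagmat_def if_distrib[of "\<lambda>z. _ * z"] if_distrib[of "\<lambda>z. z * _"] cong: if_cong)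
  have "N $ i $ j * d $ j = d $ i * N $ i $ j" for i j
    using arg_cong[OF *, of "\<lambda>A. A $ i $ j"] by (simp add: R L)
  then have "N $ i $ j = 0 \<or> d $ i = d $ j" for i j by (metis mult.commute mult_cancel_left)
  then have "N $ i $ j * g (d $ j) = g (d $ i) * N $ i $ j" for i j by (metis mult.commute mult_zero_left)
  then have ND: "N ** diagmat (\<chi> i. g (d $ i)) = diagmat (\<chi> i. g (d $ i)) ** N"
    by (simp add: vec_eq_iff R L)
  have "M ** fc g = T ** N ** (matrix_inv T ** T) ** diagmat (\<chi> i. g (d $ i)) ** matrix_inv T"
    unfolding fc_def by (subst M) (simp only: matrix_mul_assoc)
  also have "\<dots> = T ** (N ** diagmat (\<chi> i. g (d $ i))) ** matrix_inv T"
    by (simp add: TT matrix_mul_assoc)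
  also have "\<dots> = T ** diagmat (\<chi> i. g (d $ i)) ** (matrix_inv T ** T) ** N ** matrix_inv T"
    by (simp add: ND TT matrix_mul_assoc)
  also have "\<dots> = fc g ** M"
    unfolding fc_def by (subst M) (simp only: matrix_mul_assoc)
  finally show ?thesis .
qed

lemma fc_inverse:
  assumes "\<And>x. 0 < x \<Longrightarrow> g x \<noteq> 0"
  shows "invertible (fc g)" "matrix_inv (fc g) = fc (\<lambda>x. 1 / g x)"
proof -
  have "fc g ** fc (\<lambda>x. 1 / g x) = fc (\<lambda>x. 1)"
    unfolding fc_mult by (rule fc_cong) (simp add: assms)
  then have "fc g ** fc (\<lambda>x. 1 / g x) = mat 1" by (simp add: fc_one)
  then show "invertible (fc g)" "matrix_inv (fc g) = fc (\<lambda>x. 1 / g x)"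
    by (auto intro: invertibleI matrix_inv_eqI)
qed

lemma det_fc: "det (fc g) = (\<Prod>i\<in>UNIV. g (d $ i))"
  unfolding fc_def by (simp add: det_conj invT det_diagmat)

lemma TB: "transpose T ** (Om ** M) = matrix_inv T"
  by (metis TBT TT(2) matrix_inv_eqI matrix_left_right_inverse)

text \<open>\<open>M ** fc g\<close> is the function \<open>i m \<mapsto> i m * g (m\<^sup>2)\<close> of \<open>M\<close>. In the basis \<open>T\<close> its form
  is diagonal with the entries \<open>g (d $ i)\<close>.\<close>

lemma pd_M_fc:
  assumes g: "\<And>x. 0 < x \<Longrightarrow> 0 < g x"
  shows "pd (Om ** (M ** fc g))"
proof -
  have "transpose T ** (Om ** (M ** fc g)) ** T = (transpose T ** (Om ** M)) ** fc g ** T"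
    by (simp add: matrix_mul_assoc)
  also have "\<dots> = (matrix_inv T ** T) ** diagmat (\<chi> i. g (d $ i)) ** (matrix_inv T ** T)"
    unfolding TB fc_def by (simp add: matrix_mul_assoc)
  finally have e: "transpose T ** (Om ** (M ** fc g)) ** T = diagmat (\<chi> i. g (d $ i))" by (simp add: TT)
  have "pd (diagmat (\<chi> i. g (d $ i)))"
    unfolding pd_def transpose_diagmat diagmat_mult_vec
  proof (intro conjI allI impI refl)
    fix y :: "real^('n + 'n)" assume "y \<noteq> 0"
    then obtain i where i: "y $ i \<noteq> 0" by (auto simp: vec_eq_iff)
    have t: "y $ j * ((\<chi> i. g (d $ i)) $ j * y $ j) = g (d $ j) * (y $ j)\<^sup>2" for j
      by (simp add: power2_eq_square)
    have "0 < g (d $ i) * (y $ i)\<^sup>2" using i g[OF d_pos] by simp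
    then show "0 < y \<bullet> (\<chi> i. (\<chi> i. g (d $ i)) $ i * y $ i)"
      unfolding inner_vec_def inner_real_def using g[OF d_pos]
      by (intro sum_pos2[where i = i]) (simp_all only: vec_lambda_beta t[simplified vec_lambda_beta] finite UNIV_I, auto simp: less_imp_le)
  qed
  then have "pd (transpose (matrix_inv T) ** diagmat (\<chi> i. g (d $ i)) ** matrix_inv T)"
    by (intro pd_congruence invertible_matrix_inv invT)
  moreover have "transpose (matrix_inv T) ** diagmat (\<chi> i. g (d $ i)) ** matrix_inv T
     = transpose (T ** matrix_inv T) ** (Om ** (M ** fc g)) ** (T ** matrix_inv T)"
    unfolding e[symmetric] by (simp add: mtrans matrix_mul_assoc)
  ultimately show ?thesis by (simp add: TT)
qed

text \<open>The square of \<open>det M\<close> is known from \<open>M ** M\<close>, and \<open>det M\<close> is positive since it is also the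
  determinant of the form.\<close>

lemma det_M: "det M = (\<Prod>i\<in>UNIV. sqrt (d $ i))"
proof -
  have pos: "0 < det M" using pd_det_pos[OF pdM] by (simp add: det_sp)
  have "(det M)\<^sup>2 = det (M ** M)" by (simp add: det_mul power2_eq_square)
  also have "\<dots> = (\<Prod>i\<in>UNIV. - (d $ i))" unfolding M_squared fc_minus det_fc ..
  also have "\<dots> = (\<Prod>i\<in>UNIV. (- 1) * (d $ i))" by simp
  also have "\<dots> = (- 1) ^ CARD('n + 'n) * (\<Prod>i\<in>UNIV. d $ i)" by (simp only: prod.distrib prod_constant)
  also have "(- 1 :: real) ^ CARD('n + 'n) = 1" by simp
  also have "(\<Prod>i\<in>UNIV. d $ i) = (\<Prod>i\<in>UNIV. sqrt (d $ i))\<^sup>2"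
    by (simp add: prod_power_distrib less_imp_le[OF d_pos])
  finally have "(det M)\<^sup>2 = (\<Prod>i\<in>UNIV. sqrt (d $ i))\<^sup>2" by simp
  moreover have "0 \<le> (\<Prod>i\<in>UNIV. sqrt (d $ i))" by (intro prod_nonneg) (simp add: less_imp_le[OF d_pos])
  ultimately show ?thesis using pos by (simp add: power2_eq_iff_nonneg)
qed

text \<open>The eigenvalues of \<open>cayley M\<close> are the \<open>cis (\<plusminus> angle)\<close>.\<close>

definition angle :: "real ^ ('n + 'n)"
  where "angle = (\<chi> i. 2 * arctan (sqrt (d $ i)))"

lemma angle_bounds: "0 < angle $ i" "angle $ i < pi"
  using arctan_bounded[of "sqrt (d $ i)"] d_pos[of i] by (simp_all add: angle_def)

text \<open>The principal logarithm of \<open>cayley M\<close>: the function \<open>i m \<mapsto> 2 i arctan m\<close> of \<open>M\<close>.\<close>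

definition logM :: "'n rmat"
  where "logM = M ** fc (\<lambda>x. 2 * arctan (sqrt x) / sqrt x)"

lemma logM_pd: "pd (Om ** logM)"
  unfolding logM_def by (rule pd_M_fc) simp

lemma det_logM: "det logM = (\<Prod>i\<in>UNIV. angle $ i)"
  unfolding logM_def det_mul det_M det_fc prod.distrib[symmetric] angle_def
  by (intro prod.cong refl) (simp add: d_pos[THEN less_imp_neq, symmetric])

text \<open>The one-parameter group generated by \<open>logM\<close>. On the eigenspace of \<open>- M\<^sup>2\<close> for \<open>x\<close> the matrix
  \<open>M / sqrt x\<close> is a complex structure, so the exponential is a cosine plus this structure times a
  sine.\<close>

definition expM :: "real \<Rightarrow> 'n rmat"
  where "expM t = fc (\<lambda>x. cos (t * (2 * arctan (sqrt x)))) + M ** fc (\<lambda>x. sin (t * (2 * arctan (sqrt x))) / sqrt x)"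

lemma M_fc_mult: "(M ** fc g) ** (M ** fc h) = - fc (\<lambda>x. x * g x * h x)"
proof -
  have "(M ** fc g) ** (M ** fc h) = M ** (fc g ** M) ** fc h" by (simp add: matrix_mul_assoc)
  also have "\<dots> = (M ** M) ** (fc g ** fc h)" by (simp add: fc_commute[symmetric] matrix_mul_assoc)
  finally show ?thesis by (simp add: M_squared fc_mult matrix_minus_left mult.assoc)
qed

lemma expM_0: "expM 0 = mat 1"
proof -
  have "fc (\<lambda>x. 0) = 0" using fc_scale[of 0 "\<lambda>x. 0"] by simp
  then show ?thesis by (simp add: expM_def fc_one)
qed

lemma has_vector_derivative_vec:
  assumes "\<And>i. ((\<lambda>x. f x $ i) has_vector_derivative f' $ i) (at x within S)"
  shows "(f has_vector_derivative (f' :: 'b::real_normed_vector^'k)) (at x within S)"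
  unfolding has_vector_derivative_iff_slope
proof (rule vec_tendstoI)
  fix i show "((\<lambda>y. ((1 / (y - x)) *\<^sub>R (f y - f x)) $ i) \<longlongrightarrow> f' $ i) (at x within S)"
    using assms[of i] unfolding has_vector_derivative_iff_slope by simp
qed

lemma fc_has_vector_derivative:
  assumes "\<And>x. 0 < x \<Longrightarrow> ((\<lambda>r. g r x) has_real_derivative g' x) (at r within S)"
  shows "((\<lambda>r. fc (g r)) has_vector_derivative fc g') (at r within S)"
proof -
  have "((\<lambda>r. diagmat (\<chi> i. g r (d $ i))) has_vector_derivative diagmat (\<chi> i. g' (d $ i))) (at r within S)"
    by (intro has_vector_derivative_vec)
      (auto simp: diagmat_def has_real_derivative_iff_has_vector_derivative[symmetric] intro!: assms d_pos)
  then have "((\<lambda>r. T ** diagmat (\<chi> i. g r (d $ i))) has_vector_derivative T ** diagmat (\<chi> i. g' (d $ i))) (at r within S)"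
    using has_vector_derivative_matrix_mult[OF has_vector_derivative_const] by fastforce
  then show ?thesis
    unfolding fc_def using has_vector_derivative_matrix_mult[OF _ has_vector_derivative_const] by fastforce
qed

lemma M_fc_has_vector_derivative:
  assumes "\<And>x. 0 < x \<Longrightarrow> ((\<lambda>r. g r x) has_real_derivative g' x) (at r within S)"
  shows "((\<lambda>r. M ** fc (g r)) has_vector_derivative M ** fc g') (at r within S)"
  using has_vector_derivative_matrix_mult[OF has_vector_derivative_const fc_has_vector_derivative[OF assms]] by simp

lemma expM_derivative: "(expM has_vector_derivative logM ** expM t) (at t within S)"
proof -
  define \<theta> where "\<theta> = (\<lambda>x. 2 * arctan (sqrt x))"
  have "(expM has_vector_derivative fc (\<lambda>x. - (sin (t * \<theta> x) * \<theta> x)) + M ** fc (\<lambda>x. cos (t * \<theta> x) * \<theta> x / sqrt x)) (at t within S)"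
    unfolding expM_def \<theta>_def[symmetric, THEN fun_cong]
    by (intro has_vector_derivative_add fc_has_vector_derivative M_fc_has_vector_derivative)
      (auto intro!: derivative_eq_intros simp: field_simps)
  moreover have "logM ** expM t = fc (\<lambda>x. - (sin (t * \<theta> x) * \<theta> x)) + M ** fc (\<lambda>x. cos (t * \<theta> x) * \<theta> x / sqrt x)"
  proof -
    have "logM ** expM t = M ** (fc (\<lambda>x. \<theta> x / sqrt x) ** fc (\<lambda>x. cos (t * \<theta> x))) +
        (M ** fc (\<lambda>x. \<theta> x / sqrt x)) ** (M ** fc (\<lambda>x. sin (t * \<theta> x) / sqrt x))"
      by (simp add: logM_def expM_def \<theta>_def mring)
    also have "\<dots> = M ** fc (\<lambda>x. \<theta> x / sqrt x * cos (t * \<theta> x)) + fc (\<lambda>x. - (x * (\<theta> x / sqrt x) * (sin (t * \<theta> x) / sqrt x)))"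
      unfolding M_fc_mult fc_mult fc_minus ..
    also have "fc (\<lambda>x. - (x * (\<theta> x / sqrt x) * (sin (t * \<theta> x) / sqrt x))) = fc (\<lambda>x. - (sin (t * \<theta> x) * \<theta> x))"
      by (rule fc_cong) (simp add: field_simps flip: power2_eq_square)
    finally show ?thesis by (simp add: mult.commute add.commute)
  qed
  ultimately show ?thesis by simp
qed

text \<open>Up to time 1 the one-parameter group stays in the elliptic region: \<open>cis (t \<theta>)\<close> is the Cayley
  transform of \<open>i tan (t \<theta> / 2)\<close>.\<close>

lemma expM_cayley:
  assumes t: "0 < t" "t \<le> 1"
  defines "Mt \<equiv> M ** fc (\<lambda>x. tan (t * arctan (sqrt x)) / sqrt x)"
  shows "pd (Om ** Mt)" "expM t = cayley Mt"
proof -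
  have a: "0 < t * arctan (sqrt x)" "t * arctan (sqrt x) < pi / 2" if "0 < x" for x
  proof -
    show "0 < t * arctan (sqrt x)" using that t by simp
    have "t * arctan (sqrt x) \<le> 1 * arctan (sqrt x)" using that t by (intro mult_right_mono) auto
    also have "\<dots> < pi / 2" using arctan_bounded by simp
    finally show "t * arctan (sqrt x) < pi / 2" .
  qed
  show p: "pd (Om ** Mt)"
    unfolding Mt_def using a by (intro pd_M_fc) (simp add: tan_gt_zero)
  have inv: "invertible (mat 1 - Mt)" by (rule pd_one_minus_invertible[OF p])
  define c where "c = (\<lambda>x. cos (t * (2 * arctan (sqrt x))))"
  define s where "s = (\<lambda>x. sin (t * (2 * arctan (sqrt x))))"
  define u where "u = (\<lambda>x. tan (t * arctan (sqrt x)))"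
  have cs: "c x + s x * u x = 1" "s x - c x * u x = u x" if "0 < x" for x
  proof -
    define y where "y = t * arctan (sqrt x)"
    have "cos y > 0" using a[OF that] by (intro cos_gt_zero) (auto simp: y_def)
    then have cu: "cos y * u x = sin y" by (simp add: u_def tan_def y_def)
    have 2: "c x = cos (2 * y)" "s x = sin (2 * y)" by (simp_all add: c_def s_def y_def mult.left_commute)
    have "c x + s x * u x = (cos y)\<^sup>2 - (sin y)\<^sup>2 + 2 * sin y * (cos y * u x)"
      unfolding 2 cos_double sin_double by simp
    also have "\<dots> = (cos y)\<^sup>2 + (sin y)\<^sup>2" unfolding cu by algebra
    finally show "c x + s x * u x = 1" by simp
    have "s x - c x * u x = 2 * sin y * cos y - ((cos y)\<^sup>2 * u x - (sin y)\<^sup>2 * u x)"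
      unfolding 2 cos_double sin_double by (simp add: algebra_simps)
    also have "(cos y)\<^sup>2 * u x = cos y * (cos y * u x)" by (simp add: power2_eq_square)
    also have "2 * sin y * cos y - (cos y * (cos y * u x) - (sin y)\<^sup>2 * u x) = sin y * (cos y + sin y * u x)"
      unfolding cu by (simp add: power2_eq_square algebra_simps)
    also have "sin y = cos y * u x" by (simp only: cu)
    also have "cos y * u x * (cos y + cos y * u x * u x) = u x * ((cos y)\<^sup>2 + (cos y * u x)\<^sup>2)"
      by (simp add: power2_eq_square algebra_simps)
    finally show "s x - c x * u x = u x"
      unfolding cu using sin_cos_squared_add[of y] by (simp add: add.commute)
  qed
  have cu': "fc (\<lambda>x. c x * (u x / sqrt x)) = fc c ** fc (\<lambda>x. u x / sqrt x)" by (simp add: fc_mult)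
  have "expM t ** (mat 1 - Mt) = fc c + M ** fc (\<lambda>x. s x / sqrt x) - (fc c ** M) ** fc (\<lambda>x. u x / sqrt x)
      - (M ** fc (\<lambda>x. s x / sqrt x)) ** (M ** fc (\<lambda>x. u x / sqrt x))"
    by (simp add: expM_def Mt_def c_def s_def u_def mring)
  also have "\<dots> = (fc c + fc (\<lambda>x. x * (s x / sqrt x) * (u x / sqrt x))) +
      M ** (fc (\<lambda>x. s x / sqrt x) - fc (\<lambda>x. c x * (u x / sqrt x)))"
    unfolding M_fc_mult fc_commute[symmetric] cu' by (simp add: mring)
  also have "fc c + fc (\<lambda>x. x * (s x / sqrt x) * (u x / sqrt x)) = fc (\<lambda>x. 1)"
    unfolding fc_add
  proof (rule fc_cong)
    fix x :: real assume "0 < x"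
    then have "x * (s x / sqrt x) * (u x / sqrt x) = s x * u x" by (simp add: field_simps flip: power2_eq_square)
    then show "c x + x * (s x / sqrt x) * (u x / sqrt x) = 1" using cs(1)[OF \<open>0 < x\<close>] by simp
  qed
  also have "fc (\<lambda>x. s x / sqrt x) - fc (\<lambda>x. c x * (u x / sqrt x)) = fc (\<lambda>x. u x / sqrt x)"
    unfolding fc_diff
  proof (rule fc_cong)
    fix x :: real assume "0 < x"
    have "s x / sqrt x - c x * (u x / sqrt x) = (s x - c x * u x) / sqrt x" by (simp add: diff_divide_distrib)
    then show "s x / sqrt x - c x * (u x / sqrt x) = u x / sqrt x" unfolding cs(2)[OF \<open>0 < x\<close>] .
  qed
  finally have "expM t ** (mat 1 - Mt) = mat 1 + Mt"
    by (simp add: fc_one Mt_def u_def)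
  then show "expM t = cayley Mt"
    unfolding cayley_def by (metis inv matrix_inv_right matrix_mul_assoc matrix_mul_rid)
qed

lemma expM_1: "expM 1 = cayley M"
proof -
  have "fc (\<lambda>x. tan (1 * arctan (sqrt x)) / sqrt x) = fc (\<lambda>x. 1)"
    by (rule fc_cong) (simp add: tan_arctan)
  then show ?thesis using expM_cayley(2)[of 1] by (simp add: fc_one)
qed

lemma cayley_plus_inverse:
  "cayley M + matrix_inv (cayley M) = T ** diagmat (\<chi> i. 2 * cos (angle $ i)) ** matrix_inv T"
proof -
  define c where "c = (\<lambda>x. cos (2 * arctan (sqrt x)))"
  define s where "s = (\<lambda>x. sin (2 * arctan (sqrt x)))"
  have W: "cayley M = fc c + M ** fc (\<lambda>x. s x / sqrt x)"
    unfolding expM_1[symmetric] by (simp add: expM_def c_def s_def)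
  have "(fc c + M ** fc (\<lambda>x. s x / sqrt x)) ** (fc c - M ** fc (\<lambda>x. s x / sqrt x))
      = fc c ** fc c + M ** (fc (\<lambda>x. s x / sqrt x) ** fc c) - (fc c ** M) ** fc (\<lambda>x. s x / sqrt x) - (M ** fc (\<lambda>x. s x / sqrt x)) ** (M ** fc (\<lambda>x. s x / sqrt x))"
    by (simp add: mring)
  also have "\<dots> = fc c ** fc c + fc (\<lambda>x. x * (s x / sqrt x) * (s x / sqrt x))"
    unfolding M_fc_mult fc_commute[symmetric] by (simp add: matrix_mul_assoc[symmetric] fc_mult mult.commute)
  also have "\<dots> = fc (\<lambda>x. 1)"
    unfolding fc_mult fc_add
  proof (rule fc_cong)
    fix x :: real assume "0 < x"
    then have "x * (s x / sqrt x) * (s x / sqrt x) = s x * s x" by (simp add: field_simps flip: power2_eq_square)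
    then show "c x * c x + x * (s x / sqrt x) * (s x / sqrt x) = 1"
      by (simp add: c_def s_def flip: power2_eq_square)
  qed
  finally have "matrix_inv (cayley M) = fc c - M ** fc (\<lambda>x. s x / sqrt x)"
    unfolding W fc_one by (rule matrix_inv_eqI)
  then have "cayley M + matrix_inv (cayley M) = fc c + fc c"
    unfolding W by simp
  also have "\<dots> = fc (\<lambda>x. 2 * c x)"
    unfolding fc_add by (rule fc_cong) simp
  finally have "cayley M + matrix_inv (cayley M) = fc (\<lambda>x. 2 * c x)" .
  then show ?thesis by (simp add: fc_def c_def angle_def)
qed

end

text \<open>\<open>- M\<^sup>2\<close> is self-adjoint for the form of \<open>M\<close>, as \<open>M\<close> is skew for it, so both forms can be
  diagonalized simultaneously.\<close>

lemma normal_form_exists: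
  assumes B: "pd (Om ** (M :: ('n::finite) rmat))"
  obtains T d where "normal_form M T d"
proof -
  define B' where "B' = Om ** M"
  have B: "pd B'" using B by (simp add: B'_def)
  have M: "M \<in> sp" using B by (simp add: pd_def sp_iff B'_def)
  have MB: "transpose M ** B' = - (B' ** M)"
    using M unfolding sp_transpose B'_def by (simp add: matrix_mul_assoc matrix_minus_left)
  have sB: "transpose B' = B'" using B by (simp add: pd_def)
  define H where "H = - (B' ** M ** M)"
  have HM: "H = transpose M ** B' ** M" unfolding H_def MB by (simp add: matrix_minus_left)
  have sH: "transpose H = H" unfolding HM by (simp add: matrix_transpose_mul sB matrix_mul_assoc)
  obtain T :: "'n rmat" and d where T: "invertible T" "transpose T ** B' ** T = mat 1" "transpose T ** H ** T = diagmat d"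
    using simultaneous_diagonalization[OF B sH] by metis
  have M0: "M *v v \<noteq> 0" if "v \<noteq> 0" for v
  proof
    assume "M *v v = 0"
    then have "v \<bullet> (B' *v v) = 0" by (simp add: B'_def matrix_vector_mul_assoc[symmetric])
    then show False using B that unfolding pd_def by (metis less_irrefl)
  qed
  have dpos: "0 < d $ i" for i
  proof -
    have "T *v axis i 1 \<noteq> 0" using T(1) by (auto simp: invertible_iff_ker axis_eq_0_iff)
    then have "0 < (M *v (T *v axis i 1)) \<bullet> (B' *v (M *v (T *v axis i 1)))"
      using B M0 by (simp add: pd_def)
    then show ?thesis
      unfolding congruence_diag_entry[OF T(3)] HM
      by (simp add: matrix_vector_mul_assoc[symmetric] inner_vector_matrix)
  qed
  have TB: "transpose T ** B' = matrix_inv T"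
    using T(2) by (metis matrix_inv_eqI matrix_left_right_inverse)
  have "diagmat d = - (matrix_inv T ** (M ** M) ** T)"
    unfolding T(3)[symmetric] H_def TB[symmetric] by (simp add: mring)
  then have "diagmat (\<chi> i. - (d $ i)) = matrix_inv T ** (M ** M) ** T"
  proof -
    assume "diagmat d = - (matrix_inv T ** (M ** M) ** T)"
    moreover have "diagmat (\<chi> i. - (d $ i)) = - diagmat d" by (simp add: vec_eq_iff diagmat_def)
    ultimately show ?thesis by simp
  qed
  then have "T ** diagmat (\<chi> i. - (d $ i)) ** matrix_inv T = (T ** matrix_inv T) ** (M ** M) ** (T ** matrix_inv T)"
    by (simp add: matrix_mul_assoc)
  then have "normal_form M T d"
    using B T(1,2) dpos unfolding B'_def by unfold_locales (simp_all add: matrix_inv_right)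
  then show ?thesis using that by blast
qed

section \<open>Eigenvalue angles\<close>

text \<open>The square of the characteristic polynomial is the product of the \<open>(x - cis (\<theta> $ i)) (x - cis (- \<theta> $ i))\<close>;
  here \<open>i\<close> runs over \<open>2n\<close> indices, so every angle of a conjugate pair is listed twice.\<close>

definition has_angles :: "('n::finite) rmat \<Rightarrow> real ^ ('n + 'n) \<Rightarrow> bool"
  where "has_angles W \<theta> \<longleftrightarrow> (\<forall>i. 0 \<le> \<theta> $ i \<and> \<theta> $ i \<le> pi) \<and>
    (\<forall>x. det (mat x - complexify W) ^ 2 = (\<Prod>i\<in>UNIV. x\<^sup>2 - 2 * x * complex_of_real (cos (\<theta> $ i)) + 1))"

text \<open>For the eigenvalues \<open>cis (\<plusminus>\<theta>\<^sub>k)\<close> this is the square of \<open>\<theta>\<^sub>1 \<cdots> \<theta>\<^sub>n\<close>. It depends on \<open>W\<close> alone, and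
  its \<open>2n\<close>-th root is the distance to be computed.\<close>

definition eigprod :: "('n::finite) rmat \<Rightarrow> real"
  where "eigprod W = (\<Prod>z\<in>#eigenvalues W. \<bar>Arg z\<bar>)"

lemma mat_commute: "mat x ** A = A ** mat (x :: 'a::comm_semiring_1)"
  by (simp add: matrix_matrix_mult_def mat_def vec_eq_iff if_distrib[of "\<lambda>z. z * _"] if_distrib[of "\<lambda>z. _ * z"]
      mult.commute cong: if_cong)

lemma mat_mult_diagmat: "mat x ** diagmat v = diagmat (\<chi> i. x * (v $ i :: 'a::comm_semiring_1))"
  by (simp add: matrix_matrix_mult_def mat_def diagmat_def vec_eq_iff if_distrib[of "\<lambda>z. z * _"] cong: if_cong)

text \<open>The inverse of a symplectic matrix is similar to its transpose.\<close>

lemma det_mat_minus_inverse: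
  assumes W: "(W :: ('n::finite) rmat) \<in> Sp"
  shows "det (mat x - complexify (matrix_inv W)) = det (mat x - complexify W)"
proof -
  let ?O = "complexify (Om :: 'n rmat)"
  have OO: "?O ** ?O = - mat 1"
    by (simp add: complexify_mult[symmetric] Om_Om complexify_minus complexify_mat_1)
  have "?O ** mat x ** ?O = mat x ** (?O ** ?O)"
    by (simp add: mat_commute[symmetric] matrix_mul_assoc)
  also have "\<dots> = - mat x" by (simp add: OO matrix_minus_right)
  finally have "- (?O ** mat x ** ?O) = mat x" by (metis minus_minus)
  then have "mat x - complexify (matrix_inv W) = (- ?O) ** transpose (mat x - complexify W) ** ?O"
    by (simp add: Sp_inv_eq[OF W] complexify_minus complexify_mult complexify_transpose mtrans mring)
  then have "det (mat x - complexify (matrix_inv W)) = det ((- ?O) ** ?O) * det (mat x - complexify W)"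
    by (simp add: det_mul)
  then show ?thesis by (simp add: matrix_minus_left OO)
qed

text \<open>Since \<open>W\<close> and its inverse have the same characteristic polynomial, its square is the
  determinant of \<open>(x - W) (x - W\<^sup>-\<^sup>1) = x\<^sup>2 - x (W + W\<^sup>-\<^sup>1) + 1\<close>, and \<open>W + W\<^sup>-\<^sup>1\<close> is
  diagonalizable over the reals. This counts every angle twice but avoids a pairing of the
  eigenvectors.\<close>

lemma (in normal_form) has_angles_cayley: "has_angles (cayley M) angle"
proof -
  let ?W = "cayley M" and ?T = "complexify T" and ?I = "complexify (matrix_inv T)"
  let ?c = "\<chi> i. complex_of_real (2 * cos (angle $ i))"
  have inv1: "invertible (mat 1 - M)" by (rule pd_one_minus_invertible[OF pdM])
  have W: "?W \<in> Sp" by (rule cayley_Sp[OF M_sp inv1])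
  have TI: "?T ** ?I = mat 1" by (simp add: complexify_mult[symmetric] TT complexify_mat_1)
  have WW: "complexify ?W ** complexify (matrix_inv ?W) = mat 1"
    by (simp add: complexify_mult[symmetric] matrix_inv_right Sp_invertible W complexify_mat_1)
  have S: "complexify ?W + complexify (matrix_inv ?W) = ?T ** diagmat ?c ** ?I"
    unfolding complexify_add[symmetric] cayley_plus_inverse complexify_mult complexify_diagmat by simp
  have "det (mat x - complexify ?W) ^ 2 = (\<Prod>i\<in>UNIV. x\<^sup>2 - 2 * x * complex_of_real (cos (angle $ i)) + 1)" for x
  proof -
    have "(mat x - complexify ?W) ** (mat x - complexify (matrix_inv ?W))
       = mat x ** mat x - mat x ** (complexify ?W + complexify (matrix_inv ?W)) + mat 1"
      by (simp add: mring WW mat_commute[of x "complexify ?W"])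
    also have "\<dots> = ?T ** (mat x ** mat x - mat x ** diagmat ?c + mat 1) ** ?I"
    proof -
      have "?T ** (mat x ** B) ** ?I = mat x ** (?T ** B ** ?I)" for B
        by (simp add: matrix_mul_assoc mat_commute[of x ?T])
      then have "?T ** (mat x ** mat x) ** ?I = mat x ** mat x" "?T ** (mat x ** diagmat ?c) ** ?I = mat x ** (?T ** diagmat ?c ** ?I)"
        by (simp_all add: mat_commute[of x ?T, symmetric]) (simp_all add: matrix_mul_assoc[symmetric] TI)
      then show ?thesis unfolding S
        by (simp add: matrix_add_ldistrib matrix_add_rdistrib matrix_sub_ldistrib matrix_sub_rdistrib TI)
    qed
    also have "mat x ** mat x - mat x ** diagmat ?c + mat 1 = diagmat (\<chi> i. x * x - x * ?c $ i + 1)"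
      unfolding mat_mult_diagmat
      by (simp add: vec_eq_iff diagmat_def mat_mult_diagmat matrix_matrix_mult_def mat_def if_distrib[of "\<lambda>z. z * _"] cong: if_cong)
    finally have "det ((mat x - complexify ?W) ** (mat x - complexify (matrix_inv ?W)))
       = det (?T ** ?I) * det (diagmat (\<chi> i. x * x - x * ?c $ i + 1))"
      by (simp add: det_mul)
    then have "det (mat x - complexify ?W) * det (mat x - complexify ?W) = (\<Prod>i\<in>UNIV. x * x - x * ?c $ i + 1)"
      unfolding TI det_mul det_mat_minus_inverse[OF W] det_diagmat by simp
    also have "\<dots> = (\<Prod>i\<in>UNIV. x\<^sup>2 - 2 * x * complex_of_real (cos (angle $ i)) + 1)"
      by (rule prod.cong) (simp_all add: power2_eq_square)
    finally show ?thesis by (simp add: power2_eq_square)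
  qed
  then show ?thesis
    using angle_bounds by (auto simp: has_angles_def less_imp_le)
qed

lemma abs_Arg_cis: "0 \<le> t \<Longrightarrow> t \<le> pi \<Longrightarrow> \<bar>Arg (cis t)\<bar> = t" "0 \<le> t \<Longrightarrow> t \<le> pi \<Longrightarrow> \<bar>Arg (cis (- t))\<bar> = t"
proof -
  assume t: "0 \<le> t" "t \<le> pi"
  show "\<bar>Arg (cis t)\<bar> = t"
    using t cis_Arg_unique[of "cis t" t] pi_gt_zero by (simp add: sgn_cis)
  show "\<bar>Arg (cis (- t))\<bar> = t"
  proof (cases "t = pi")
    case True
    then have "cis (- t) = cis pi" by (simp add: complex_eq_iff)
    then show ?thesis using True cis_Arg_unique[of "cis pi" pi] pi_gt_zero by (simp add: sgn_cis)
  next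
    case False
    then show ?thesis using t cis_Arg_unique[of "cis (- t)" "- t"] by (simp add: sgn_cis)
  qed
qed

lemma prod_mset_image_sum:
  "finite A \<Longrightarrow> prod_mset (image_mset f (\<Sum>i\<in>A. S i)) = (\<Prod>i\<in>A. prod_mset (image_mset f (S i)))"
  by (induction A rule: finite_induct) simp_all

lemma eigprod_angles:
  assumes "has_angles (W :: ('n::finite) rmat) \<theta>"
  shows "eigprod W = (\<Prod>i\<in>UNIV. \<theta> $ i)"
proof -
  have b: "0 \<le> \<theta> $ i" "\<theta> $ i \<le> pi" for i using assms by (auto simp: has_angles_def)
  let ?q = "\<Prod>i\<in>UNIV. [:- cis (\<theta> $ i), 1:] * [:- cis (- (\<theta> $ i)), 1:]"
  have "poly (charpoly (complexify W) ^ 2) x = poly ?q x" for x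
  proof -
    have "(x - cis t) * (x - cis (- t)) = x\<^sup>2 - 2 * x * complex_of_real (cos t) + 1" for t
    proof -
      have "cis t * cis (- t) = 1" by (simp add: cis_mult)
      moreover have "cis t + cis (- t) = 2 * complex_of_real (cos t)" by (simp add: complex_eq_iff)
      ultimately have "x\<^sup>2 - x * (cis t + cis (- t)) + cis t * cis (- t) = x\<^sup>2 - 2 * x * complex_of_real (cos t) + 1"
        by simp
      then show ?thesis by (simp add: algebra_simps power2_eq_square)
    qed
    moreover have "poly ([:- a, 1:] * [:- b, 1:]) x = (x - a) * (x - b)" for a b
      by (simp add: algebra_simps)
    ultimately have "poly ?q x = (\<Prod>i\<in>UNIV. x\<^sup>2 - 2 * x * complex_of_real (cos (\<theta> $ i)) + 1)"
      by (simp only: poly_prod)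
    then show ?thesis
      using assms by (simp only: has_angles_def poly_charpoly poly_power)
  qed
  then have "charpoly (complexify W) ^ 2 = ?q" by (simp add: poly_eq_poly_eq_iff[symmetric] fun_eq_iff)
  then have "proots (charpoly (complexify W) ^ 2) = proots ?q" by simp
  moreover have "proots ?q = (\<Sum>i\<in>UNIV. {#cis (\<theta> $ i), cis (- (\<theta> $ i))#})"
  proof -
    have "proots ([:- a, 1:] * [:- b, 1:]) = {#a, b#}" for a b :: complex
      by (subst proots_mult) auto
    then show ?thesis by (subst proots_prod) (auto intro!: sum.cong simp del: mult_pCons_left)
  qed
  ultimately have "repeat_mset 2 (eigenvalues W) = (\<Sum>i\<in>UNIV. {#cis (\<theta> $ i), cis (- (\<theta> $ i))#})"
    by (simp add: proots_power eigenvalues_def)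
  then have "eigenvalues W + eigenvalues W = (\<Sum>i\<in>UNIV. {#cis (\<theta> $ i), cis (- (\<theta> $ i))#})"
    by (simp add: numeral_2_eq_2)
  from arg_cong[OF this, of "\<lambda>S. \<Prod>z\<in>#S. \<bar>Arg z\<bar>"]
  have "(eigprod W)\<^sup>2 = (\<Prod>i\<in>UNIV. (\<theta> $ i)\<^sup>2)"
    by (simp add: eigprod_def power2_eq_square prod_mset_image_sum abs_Arg_cis b)
  then have "(eigprod W)\<^sup>2 = (\<Prod>i\<in>UNIV. \<theta> $ i)\<^sup>2" by (simp add: prod_power_distrib)
  moreover have "0 \<le> (\<Prod>z\<in>#S. \<bar>Arg z\<bar>)" for S by (induction S) auto
  then have "0 \<le> eigprod W" unfolding eigprod_def .
  ultimately show ?thesis by (simp add: power2_eq_iff_nonneg prod_nonneg b)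
qed

lemma eigprod_of_eigenvalues:
  assumes "eigenvalues (W :: ('n::finite) rmat) = (\<Sum>k\<in>(UNIV::'n set). {#cis (\<theta> k), cis (- \<theta> k)#})"
    and "\<And>k. 0 \<le> \<theta> k \<and> \<theta> k \<le> pi"
  shows "eigprod W = (\<Prod>k\<in>UNIV. \<theta> k)\<^sup>2"
  unfolding eigprod_def assms(1)
  by (simp add: prod_mset_image_sum abs_Arg_cis assms(2) prod_power_distrib power2_eq_square prod.distrib)

lemma (in normal_form) eigprod_cayley: "eigprod (cayley M) = det logM"
  using eigprod_angles[OF has_angles_cayley] det_logM by simp

lemma Sp_ell_plus_has_angles:
  assumes "W \<in> Sp_ell_plus"
  shows "\<exists>\<theta>. has_angles W \<theta>"
proof -
  obtain T d where nf: "normal_form (cayley_inv W) T d"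
    using normal_form_exists[OF Sp_ell_plus_imp_pd[OF assms]] by blast
  show ?thesis
    using normal_form.has_angles_cayley[OF nf] cayley_cayley_inv[OF Sp_ell_plus_plus_one_invertible[OF assms]] by auto
qed

text \<open>The angles lie in a compact cube and the characteristic polynomial is continuous, so the
  limits of a convergent subsequence of angles are angles of the limit matrix. This replaces the
  continuity of the individual eigenvalues.\<close>

lemma eigprod_limit:
  assumes W: "\<And>j. W j \<in> Sp_ell_plus" and lim: "W \<longlonglongrightarrow> (W0 :: ('n::finite) rmat)"
  shows "\<exists>r. strict_mono r \<and> (\<lambda>j. eigprod (W (r j))) \<longlonglongrightarrow> eigprod W0"
proof -
  have "\<forall>j. \<exists>\<theta>. has_angles (W j) \<theta>" using W Sp_ell_plus_has_angles by blast
  then obtain \<theta> where \<theta>: "\<And>j. has_angles (W j) (\<theta> j)" by metis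
  let ?C = "cbox 0 (\<chi> i. pi) :: (real ^ ('n + 'n)) set"
  have "\<theta> j \<in> ?C" for j using \<theta>[of j] by (simp add: has_angles_def mem_box_cart)
  then obtain l r where l: "l \<in> ?C" and r: "strict_mono r" and conv: "(\<theta> \<circ> r) \<longlonglongrightarrow> l"
    using compact_imp_seq_compact[OF compact_cbox[of 0 "\<chi> i. pi"]] unfolding seq_compact_def by metis
  have "has_angles W0 l"
    unfolding has_angles_def
  proof (intro conjI allI)
    show "0 \<le> l $ i" "l $ i \<le> pi" for i using l by (simp_all add: mem_box_cart)
    fix x
    have Wr: "(\<lambda>j. W (r j)) \<longlonglongrightarrow> W0" using LIMSEQ_subseq_LIMSEQ[OF lim r] by (simp add: o_def)
    have "(\<lambda>j. det (mat x - complexify (W (r j))) ^ 2) \<longlonglongrightarrow> det (mat x - complexify W0) ^ 2"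
      unfolding complexify_def map_matrix_def by (intro tendsto_intros Wr)
    moreover have "(\<lambda>j. \<Prod>i\<in>UNIV. x\<^sup>2 - 2 * x * complex_of_real (cos (\<theta> (r j) $ i)) + 1)
       \<longlonglongrightarrow> (\<Prod>i\<in>UNIV. x\<^sup>2 - 2 * x * complex_of_real (cos (l $ i)) + 1)"
      using conv by (intro tendsto_intros) (simp_all add: o_def)
    moreover have "(\<lambda>j. det (mat x - complexify (W (r j))) ^ 2) =
       (\<lambda>j. \<Prod>i\<in>UNIV. x\<^sup>2 - 2 * x * complex_of_real (cos (\<theta> (r j) $ i)) + 1)"
      using \<theta> by (simp add: has_angles_def)
    ultimately show "det (mat x - complexify W0) ^ 2 = (\<Prod>i\<in>UNIV. x\<^sup>2 - 2 * x * complex_of_real (cos (l $ i)) + 1)"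
      using LIMSEQ_unique by metis
  qed
  then have "eigprod W0 = (\<Prod>i\<in>UNIV. l $ i)" by (rule eigprod_angles)
  moreover have "(\<lambda>j. \<Prod>i\<in>UNIV. \<theta> (r j) $ i) \<longlonglongrightarrow> (\<Prod>i\<in>UNIV. l $ i)"
    using conv by (intro tendsto_intros) (simp_all add: o_def)
  ultimately show ?thesis
    using r eigprod_angles[OF \<theta>] by auto
qed

section \<open>The time function\<close>

text \<open>\<open>M ** log_factor M\<close> is \<open>artanh M\<close>, half of the logarithm of \<open>cayley M\<close>. Unlike a diagonalizing
  basis, the integral formula can be differentiated with respect to \<open>M\<close>.\<close>

definition log_factor :: "('n::finite) rmat \<Rightarrow> 'n rmat"
  where "log_factor M = integral {0..1} (\<lambda>r. matrix_inv (mat 1 - r\<^sup>2 *\<^sub>R (M ** M)))"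

definition time_det :: "('n::finite) rmat \<Rightarrow> real"
  where "time_det M = det (2 *\<^sub>R (M ** log_factor M))"

lemma bounded_linear_trace_mult: "bounded_linear (\<lambda>A. trace (C ** A) :: real)" for C :: "real^'m^'m"
  unfolding linear_conv_bounded_linear[symmetric]
  by (rule linearI) (simp_all add: mring trace_add trace_scaleR)

context normal_form
begin

lemma resolvent_fc:
  "mat 1 - r\<^sup>2 *\<^sub>R (M ** M) = fc (\<lambda>x. 1 + r\<^sup>2 * x)"
  unfolding M_squared scaleR_minus_right fc_scale fc_one[symmetric] by (simp add: fc_add)

lemma resolvent:
  "invertible (mat 1 - r\<^sup>2 *\<^sub>R (M ** M))"
  "matrix_inv (mat 1 - r\<^sup>2 *\<^sub>R (M ** M)) = fc (\<lambda>x. 1 / (1 + r\<^sup>2 * x))"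
proof -
  have "1 + r\<^sup>2 * x \<noteq> 0" if "0 < x" for x
    using that by (metis add_pos_nonneg less_irrefl less_imp_le mult_nonneg_nonneg zero_le_power2 zero_less_one)
  then show "invertible (mat 1 - r\<^sup>2 *\<^sub>R (M ** M))"
    "matrix_inv (mat 1 - r\<^sup>2 *\<^sub>R (M ** M)) = fc (\<lambda>x. 1 / (1 + r\<^sup>2 * x))"
    unfolding resolvent_fc by (auto intro: fc_inverse)
qed

definition kf :: "real \<Rightarrow> real" where "kf x = arctan (sqrt x) / sqrt x"

lemma kf_pos: "0 < x \<Longrightarrow> 0 < kf x" by (simp add: kf_def)

lemma one_plus_pos: "0 < x \<Longrightarrow> 0 < 1 + r\<^sup>2 * x" for x r :: real
  by (simp add: add_pos_nonneg)

lemma arctan_deriv: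
  assumes "0 < x"
  shows "((\<lambda>r. arctan (sqrt x * r) / sqrt x) has_real_derivative 1 / (1 + r\<^sup>2 * x)) (at r within S)"
proof -
  have "((\<lambda>r. arctan (sqrt x * r) / sqrt x) has_real_derivative (inverse (1 + (sqrt x * r)\<^sup>2) * sqrt x) / sqrt x) (at r within S)"
    by (intro DERIV_cdivide derivative_eq_intros DERIV_subset[OF DERIV_arctan]) (auto intro!: derivative_eq_intros)
  then show ?thesis using assms by (simp add: power_mult_distrib mult.commute inverse_eq_divide)
qed

lemma log_factor_fc: "log_factor M = fc kf"
proof -
  have "((\<lambda>r. matrix_inv (mat 1 - r\<^sup>2 *\<^sub>R (M ** M))) has_integral
      fc (\<lambda>x. arctan (sqrt x * 1) / sqrt x) - fc (\<lambda>x. arctan (sqrt x * 0) / sqrt x)) {0..1}"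
    unfolding resolvent
    by (rule fundamental_theorem_of_calculus) (auto intro!: fc_has_vector_derivative arctan_deriv)
  then show ?thesis
    unfolding log_factor_def fc_diff by (simp add: integral_unique kf_def[abs_def])
qed

lemma logM_log_factor: "2 *\<^sub>R (M ** log_factor M) = logM"
  unfolding log_factor_fc logM_def scaleR_matrix_right[symmetric] fc_scale kf_def by simp

lemma time_det_eq: "time_det M = det logM"
  unfolding time_det_def logM_log_factor ..

text \<open>Under the trace all functions of \<open>M\<close> can be collected on one side of \<open>M'\<close>, as if \<open>M'\<close> commuted
  with them; what remains is an integral over \<open>r\<close> inside the functional calculus.\<close>

lemma trace_log_factor_derivative:
  fixes M' :: "'n rmat"
  defines "A \<equiv> \<lambda>r. matrix_inv (mat 1 - r\<^sup>2 *\<^sub>R (M ** M))"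
  shows "trace (matrix_inv (log_factor M) ** integral {0..1} (\<lambda>r. A r ** (r\<^sup>2 *\<^sub>R (M ** M' + M' ** M)) ** A r))
    = trace (M ** fc (\<lambda>x. (kf x - 1 / (1 + x)) / (x * kf x)) ** M')"
proof -
  define a where "a = (\<lambda>r x::real. 1 / (1 + r\<^sup>2 * x))"
  have Aa: "A r = fc (a r)" for r unfolding A_def resolvent(2) a_def ..
  have Ki: "matrix_inv (log_factor M) = fc (\<lambda>x. 1 / kf x)"
    unfolding log_factor_fc by (rule fc_inverse) (use kf_pos in force)
  have tr: "trace (fc (\<lambda>x. 1 / kf x) ** (A r ** (r\<^sup>2 *\<^sub>R (M ** M' + M' ** M)) ** A r))
      = trace (M ** fc (\<lambda>x. 2 * r\<^sup>2 * (a r x)\<^sup>2 / kf x) ** M')" for r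
  proof -
    define F where "F = fc (\<lambda>x. 1 / kf x)"
    define Q where "Q = A r ** F ** A r"
    have Q: "Q = fc (\<lambda>x. (a r x)\<^sup>2 / kf x)"
      unfolding Q_def F_def Aa fc_mult by (rule fc_cong) (simp add: power2_eq_square)
    have QM: "Q ** M = M ** Q" unfolding Q by (rule fc_commute[symmetric])
    have "trace (F ** (A r ** (r\<^sup>2 *\<^sub>R (M ** M' + M' ** M)) ** A r))
       = r\<^sup>2 * (trace ((F ** A r ** M ** M') ** A r) + trace ((F ** A r ** M') ** (M ** A r)))"
      by (simp add: mring trace_add trace_scaleR)
    also have "trace ((F ** A r ** M ** M') ** A r) = trace (A r ** (F ** A r ** M ** M'))" by (rule trace_mul_sym)
    also have "A r ** (F ** A r ** M ** M') = Q ** M ** M'" by (simp add: Q_def matrix_mul_assoc)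
    also have "trace ((F ** A r ** M') ** (M ** A r)) = trace ((M ** A r) ** (F ** A r ** M'))" by (rule trace_mul_sym)
    also have "(M ** A r) ** (F ** A r ** M') = M ** Q ** M'" by (simp add: Q_def matrix_mul_assoc)
    also have "r\<^sup>2 * (trace (Q ** M ** M') + trace (M ** Q ** M')) = (2 * r\<^sup>2) * trace (M ** Q ** M')"
      unfolding QM by simp
    also have "\<dots> = trace (M ** ((2 * r\<^sup>2) *\<^sub>R Q) ** M')"
      by (simp add: mring trace_scaleR)
    also have "(2 * r\<^sup>2) *\<^sub>R Q = fc (\<lambda>x. 2 * r\<^sup>2 * (a r x)\<^sup>2 / kf x)"
      unfolding Q fc_scale by simp
    finally show ?thesis by (simp only: F_def)
  qed
  \<comment> \<open>The primitive in \<open>r\<close> of the integrand, for each eigenvalue \<open>x\<close> of \<open>- M\<^sup>2\<close>.\<close>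
  define h where "h = (\<lambda>r x. (arctan (sqrt x * r) / sqrt x - r / (1 + r\<^sup>2 * x)) / (x * kf x))"
  have hd: "((\<lambda>r. h r x) has_real_derivative 2 * r\<^sup>2 * (a r x)\<^sup>2 / kf x) (at r within S)" if x: "0 < x" for r x S
  proof -
    have p: "1 + r\<^sup>2 * x \<noteq> 0" using one_plus_pos[OF x, of r] by simp
    have "((\<lambda>r. r / (1 + r\<^sup>2 * x)) has_real_derivative ((1 + r\<^sup>2 * x) - r * (2 * r * x)) / (1 + r\<^sup>2 * x)\<^sup>2) (at r within S)"
      using p by (auto intro!: derivative_eq_intros simp: power2_eq_square)
    then have "((\<lambda>r. h r x) has_real_derivative (1 / (1 + r\<^sup>2 * x) - ((1 + r\<^sup>2 * x) - r * (2 * r * x)) / (1 + r\<^sup>2 * x)\<^sup>2) / (x * kf x)) (at r within S)"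
      unfolding h_def by (intro DERIV_cdivide DERIV_diff arctan_deriv x)
    moreover have "1 / (1 + r\<^sup>2 * x) - ((1 + r\<^sup>2 * x) - r * (2 * r * x)) / (1 + r\<^sup>2 * x)\<^sup>2 = x * (2 * r\<^sup>2 * (a r x)\<^sup>2)"
    proof -
      have "1 / q - (q - r * (2 * r * x)) / q\<^sup>2 = x * (2 * r\<^sup>2 * (1 / q)\<^sup>2)" if "q \<noteq> 0" for q :: real
        using that by (simp add: field_simps power2_eq_square)
      from this[OF p] show ?thesis by (simp add: a_def)
    qed
    ultimately show ?thesis using x by simp
  qed
  have "((\<lambda>r. trace (M ** fc (\<lambda>x. 2 * r\<^sup>2 * (a r x)\<^sup>2 / kf x) ** M')) has_integral
      trace (M ** fc (h 1) ** M') - trace (M ** fc (h 0) ** M')) {0..1}"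
  proof (rule fundamental_theorem_of_calculus)
    fix r :: real
    have "((\<lambda>r. (M ** fc (h r)) ** M') has_vector_derivative (M ** fc (\<lambda>x. 2 * r\<^sup>2 * (a r x)\<^sup>2 / kf x)) ** M') (at r within {0..1})"
      using has_vector_derivative_matrix_mult[OF M_fc_has_vector_derivative[OF hd] has_vector_derivative_const] by simp
    from bounded_linear.has_vector_derivative[OF bounded_linear_trace_mult[of "mat 1"] this]
    show "((\<lambda>r. trace (M ** fc (h r) ** M')) has_vector_derivative trace (M ** fc (\<lambda>x. 2 * r\<^sup>2 * (a r x)\<^sup>2 / kf x) ** M')) (at r within {0..1})"
      by simp
  qed simp
  moreover have "h 0 = (\<lambda>x. 0)" by (simp add: h_def fun_eq_iff)
  moreover have "fc (\<lambda>x. 0) = 0" using fc_scale[of 0 "\<lambda>x. 0"] by simp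
  moreover have "fc (h 1) = fc (\<lambda>x. (kf x - 1 / (1 + x)) / (x * kf x))"
    by (simp add: h_def kf_def)
  ultimately have I: "((\<lambda>r. trace (M ** fc (\<lambda>x. 2 * r\<^sup>2 * (a r x)\<^sup>2 / kf x) ** M')) has_integral
      trace (M ** fc (\<lambda>x. (kf x - 1 / (1 + x)) / (x * kf x)) ** M')) {0..1}"
    by (simp add: trace_0[unfolded mat_0] trace_def)
  have "(\<lambda>r. A r ** (r\<^sup>2 *\<^sub>R (M ** M' + M' ** M)) ** A r) integrable_on {0..1}"
    unfolding A_def by (intro integrable_continuous_interval continuous_intros resolvent)
  from integral_linear[OF this bounded_linear_trace_mult[of "matrix_inv (log_factor M)"]]
  show ?thesis
    unfolding Ki o_def tr using integral_unique[OF I] by simp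
qed

text \<open>The logarithmic derivative of the time function in the direction of \<open>X\<close> is
  \<open>trace (logM\<^sup>-\<^sup>1 ** X)\<close>, as if \<open>X\<close> commuted with \<open>logM\<close>: this is the rule
  \<open>d tr f(W) = tr (f'(W) dW)\<close> for traces of functions of a matrix.\<close>

lemma trace_time_derivative:
  fixes X :: "'n rmat"
  defines "M' \<equiv> (1/2) *\<^sub>R ((mat 1 - M) ** X ** (mat 1 + M))"
  shows "trace (matrix_inv M ** M') + trace (M ** fc (\<lambda>x. (kf x - 1 / (1 + x)) / (x * kf x)) ** M')
    = trace (matrix_inv logM ** X)"
proof -
  have Mi: "matrix_inv M = - (M ** fc (\<lambda>x. 1 / x))"
  proof (rule matrix_inv_eqI)
    have "M ** - (M ** fc (\<lambda>x. 1 / x)) = fc (\<lambda>x. x * (1 / x))"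
      by (simp add: matrix_minus_right matrix_mul_assoc M_squared matrix_minus_left fc_mult)
    also have "\<dots> = fc (\<lambda>x. 1)" by (rule fc_cong) simp
    finally show "M ** - (M ** fc (\<lambda>x. 1 / x)) = mat 1" by (simp add: fc_one)
  qed
  define g where "g = (\<lambda>x. - (1 / ((1 + x) * x * kf x)))"
  have "trace (matrix_inv M ** M') + trace (M ** fc (\<lambda>x. (kf x - 1 / (1 + x)) / (x * kf x)) ** M')
    = trace (M ** (fc (\<lambda>x. (kf x - 1 / (1 + x)) / (x * kf x)) - fc (\<lambda>x. 1 / x)) ** M')"
    unfolding trace_add[symmetric] Mi by (simp add: mring)
  also have "fc (\<lambda>x. (kf x - 1 / (1 + x)) / (x * kf x)) - fc (\<lambda>x. 1 / x) = fc g"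
    unfolding fc_diff
  proof (rule fc_cong)
    fix x :: real assume x: "0 < x"
    have "(k - 1 / q) / (x * k) - 1 / x = - (1 / (q * x * k))" if "k \<noteq> 0" "q \<noteq> 0" for k q :: real
      using that x by (simp add: field_simps)
    from this[of "kf x" "1 + x"] show "(kf x - 1 / (1 + x)) / (x * kf x) - 1 / x = g x"
      using kf_pos[OF x] x by (simp add: g_def)
  qed
  also have "trace (M ** fc g ** M') = (1/2) * trace ((M ** fc g ** (mat 1 - M) ** X) ** (mat 1 + M))"
    by (simp add: M'_def scaleR_matrix_right trace_scaleR matrix_mul_assoc)
  also have "trace ((M ** fc g ** (mat 1 - M) ** X) ** (mat 1 + M)) = trace ((mat 1 + M) ** (M ** fc g ** (mat 1 - M) ** X))"
    by (rule trace_mul_sym)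
  also have "(mat 1 + M) ** (M ** fc g ** (mat 1 - M) ** X) = (M ** fc g - M ** fc g ** (M ** M)) ** X"
  proof -
    have "(mat 1 + M) ** (M ** fc g) = (M ** fc g) ** (mat 1 + M)"
    proof -
      have "M ** (M ** fc g) = M ** (fc g ** M)" by (subst fc_commute) (rule refl)
      then show ?thesis by (simp add: mring)
    qed
    then have "(mat 1 + M) ** (M ** fc g ** (mat 1 - M) ** X) = (M ** fc g) ** ((mat 1 + M) ** (mat 1 - M)) ** X"
      by (simp add: matrix_mul_assoc)
    also have "(mat 1 + M) ** (mat 1 - M) = mat 1 - M ** M" by (simp add: mring)
    finally show ?thesis by (simp add: mring)
  qed
  also have "M ** fc g - M ** fc g ** (M ** M) = M ** fc (\<lambda>x. g x * (1 + x))"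
    unfolding M_squared by (simp add: mring matrix_mul_assoc[symmetric, of M] fc_mult)
      (simp add: matrix_add_ldistrib[symmetric] fc_add algebra_simps)
  also have "fc (\<lambda>x. g x * (1 + x)) = fc (\<lambda>x. - (1 / (x * kf x)))"
  proof (rule fc_cong)
    fix x :: real assume x: "0 < x"
    have "- (1 / (q * x * k)) * q = - (1 / (x * k))" if "q \<noteq> 0" for k q :: real
      using that by simp
    from this[of "1 + x" "kf x"] show "g x * (1 + x) = - (1 / (x * kf x))" using x by (simp add: g_def)
  qed
  also have "(1/2) * trace (M ** fc (\<lambda>x. - (1 / (x * kf x))) ** X) = trace (M ** fc (\<lambda>x. - (1 / (2 * x * kf x))) ** X)"
  proof -
    have "fc (\<lambda>x. - (1 / (2 * x * kf x))) = (1/2) *\<^sub>R fc (\<lambda>x. - (1 / (x * kf x)))"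
      unfolding fc_scale by (simp add: mult.assoc)
    then show ?thesis by (simp add: mring trace_scaleR)
  qed
  also have "M ** fc (\<lambda>x. - (1 / (2 * x * kf x))) = matrix_inv logM"
  proof (rule matrix_inv_eqI[symmetric])
    have "logM ** (M ** fc (\<lambda>x. - (1 / (2 * x * kf x)))) = fc (\<lambda>x. - (x * (2 * arctan (sqrt x) / sqrt x) * - (1 / (2 * x * kf x))))"
      unfolding logM_def M_fc_mult fc_minus ..
    also have "\<dots> = fc (\<lambda>x. 1)"
    proof (rule fc_cong)
      fix x :: real assume x: "0 < x"
      have "- (x * (2 * k) * - (1 / (2 * x * k))) = 1" if "k \<noteq> 0" for k using that x by simp
      from this[of "kf x"] show "- (x * (2 * arctan (sqrt x) / sqrt x) * - (1 / (2 * x * kf x))) = 1"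
        using kf_pos[OF x] x by (simp add: kf_def)
    qed
    finally show "logM ** (M ** fc (\<lambda>x. - (1 / (2 * x * kf x)))) = mat 1" by (simp add: fc_one)
  qed
  finally show ?thesis .
qed

end

lemma continuous_on_has_vector_derivative:
  "(\<And>t. t \<in> S \<Longrightarrow> (f has_vector_derivative f' t) (at t within S)) \<Longrightarrow> continuous_on S f"
  unfolding continuous_on_eq_continuous_within by (blast intro: has_vector_derivative_continuous)

text \<open>Differentiation under the integral sign.\<close>

lemma log_factor_has_vector_derivative:
  fixes M M' :: "real \<Rightarrow> ('n::finite) rmat"
  assumes M: "\<And>t. t \<in> {a..b} \<Longrightarrow> (M has_vector_derivative M' t) (at t within {a..b})"
    and M': "continuous_on {a..b} M'" and B: "\<And>t. t \<in> {a..b} \<Longrightarrow> pd (Om ** M t)"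
    and t: "t \<in> {a..b}"
  defines "A \<equiv> \<lambda>t r. matrix_inv (mat 1 - r\<^sup>2 *\<^sub>R (M t ** M t))"
  shows "((\<lambda>t. log_factor (M t)) has_vector_derivative
    integral {0..1} (\<lambda>r. A t r ** (r\<^sup>2 *\<^sub>R (M t ** M' t + M' t ** M t)) ** A t r)) (at t within {a..b})"
proof -
  have inv: "invertible (mat 1 - r\<^sup>2 *\<^sub>R (M t ** M t))" if "t \<in> {a..b}" for t r
    using normal_form_exists[OF B[OF that]] normal_form.resolvent(1) by metis
  have cM: "continuous_on {a..b} M"
    using M by (rule continuous_on_has_vector_derivative)
  have cM2: "continuous_on ({a..b} \<times> cbox 0 1) (\<lambda>p. M (fst p))" "continuous_on ({a..b} \<times> cbox 0 1) (\<lambda>p. M' (fst p))"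
    by (rule continuous_on_compose2[OF cM continuous_on_fst[OF continuous_on_id]], force,
        rule continuous_on_compose2[OF M' continuous_on_fst[OF continuous_on_id]], force)
  have "((\<lambda>t. integral (cbox 0 1) (A t)) has_vector_derivative
    integral (cbox 0 1) (\<lambda>r. A t r ** (r\<^sup>2 *\<^sub>R (M t ** M' t + M' t ** M t)) ** A t r)) (at t within {a..b})"
  proof (rule leibniz_rule_vector_derivative[where U = "{a..b}"])
    fix t r :: real assume t: "t \<in> {a..b}"
    have "((\<lambda>t. mat 1 - r\<^sup>2 *\<^sub>R (M t ** M t)) has_vector_derivative 0 - r\<^sup>2 *\<^sub>R (M t ** M' t + M' t ** M t)) (at t within {a..b})"
      by (intro has_vector_derivative_diff has_vector_derivative_const
          bounded_linear.has_vector_derivative[OF bounded_linear_scaleR_right] has_vector_derivative_matrix_mult M t)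
    from has_vector_derivative_matrix_inv[OF this inv[OF t]]
    show "((\<lambda>t. A t r) has_vector_derivative A t r ** (r\<^sup>2 *\<^sub>R (M t ** M' t + M' t ** M t)) ** A t r) (at t within {a..b})"
      by (simp add: A_def matrix_minus_left matrix_minus_right)
  next
    fix t assume "t \<in> {a..b}"
    then show "A t integrable_on cbox 0 1"
      unfolding A_def by (intro integrable_continuous continuous_intros inv)
  next
    show "continuous_on ({a..b} \<times> cbox 0 1) (\<lambda>(t, r). A t r ** (r\<^sup>2 *\<^sub>R (M t ** M' t + M' t ** M t)) ** A t r)"
      unfolding A_def split_beta by (intro continuous_intros cM2 inv) auto
  qed (use t in auto)
  then show ?thesis unfolding log_factor_def A_def by simp
qed

lemma time_det_has_derivative:
  fixes M X :: "real \<Rightarrow> ('n::finite) rmat"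
  assumes M: "\<And>t. t \<in> {a..b} \<Longrightarrow> (M has_vector_derivative
      (1/2) *\<^sub>R ((mat 1 - M t) ** X t ** (mat 1 + M t))) (at t within {a..b})"
    and X: "continuous_on {a..b} X" and B: "\<And>t. t \<in> {a..b} \<Longrightarrow> pd (Om ** M t)"
    and t: "t \<in> {a..b}"
  shows "((\<lambda>t. time_det (M t)) has_real_derivative
    time_det (M t) * trace (matrix_inv (2 *\<^sub>R (M t ** log_factor (M t))) ** X t)) (at t within {a..b})"
proof -
  define M' where "M' = (\<lambda>t. (1/2) *\<^sub>R ((mat 1 - M t) ** X t ** (mat 1 + M t)))"
  have Md: "(M has_vector_derivative M' t) (at t within {a..b})" if "t \<in> {a..b}" for t
    using M[OF that] by (simp add: M'_def)
  have cM: "continuous_on {a..b} M"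
    using M by (rule continuous_on_has_vector_derivative)
  have cM': "continuous_on {a..b} M'" unfolding M'_def by (intro continuous_intros cM X)
  obtain T d where nf: "normal_form (M t) T d" using normal_form_exists[OF B[OF t]] by blast
  interpret normal_form "M t" T d by (rule nf)
  have invM: "invertible (M t)" using pd_invertible[OF pdM] by (simp add: invertible_det_nz det_sp)
  have invK: "invertible (log_factor (M t))"
    unfolding log_factor_fc by (rule fc_inverse) (use kf_pos in force)
  define A where "A = (\<lambda>r. matrix_inv (mat 1 - r\<^sup>2 *\<^sub>R (M t ** M t)))"
  define K' where "K' = integral {0..1} (\<lambda>r. A r ** (r\<^sup>2 *\<^sub>R (M t ** M' t + M' t ** M t)) ** A r)"
  have Kd: "((\<lambda>t. log_factor (M t)) has_vector_derivative K') (at t within {a..b})"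
    unfolding K'_def A_def by (rule log_factor_has_vector_derivative[OF Md cM' B t])
  have d1: "((\<lambda>t. det (M t)) has_real_derivative det (M t) * trace (matrix_inv (M t) ** M' t)) (at t within {a..b})"
    using has_vector_derivative_det[OF Md[OF t] invM] by (simp add: has_real_derivative_iff_has_vector_derivative)
  have d2: "((\<lambda>t. det (log_factor (M t))) has_real_derivative det (log_factor (M t)) * trace (matrix_inv (log_factor (M t)) ** K')) (at t within {a..b})"
    using has_vector_derivative_det[OF Kd invK] by (simp add: has_real_derivative_iff_has_vector_derivative)
  have td: "time_det (M t) = 2 ^ CARD('n + 'n) * (det (M t) * det (log_factor (M t)))" for t
    by (simp only: time_det_def det_scaleR det_mul)
  have "((\<lambda>t. time_det (M t)) has_real_derivative time_det (M t) * (trace (matrix_inv (M t) ** M' t) + trace (matrix_inv (log_factor (M t)) ** K'))) (at t within {a..b})"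
    unfolding td by (rule derivative_eq_intros d1 d2 refl)+ (simp add: algebra_simps)
  moreover have "trace (matrix_inv (log_factor (M t)) ** K') = trace (M t ** fc (\<lambda>x. (kf x - 1 / (1 + x)) / (x * kf x)) ** M' t)"
    unfolding K'_def A_def by (rule trace_log_factor_derivative)
  ultimately show ?thesis
    unfolding logM_log_factor using trace_time_derivative[of "X t"] by (simp add: M'_def)
qed

text \<open>The inequality of arithmetic and geometric means bounds the metric by a linear function of \<open>X\<close>,
  namely the one which is the derivative of the root of \<open>det Y\<close>.\<close>

lemma det_trace_root:
  assumes "pd (Om ** Y)" "psd (Om ** (X :: ('n::finite) rmat))"
  shows "G_id X \<le> root (2 * CARD('n)) (det Y) * trace (matrix_inv Y ** X) / real (2 * CARD('n))"
proof -
  let ?N = "2 * CARD('n)"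
  have N: "CARD('n + 'n) = ?N" by simp
  have iY: "invertible Y" using pd_invertible[OF assms(1)] by (simp add: invertible_det_nz det_sp)
  have "matrix_inv (Om ** Y) ** (Om ** X) = matrix_inv Y ** (matrix_inv Om ** Om) ** X"
    by (simp add: matrix_inv_mult[OF invertible_Om iY] matrix_mul_assoc)
  then have tr: "trace (matrix_inv (Om ** Y) ** (Om ** X)) = trace (matrix_inv Y ** X)"
    by (simp add: matrix_inv_left invertible_Om)
  have Y: "0 < det Y" using pd_det_pos[OF assms(1)] by (simp add: det_sp)
  have X: "0 \<le> det X" using psd_det_nonneg[OF assms(2)] by (simp add: det_sp)
  define s where "s = trace (matrix_inv Y ** X) / real ?N"
  have s: "0 \<le> s" "det X / det Y \<le> s ^ ?N"
    using det_le_trace_power[OF assms] unfolding tr det_sp N s_def by simp_all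
  have "root ?N (det X / det Y) \<le> root ?N (s ^ ?N)"
    by (rule real_root_le_mono[OF _ s(2)]) simp
  then have "root ?N (det X) / root ?N (det Y) \<le> s"
    using s(1) by (simp add: real_root_divide real_root_power_cancel)
  moreover have "0 < root ?N (det Y)" using Y by simp
  ultimately have "root ?N (det X) \<le> s * root ?N (det Y)" by (simp add: pos_divide_le_eq)
  then show ?thesis by (simp add: G_id_def s_def mult.commute)
qed

text \<open>The derivative of the \<open>2n\<close>-th root of the time function is the linear function of \<open>X\<close> which
  bounds the metric in \<open>det_trace_root\<close>.\<close>

theorem length_le_time_increase:
  fixes M X :: "real \<Rightarrow> ('n::finite) rmat"
  assumes ab: "a \<le> b" and M: "\<And>t. t \<in> {a..b} \<Longrightarrow> (M has_vector_derivative
      (1/2) *\<^sub>R ((mat 1 - M t) ** X t ** (mat 1 + M t))) (at t within {a..b})"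
    and X: "continuous_on {a..b} X" and B: "\<And>t. t \<in> {a..b} \<Longrightarrow> pd (Om ** M t)"
    and Xp: "\<And>t. t \<in> {a..b} \<Longrightarrow> psd (Om ** X t)"
  shows "integral {a..b} (\<lambda>t. G_id (X t)) \<le> root (2 * CARD('n)) (time_det (M b)) - root (2 * CARD('n)) (time_det (M a))"
proof -
  let ?N = "2 * CARD('n)"
  let ?Y = "\<lambda>t. 2 *\<^sub>R (M t ** log_factor (M t))"
  define g where "g = (\<lambda>t. root ?N (time_det (M t)) * trace (matrix_inv (?Y t) ** X t) / real ?N)"
  have Yp: "pd (Om ** ?Y t)" if t: "t \<in> {a..b}" for t
  proof -
    obtain T d where "normal_form (M t) T d" using normal_form_exists[OF B[OF t]] by blast
    then show ?thesis using normal_form.logM_log_factor normal_form.logM_pd by metis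
  qed
  have pos: "0 < time_det (M t)" if "t \<in> {a..b}" for t
    using pd_det_pos[OF Yp[OF that]] by (simp add: det_sp time_det_def)
  have "(g has_integral root ?N (time_det (M b)) - root ?N (time_det (M a))) {a..b}"
  proof (rule fundamental_theorem_of_calculus[OF ab])
    fix t assume t: "t \<in> {a..b}"
    let ?R = "root ?N (time_det (M t))"
    have R: "0 < ?R" using pos[OF t] by simp
    have "(root ?N has_real_derivative inverse (real ?N * ?R ^ (?N - Suc 0))) (at (time_det (M t)))"
      by (rule DERIV_real_root) (simp_all add: pos[OF t])
    from DERIV_chain2[OF this time_det_has_derivative[OF M X B t]]
    have "((\<lambda>t. root ?N (time_det (M t))) has_real_derivative
       inverse (real ?N * ?R ^ (?N - Suc 0)) * (time_det (M t) * trace (matrix_inv (?Y t) ** X t))) (at t within {a..b})" .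
    moreover have "inverse (real ?N * ?R ^ (?N - Suc 0)) * (time_det (M t) * trace (matrix_inv (?Y t) ** X t)) = g t"
    proof -
      have "time_det (M t) = ?R ^ ?N" using pos[OF t] by simp
      also have "\<dots> = ?R ^ (?N - Suc 0) * ?R"
        using power_Suc2[of ?R "?N - Suc 0"] by simp
      finally have e: "time_det (M t) = ?R ^ (?N - Suc 0) * ?R" .
      have "inverse (c * q) * ((q * R) * s) = R * s / c" if "q \<noteq> 0" for c q R s :: real
        using that by (simp add: field_simps)
      from this[of "?R ^ (?N - Suc 0)" "real ?N" ?R "trace (matrix_inv (?Y t) ** X t)"] R
      show ?thesis unfolding g_def e[symmetric] by simp
    qed
    ultimately show "((\<lambda>t. root ?N (time_det (M t))) has_vector_derivative g t) (at t within {a..b})"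
      by (simp add: has_real_derivative_iff_has_vector_derivative)
  qed
  then have gi: "g integrable_on {a..b}" "integral {a..b} g = root ?N (time_det (M b)) - root ?N (time_det (M a))"
    by (auto simp: integral_unique)
  have "integral {a..b} (\<lambda>t. G_id (X t)) \<le> integral {a..b} g"
  proof (rule integral_le)
    show "(\<lambda>t. G_id (X t)) integrable_on {a..b}"
      unfolding G_id_def by (intro integrable_continuous_interval continuous_intros X)
    show "g integrable_on {a..b}" by (rule gi)
    show "G_id (X t) \<le> g t" if "t \<in> {a..b}" for t
      using det_trace_root[OF Yp[OF that] Xp[OF that]] by (simp add: g_def time_det_def)
  qed
  then show ?thesis by (simp add: gi)
qed

section \<open>Continuous logarithms\<close>

text \<open>The difference is continuous and takes values in the discrete set \<open>2 \<pi> i \<int>\<close>.\<close>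

lemma continuous_logs_agree:
  fixes f g :: "'a::topological_space \<Rightarrow> complex"
  assumes S: "connected S" and f: "continuous_on S f" and g: "continuous_on S g"
    and eq: "\<And>x. x \<in> S \<Longrightarrow> exp (f x) = exp (g x)" and x: "x \<in> S" and y: "y \<in> S"
  shows "f x - g x = f y - g y"
proof -
  define h where "h = (\<lambda>x. f x - g x)"
  have h1: "exp (h x) = 1" if "x \<in> S" for x using eq[OF that] by (simp add: h_def exp_diff)
  have "h constant_on S"
  proof (rule continuous_discrete_range_constant[OF S])
    show "continuous_on S h" unfolding h_def by (intro continuous_intros f g)
    fix x assume x: "x \<in> S"
    have "2 * pi \<le> norm (h y - h x)" if y: "y \<in> S" "h y \<noteq> h x" for y
    proof -
      have "exp (h y - h x) = 1" using h1[OF x] h1[OF y(1)] by (simp add: exp_diff)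
      then obtain n :: int where re: "Re (h y - h x) = 0" and n: "Im (h y - h x) = of_int (2 * n) * pi"
        unfolding exp_eq_1 by blast
      have "n \<noteq> 0" using y(2) re n by (auto simp: complex_eq_iff)
      then have "1 \<le> \<bar>real_of_int n\<bar>" by linarith
      then have "2 * pi * 1 \<le> 2 * pi * \<bar>real_of_int n\<bar>" by (intro mult_left_mono) auto
      also have "\<dots> = \<bar>Im (h y - h x)\<bar>" unfolding n by (simp add: abs_mult)
      also have "\<dots> \<le> norm (h y - h x)" by (rule abs_Im_le_cmod)
      finally show ?thesis by simp
    qed
    then show "\<exists>e>0. \<forall>y. y \<in> S \<and> h y \<noteq> h x \<longrightarrow> e \<le> norm (h y - h x)"
      by (intro exI[of _ "2 * pi"]) auto
  qed
  then show ?thesis using x y unfolding constant_on_def h_def by metis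
qed

text \<open>The loop along \<open>p\<close> and back along \<open>q\<close> is null homotopic, and along such a loop a continuous
  logarithm of \<open>F\<close> returns to its initial value.\<close>

lemma log_increment_path_independent:
  fixes S :: "'a::topological_space set" and F :: "'a \<Rightarrow> complex" and p q :: "real \<Rightarrow> 'a"
  assumes S: "simply_connected S" and F: "continuous_on S F" and F0: "\<And>x. x \<in> S \<Longrightarrow> F x \<noteq> 0"
    and p: "continuous_on {0..1} p" "p ` {0..1} \<subseteq> S" and q: "continuous_on {0..1} q" "q ` {0..1} \<subseteq> S"
    and ends: "p 0 = q 0" "p 1 = q 1"
    and L: "continuous_on {0..1} L" "\<And>t. t \<in> {0..1} \<Longrightarrow> exp (L t) = F (p t)"
    and K: "continuous_on {0..1} K" "\<And>t. t \<in> {0..1} \<Longrightarrow> exp (K t) = F (q t)"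
  shows "L 1 - L 0 = K 1 - K 0"
proof -
  define g where "g = p +++ reversepath q"
  have pp: "path p" "path (reversepath q)" "path_image p \<subseteq> S" "path_image (reversepath q) \<subseteq> S"
    using p q by (simp_all add: path_def[symmetric]) (auto simp: path_image_def)
  have pe: "pathfinish p = pathstart (reversepath q)" "pathfinish (reversepath q) = pathstart p"
    using ends by (simp_all add: pathfinish_def pathstart_def reversepath_def)
  have g: "path g" "path_image g \<subseteq> S" "pathfinish g = pathstart g"
    unfolding g_def using pp pe path_image_join[OF pe(1)] by (auto intro!: path_join_imp)
  have "p 0 \<in> S" using p by auto
  then have "path (\<lambda>_. p 0)" "path_image (\<lambda>_. p 0) \<subseteq> S" "pathfinish (\<lambda>_. p 0) = pathstart (\<lambda>_. p 0)"
    by (auto simp: path_def path_image_def pathfinish_def pathstart_def)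
  then have "homotopic_loops S g (\<lambda>_. p 0)"
    using S g unfolding simply_connected_def by blast
  \<comment> \<open>A null homotopy of the loop which runs along \<open>p\<close> and back along \<open>q\<close>. On its domain, a
    square, \<open>F \<circ> h\<close> has a continuous logarithm; it is compared with \<open>L\<close> and \<open>K\<close> on the two halves of
    the side of the loop.\<close>
  then obtain h where hc: "continuous_on ({0..1} \<times> {0..1}) h" and hS: "h \<in> ({0..1::real} \<times> {0..1::real}) \<rightarrow> S"
    and h0: "\<And>x. x \<in> {0..1} \<Longrightarrow> h (0, x) = g x" and h1: "\<And>x. x \<in> {0..1} \<Longrightarrow> h (1, x) = p 0"
    and hl: "\<And>t. t \<in> {0..1} \<Longrightarrow> h (t, 1) = h (t, 0)"
    unfolding homotopic_loops by (auto simp: pathfinish_def pathstart_def)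
  let ?Q = "{0..1::real} \<times> {0..1::real}"
  have c: "continuous_on ?Q (F \<circ> h)"
    using hc F hS by (intro continuous_on_compose) (auto intro: continuous_on_subset)
  have Q: "contractible ?Q" by (intro convex_imp_contractible convex_Times) auto
  have nz: "(F \<circ> h) z \<noteq> 0" if "z \<in> ?Q" for z
    using F0[OF funcset_mem[OF hS that]] by simp
  obtain l where l: "continuous_on ?Q l" "\<And>z. z \<in> ?Q \<Longrightarrow> (F \<circ> h) z = exp (l z)"
    using continuous_logarithm_on_contractible[OF c Q nz] by blast
  have le: "exp (l (s, t)) = F (h (s, t))" if "s \<in> {0..1}" "t \<in> {0..1}" for s t
    using l(2)[of "(s, t)"] that by simp
  have cl: "continuous_on {0..1} (\<lambda>t. l (u t, v t))"
    if "continuous_on {0..1} u" "continuous_on {0..1} v" "\<And>t. t \<in> {0..1} \<Longrightarrow> u t \<in> {0..1} \<and> v t \<in> {0..1}"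
    for u v :: "real \<Rightarrow> real"
  proof (rule continuous_on_compose2[OF l(1)])
    show "continuous_on {0..1} (\<lambda>t. (u t, v t))" by (intro continuous_on_Pair that)
    show "(\<lambda>t. (u t, v t)) ` {0..1} \<subseteq> ?Q" using that(3) by blast
  qed
  have conn: "connected {0..1::real}" by simp
  have e1: "l (0, 1) - l (0, 0) = l (1, 1) - l (1, 0)"
  proof (rule continuous_logs_agree[OF conn, where f = "\<lambda>t. l (t, 1)" and g = "\<lambda>t. l (t, 0)"])
    show "continuous_on {0..1} (\<lambda>t. l (t, 1))" by (rule cl) (auto intro!: continuous_intros)
    show "continuous_on {0..1} (\<lambda>t. l (t, 0))" by (rule cl) (auto intro!: continuous_intros)
    show "exp (l (t, 1)) = exp (l (t, 0))" if "t \<in> {0..1}" for t using le[OF that, of 0] le[OF that, of 1] hl[OF that] by simp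
  qed auto
  have e2: "l (1, 1) - 0 = l (1, 0) - 0"
  proof -
    have "l (1, 1) - l (1, 0) = l (1, 0) - l (1, 0)"
    proof (rule continuous_logs_agree[OF conn, where f = "\<lambda>t. l (1, t)" and g = "\<lambda>t. l (1, 0)"])
      show "continuous_on {0..1} (\<lambda>t. l (1, t))" by (rule cl) (auto intro!: continuous_intros)
      show "exp (l (1, t)) = exp (l (1, 0))" if "t \<in> {0..1}" for t using le[of 1 t] le[of 1 0] h1[OF that] h1[of 0] that by simp
    qed auto
    then show ?thesis by simp
  qed
  have e3: "l (0, 1/2) - L 1 = l (0, 0) - L 0"
  proof -
    have "l (0, 1 / 2) - L 1 = l (0, 0 / 2) - L 0"
    proof (rule continuous_logs_agree[OF conn, where f = "\<lambda>t. l (0, t / 2)" and g = L])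
      show "continuous_on {0..1} (\<lambda>t. l (0, t / 2))" by (rule cl) (auto intro!: continuous_intros)
      show "exp (l (0, x / 2)) = exp (L x)" if "x \<in> {0..1}" for x
        using that by (simp add: le h0 g_def joinpaths_def L(2))
    qed (use L in auto)
    then show ?thesis by simp
  qed
  have e4: "l (0, 1/2) - K 1 = l (0, 1) - K 0"
  proof -
    have "l (0, 1 - 1 / 2) - K 1 = l (0, 1 - 0 / 2) - K 0"
    proof (rule continuous_logs_agree[OF conn, where f = "\<lambda>t. l (0, 1 - t / 2)" and g = K])
      show "continuous_on {0..1} (\<lambda>t. l (0, 1 - t / 2))" by (rule cl) (auto intro!: continuous_intros)
      show "exp (l (0, 1 - x / 2)) = exp (K x)" if x: "x \<in> {0..1}" for x
      proof -
        have "g (1 - x / 2) = q x"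
        proof (cases "x = 1")
          case True then show ?thesis using ends by (simp add: g_def joinpaths_def)
        next
          case False then show ?thesis using x by (simp add: g_def joinpaths_def reversepath_def)
        qed
        then show ?thesis using x by (simp add: le h0 K(2))
      qed
    qed (use K in auto)
    then show ?thesis by simp
  qed
  show ?thesis using e1 e2 e3 e4 by algebra
qed

section \<open>Crossings of the eigenvalue -1\<close>

text \<open>In the Cayley chart this is \<open>(1 + i s B) (W + 1)\<close> with \<open>B = Om ** cayley_inv W\<close>, so that,
  where \<open>det (W + 1)\<close> is positive, the argument of the determinant is the sum of the \<open>arctan (s b)\<close> over
  the eigenvalues \<open>b\<close> of \<open>B\<close>. But the matrix is defined, and invertible, also where -1 is an eigenvalue of \<open>W\<close>.\<close>

definition maslov_mat :: "real \<Rightarrow> ('n::finite) rmat \<Rightarrow> 'n cmat"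
  where "maslov_mat s W = complexify (W + mat 1) + mat (\<i> * complex_of_real s) ** complexify (Om ** (W - mat 1))"

definition maslov_det :: "real \<Rightarrow> ('n::finite) rmat \<Rightarrow> complex"
  where "maslov_det s W = det (maslov_mat s W)"

lemma parts_i_smult [simp]:
  "re_part ((\<i> * complex_of_real s) *s v) = - s *\<^sub>R im_part v"
  "im_part ((\<i> * complex_of_real s) *s v) = s *\<^sub>R re_part v"
  by (simp_all add: re_part_def im_part_def vec_eq_iff)

lemma parts_ii_smult [simp]: "re_part (\<i> *s v) = - im_part v" "im_part (\<i> *s v) = re_part v"
  using parts_i_smult[of 1 v] by simp_all

lemma parts_add [simp]:
  "re_part (u + v) = re_part u + re_part v" "im_part (u + v) = im_part u + im_part v"
  by (simp_all add: re_part_def im_part_def vec_eq_iff)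

lemma parts_diff [simp]:
  "re_part (u - v) = re_part u - re_part v" "im_part (u - v) = im_part u - im_part v"
  by (simp_all add: re_part_def im_part_def vec_eq_iff)

lemma maslov_mat_parts:
  "re_part (maslov_mat s W *v v) = (W *v re_part v + re_part v) - s *\<^sub>R (Om *v (W *v im_part v - im_part v))"
  "im_part (maslov_mat s W *v v) = (W *v im_part v + im_part v) + s *\<^sub>R (Om *v (W *v re_part v - re_part v))"
  by (simp_all add: maslov_mat_def matrix_vector_mult_add_rdistrib matrix_vector_mul_assoc[symmetric] mat_mult_vec)
     (simp_all add: mvec matrix_vector_mul_assoc[symmetric])

lemma Om_isometry: "(Om *v u) \<bullet> (Om *v v) = u \<bullet> v"
  by (simp add: inner_vec_def sum_UNIV_sum Om_mv)

lemma omega_skew: "u \<bullet> (Om *v v) = - (v \<bullet> (Om *v u))"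
  by (simp add: omega_eq[symmetric] omega_def sum_subtractf mult.commute)

text \<open>The graph of a symplectic map is Lagrangian; both the invertibility and the monotonicity
  below come from this identity.\<close>

lemma graph_isotropic:
  assumes W: "W \<in> Sp"
  shows "(W *v x + x) \<bullet> (Om *v (W *v y - y)) = (W *v y + y) \<bullet> (Om *v (W *v x - x))"
proof -
  have i: "(W *v a) \<bullet> (Om *v (W *v b)) = a \<bullet> (Om *v b)" for a b
    using W by (simp add: Sp_def omega_eq)
  show ?thesis
    using omega_skew[of x "W *v y"] omega_skew[of "W *v x" y] omega_skew[of x y]
    by (simp add: matrix_vector_mult_diff_distrib inner_add_left inner_diff_right i)
qed

lemma maslov_invertible:
  assumes W: "W \<in> Sp" and s: "0 < s"
  shows "invertible (maslov_mat s W)"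
  unfolding invertible_iff_ker
proof (intro allI impI)
  fix v assume v: "maslov_mat s W *v v = 0"
  define a b a' b' where ab: "a = W *v re_part v + re_part v" "b = W *v re_part v - re_part v"
    "a' = W *v im_part v + im_part v" "b' = W *v im_part v - im_part v"
  have e: "a = s *\<^sub>R (Om *v b')" "a' = - s *\<^sub>R (Om *v b)"
    using arg_cong[OF v, of re_part] arg_cong[OF v, of im_part] unfolding maslov_mat_parts ab[symmetric]
    by (simp_all add: add_eq_0_iff)
  have "a \<bullet> (Om *v b') = a' \<bullet> (Om *v b)" unfolding ab by (rule graph_isotropic[OF W])
  then have "s * (b' \<bullet> b') + s * (b \<bullet> b) = 0" by (simp add: e Om_isometry)
  then have "s * (b' \<bullet> b' + b \<bullet> b) = 0" by (simp add: algebra_simps)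
  then have "b' \<bullet> b' + b \<bullet> b = 0" using s by simp
  then have b0: "b = 0" "b' = 0" by (simp_all add: add_nonneg_eq_0_iff)
  then have "a = 0" "a' = 0" using e by simp_all
  moreover have "2 *\<^sub>R re_part v = a - b" "2 *\<^sub>R im_part v = a' - b'" by (simp_all add: ab scaleR_2)
  ultimately show "v = 0" using b0 by (simp add: complex_vec_eq_iff)
qed

text \<open>The contribution of the rank one form with the vector \<open>h\<close> to the increase of the argument. The
  vector \<open>v\<close> solves \<open>maslov_mat s W v = (i s - Om) h\<close>.\<close>

lemma maslov_monotone_vector:
  assumes W: "W \<in> Sp" and s: "0 < s"
    and v: "re_part (maslov_mat s W *v v) = - (Om *v h)" "im_part (maslov_mat s W *v v) = s *\<^sub>R h"
  shows "0 \<le> h \<bullet> (W *v im_part v)"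
proof -
  define a b a' b' where ab: "a = W *v re_part v + re_part v" "b = W *v re_part v - re_part v"
    "a' = W *v im_part v + im_part v" "b' = W *v im_part v - im_part v"
  have e: "a = s *\<^sub>R (Om *v b') - Om *v h" "Om *v b = h - (1 / s) *\<^sub>R a'"
  proof -
    show "a = s *\<^sub>R (Om *v b') - Om *v h"
      using v(1) unfolding maslov_mat_parts ab[symmetric] by (simp add: algebra_simps)
    have "(1 / s) *\<^sub>R (a' + s *\<^sub>R (Om *v b)) = (1 / s) *\<^sub>R (s *\<^sub>R h)"
      using v(2) unfolding maslov_mat_parts ab[symmetric] by simp
    then show "Om *v b = h - (1 / s) *\<^sub>R a'" using s by (simp add: scaleR_add_right algebra_simps)
  qed
  have "a \<bullet> (Om *v b') = a' \<bullet> (Om *v b)" unfolding ab by (rule graph_isotropic[OF W])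
  then have "s * (b' \<bullet> b') - h \<bullet> b' = a' \<bullet> h - (1 / s) * (a' \<bullet> a')"
    unfolding e by (simp add: inner_diff_left inner_diff_right Om_isometry)
  then have q: "h \<bullet> a' + h \<bullet> b' = s * (b' \<bullet> b') + (1 / s) * (a' \<bullet> a')"
    by (simp add: inner_commute algebra_simps)
  have "2 *\<^sub>R (W *v im_part v) = a' + b'" by (simp add: ab scaleR_2)
  then have "2 * (h \<bullet> (W *v im_part v)) = h \<bullet> a' + h \<bullet> b'"
    by (metis inner_add_right inner_scaleR_right)
  moreover have "0 \<le> s * (b' \<bullet> b') + (1 / s) * (a' \<bullet> a')" using s by simp
  ultimately show ?thesis using q by linarith
qed

text \<open>The logarithmic derivative of \<open>maslov_det s\<close> at \<open>W\<close> in the direction \<open>X ** W\<close>.\<close>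

definition maslov_rate :: "real \<Rightarrow> ('n::finite) rmat \<Rightarrow> 'n rmat \<Rightarrow> complex"
  where "maslov_rate s X W = trace (matrix_inv (maslov_mat s W) **
    (complexify (X ** W) + mat (\<i> * complex_of_real s) ** complexify (Om ** X ** W)))"

text \<open>The rate is linear in \<open>X\<close>, and by the spectral theorem the form of \<open>X\<close> is a combination of rank
  one forms with nonnegative coefficients.\<close>

lemma maslov_rate_nonneg:
  assumes W: "(W :: ('n::finite) rmat) \<in> Sp" and s: "0 < s" and X: "psd (Om ** X)"
  shows "0 \<le> Im (maslov_rate s X W)"
proof -
  obtain T d where T: "orthogonal_matrix T" and H: "Om ** X = T ** diagmat d ** transpose T"
    using spectral_theorem X by (metis psd_def)
  have TT: "transpose T ** T = mat 1" using T by (simp add: orthogonal_matrix)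
  have "transpose T ** (Om ** X) ** T = (transpose T ** T) ** diagmat d ** (transpose T ** T)"
    unfolding H by (simp add: matrix_mul_assoc)
  then have D: "transpose T ** (Om ** X) ** T = diagmat d" by (simp add: TT)
  have dn: "0 \<le> d $ j" for j
    using congruence_diag_entry[OF D, of j] X by (simp add: psd_def)
  have Xe: "X = - (Om ** (Om ** X))" by (simp add: matrix_mul_assoc Om_Om matrix_minus_left)
  let ?is = "mat (\<i> * complex_of_real s) :: 'n cmat"
  let ?P = "?is - complexify (Om :: 'n rmat)"
  define N where "N = matrix_inv (maslov_mat s W)"
  have NN: "maslov_mat s W ** N = mat 1"
    unfolding N_def by (rule matrix_inv_right[OF maslov_invertible[OF W s]])
  have "complexify (X ** W) + ?is ** complexify (Om ** X ** W) = ?P ** complexify (Om ** X) ** complexify W"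
  proof -
    have "complexify (X ** W) = - (complexify Om ** complexify (Om ** X) ** complexify W)"
      by (subst Xe) (simp add: complexify_mult complexify_minus matrix_minus_left matrix_mul_assoc)
    then show ?thesis by (simp add: matrix_sub_rdistrib complexify_mult matrix_mul_assoc)
  qed
  also have "\<dots> = ?P ** complexify T ** (complexify (diagmat d) ** (complexify (transpose T) ** complexify W))"
    unfolding H complexify_mult by (simp add: matrix_mul_assoc)
  finally have "maslov_rate s X W = trace ((N ** ?P ** complexify T) ** (complexify (diagmat d) ** (complexify (transpose T) ** complexify W)))"
    unfolding maslov_rate_def N_def[symmetric] by (simp add: matrix_mul_assoc)
  also have "\<dots> = trace ((complexify (diagmat d) ** (complexify (transpose T) ** complexify W)) ** (N ** ?P ** complexify T))"
    by (rule trace_mul_sym)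
  also have "\<dots> = trace (complexify (diagmat d) ** (complexify (transpose T ** W) ** N ** ?P ** complexify T))"
    by (simp add: complexify_mult matrix_mul_assoc)
  also have "\<dots> = (\<Sum>j\<in>UNIV. complex_of_real (d $ j) * (complexify (transpose T ** W) ** N ** ?P ** complexify T) $ j $ j)"
    unfolding complexify_diagmat by (simp add: trace_def diagmat_def matrix_matrix_mult_def[of "vec_lambda _"] if_distrib[of "\<lambda>z. z * _"] cong: if_cong)
  finally have r: "maslov_rate s X W = \<dots>" .
  have "0 \<le> Im ((complexify (transpose T ** W) ** N ** ?P ** complexify T) $ j $ j)" for j
  proof -
    define h where "h = T *v axis j 1"
    define e where "e = (axis j 1 :: complex^('n + 'n))"
    have ep: "re_part e = axis j 1" "im_part e = 0"
      by (simp_all add: e_def re_part_def im_part_def axis_def vec_eq_iff)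
    define v where "v = N *v (?P *v (complexify T *v e))"
    have "maslov_mat s W *v v = ?P *v (complexify T *v e)"
      unfolding v_def matrix_vector_mul_assoc[of "maslov_mat s W" N] NN by simp
    then have "re_part (maslov_mat s W *v v) = - (Om *v h)" "im_part (maslov_mat s W *v v) = s *\<^sub>R h"
      by (simp_all add: matrix_vector_mult_diff_rdistrib mat_mult_vec ep h_def)
    then have "0 \<le> h \<bullet> (W *v im_part v)" by (rule maslov_monotone_vector[OF W s])
    also have "h \<bullet> (W *v im_part v) = axis j 1 \<bullet> ((transpose T ** W) *v im_part v)"
      unfolding h_def by (simp add: matrix_vector_mul_assoc[symmetric] inner_vector_matrix)
    also have "\<dots> = Im ((complexify (transpose T ** W) *v v) $ j)"
      using parts_complexify(2)[of "transpose T ** W" v] by (simp add: inner_axis' im_part_def vec_eq_iff)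
    also have "complexify (transpose T ** W) *v v = (complexify (transpose T ** W) ** N ** ?P ** complexify T) *v e"
      unfolding v_def by (simp add: matrix_vector_mul_assoc matrix_mul_assoc)
    also have "(\<dots>) $ j = (complexify (transpose T ** W) ** N ** ?P ** complexify T) $ j $ j"
      unfolding e_def by (subst matrix_vector_mult_def) (simp add: axis_def if_distrib[of "\<lambda>z. _ * z"] cong: if_cong)
    finally show ?thesis .
  qed
  then show ?thesis unfolding r using dn by (simp add: sum_nonneg)
qed

lemma continuous_on_complexify [continuous_intros]:
  "continuous_on S f \<Longrightarrow> continuous_on S (\<lambda>x. complexify (f x))"
  unfolding complexify_def map_matrix_def by (intro continuous_intros)

lemma bounded_linear_complexify: "bounded_linear (complexify :: ('n::finite) rmat \<Rightarrow> 'n cmat)"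
  unfolding linear_conv_bounded_linear[symmetric]
  by (rule linearI) (simp_all add: complexify_add complexify_scaleR)

lemma continuous_on_maslov_mat [continuous_intros]:
  "continuous_on S f \<Longrightarrow> continuous_on S (\<lambda>x. maslov_mat s (f x))"
  unfolding maslov_mat_def by (intro continuous_intros)

lemma maslov_mat_derivative:
  assumes W: "(W has_vector_derivative X ** W t) (at t within S)"
  shows "((\<lambda>t. maslov_mat s (W t)) has_vector_derivative
    complexify (X ** W t) + mat (\<i> * complex_of_real s) ** complexify (Om ** X ** W t)) (at t within S)"
proof -
  have "((\<lambda>t. W t + mat 1) has_vector_derivative X ** W t + 0) (at t within S)"
    by (intro has_vector_derivative_add W has_vector_derivative_const)
  from bounded_linear.has_vector_derivative[OF bounded_linear_complexify this]
  have 1: "((\<lambda>t. complexify (W t + mat 1)) has_vector_derivative complexify (X ** W t)) (at t within S)" by simp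
  have "((\<lambda>t. W t - mat 1) has_vector_derivative X ** W t - 0) (at t within S)"
    by (intro has_vector_derivative_diff W has_vector_derivative_const)
  from has_vector_derivative_matrix_mult[OF has_vector_derivative_const this, of Om]
  have "((\<lambda>t. Om ** (W t - mat 1)) has_vector_derivative Om ** X ** W t) (at t within S)"
    by (simp add: matrix_mul_assoc)
  from has_vector_derivative_matrix_mult[OF has_vector_derivative_const bounded_linear.has_vector_derivative[OF bounded_linear_complexify this],
      of "mat (\<i> * complex_of_real s)"]
  have 2: "((\<lambda>t. mat (\<i> * complex_of_real s) ** complexify (Om ** (W t - mat 1))) has_vector_derivative
      mat (\<i> * complex_of_real s) ** complexify (Om ** X ** W t)) (at t within S)" by simp
  show ?thesis unfolding maslov_mat_def by (rule has_vector_derivative_add[OF 1 2])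
qed

text \<open>The logarithm is the integral of the rate.\<close>

lemma monotone_log_exists:
  fixes W X :: "real \<Rightarrow> ('n::finite) rmat"
  assumes W: "\<And>t. t \<in> {a..b} \<Longrightarrow> (W has_vector_derivative X t ** W t) (at t within {a..b})"
    and X: "continuous_on {a..b} X" and Sp: "\<And>t. t \<in> {a..b} \<Longrightarrow> W t \<in> Sp"
    and Xp: "\<And>t. t \<in> {a..b} \<Longrightarrow> psd (Om ** X t)" and s: "0 < s"
    and ab: "a \<le> b" and c: "exp c = maslov_det s (W a)"
  obtains L where "continuous_on {a..b} L" "\<And>t. t \<in> {a..b} \<Longrightarrow> exp (L t) = maslov_det s (W t)"
    "L a = c" "\<And>t u. a \<le> t \<Longrightarrow> t \<le> u \<Longrightarrow> u \<le> b \<Longrightarrow> Im (L t) \<le> Im (L u)"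
proof -
  have cW: "continuous_on {a..b} W" by (rule continuous_on_has_vector_derivative[OF W])
  define f where "f = (\<lambda>t. maslov_rate s (X t) (W t))"
  have cf: "continuous_on {a..b} f"
    unfolding f_def maslov_rate_def by (intro continuous_intros cW X maslov_invertible Sp s)
  define L where "L = (\<lambda>t. c + integral {a..t} f)"
  have Ld: "(L has_vector_derivative f t) (at t within {a..b})" if "t \<in> {a..b}" for t
    unfolding L_def using has_vector_derivative_add[OF has_vector_derivative_const integral_has_vector_derivative[OF cf that]] by simp
  have Fd: "((\<lambda>t. maslov_det s (W t)) has_vector_derivative maslov_det s (W t) * f t) (at t within {a..b})" if t: "t \<in> {a..b}" for t
    unfolding maslov_det_def f_def maslov_rate_def
    by (rule has_vector_derivative_det[OF maslov_mat_derivative[OF W[OF t]] maslov_invertible[OF Sp[OF t] s]])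
  have "((\<lambda>t. maslov_det s (W t) * exp (- L t)) has_vector_derivative 0) (at t within {a..b})" if t: "t \<in> {a..b}" for t
  proof -
    have "((\<lambda>t. - L t) has_vector_derivative - f t) (at t within {a..b})"
      by (rule has_vector_derivative_minus[OF Ld[OF t]])
    from field_vector_diff_chain_within[OF this, of exp] DERIV_exp[of "- L t"]
    have "((\<lambda>t. exp (- L t)) has_vector_derivative - f t * exp (- L t)) (at t within {a..b})"
      by (simp add: o_def has_field_derivative_at_within)
    from has_vector_derivative_mult[OF Fd[OF t] this]
    show ?thesis by (simp add: algebra_simps)
  qed
  then obtain k where k: "\<And>t. t \<in> {a..b} \<Longrightarrow> maslov_det s (W t) * exp (- L t) = k"
    using has_vector_derivative_zero_constant[of "{a..b}" "\<lambda>t. maslov_det s (W t) * exp (- L t)"] by auto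
  have La: "L a = c" by (simp add: L_def)
  have "k = 1" using k[of a] ab unfolding La c[symmetric] exp_minus by simp
  then have e: "exp (L t) = maslov_det s (W t)" if "t \<in> {a..b}" for t
    using k[OF that] by (simp add: exp_minus field_simps)
  have m: "Im (L t) \<le> Im (L u)" if tu: "a \<le> t" "t \<le> u" "u \<le> b" for t u
  proof -
    have i: "f integrable_on {a..u}"
      using tu by (intro integrable_continuous_interval continuous_on_subset[OF cf]) auto
    have "integral {a..t} f + integral {t..u} f = integral {a..u} f"
      by (rule Henstock_Kurzweil_Integration.integral_combine[OF tu(1,2) i])
    then have "L u - L t = integral {t..u} f" by (simp add: L_def algebra_simps)
    moreover have "f integrable_on {t..u}"
      using tu by (intro integrable_continuous_interval continuous_on_subset[OF cf]) auto
    then have "Im (integral {t..u} f) = integral {t..u} (Im \<circ> f)"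
      using integral_linear[OF _ bounded_linear_Im] by metis
    moreover have "0 \<le> integral {t..u} (Im \<circ> f)"
      using tu by (intro Henstock_Kurzweil_Integration.integral_nonneg integrable_continuous_interval continuous_on_compose continuous_on_subset[OF cf])
        (auto simp: f_def intro!: maslov_rate_nonneg Sp s Xp continuous_intros)
    ultimately have "0 \<le> Im (L u - L t)" by simp
    then show ?thesis by simp
  qed
  show ?thesis by (rule that[OF _ e La m]) (auto intro: continuous_on_has_vector_derivative[OF Ld])
qed

definition one_plus_i :: "real^'n^'n \<Rightarrow> complex^'n^'n"
  where "one_plus_i B = mat 1 + mat \<i> ** map_matrix complex_of_real B"

text \<open>The symmetric matrices form a convex set, and \<open>1 + i B\<close> is invertible since \<open>B\<close> has real
  eigenvalues.\<close>

lemma sym_log_exists: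
  obtains g where "continuous_on {B :: ('n::finite) rmat. transpose B = B} g" "g 0 = 0"
    "\<And>B. transpose B = B \<Longrightarrow> exp (g B) = det (one_plus_i B)"
proof -
  let ?K = "{B :: 'n rmat. transpose B = B}"
  have "convex ?K" by (auto simp: convex_def mtrans)
  then have K: "contractible ?K" by (rule convex_imp_contractible)
  have nz: "det (one_plus_i B) \<noteq> 0" if B: "transpose B = B" for B :: "'n rmat"
  proof -
    have "v = 0" if v: "one_plus_i B *v v = 0" for v
    proof -
      have o: "one_plus_i B *v v = v + \<i> *s (complexify B *v v)"
        by (simp add: one_plus_i_def complexify_def[symmetric] mvec matrix_vector_mul_assoc[symmetric] mat_mult_vec)
      have "re_part v - B *v im_part v = 0" "im_part v + B *v re_part v = 0"
        using arg_cong[OF v, of re_part] arg_cong[OF v, of im_part] unfolding o by simp_all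
      then have e: "re_part v = B *v im_part v" "im_part v = - (B *v re_part v)"
        by (simp_all only: eq_neg_iff_add_eq_0 right_minus_eq)
      have "re_part v \<bullet> re_part v = re_part v \<bullet> (B *v im_part v)"
        "im_part v \<bullet> im_part v = - (im_part v \<bullet> (B *v re_part v))"
        using arg_cong[OF e(1), of "\<lambda>x. re_part v \<bullet> x"] arg_cong[OF e(2), of "\<lambda>x. im_part v \<bullet> x"] by simp_all
      with inner_symmetric[OF B, of "re_part v" "im_part v"] have "re_part v \<bullet> re_part v + im_part v \<bullet> im_part v = 0"
        by linarith
      then show "v = 0" by (simp add: add_nonneg_eq_0_iff complex_vec_eq_iff)
    qed
    then show ?thesis by (simp add: invertible_det_nz[symmetric] invertible_iff_ker)
  qed
  have c: "continuous_on ?K (\<lambda>B. det (one_plus_i B))"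
    unfolding one_plus_i_def map_matrix_def by (intro continuous_intros)
  have nz': "det (one_plus_i B) \<noteq> 0" if "B \<in> ?K" for B using that nz by simp
  obtain g where g: "continuous_on ?K g" "\<And>B. B \<in> ?K \<Longrightarrow> det (one_plus_i B) = exp (g B)"
    using continuous_logarithm_on_contractible[OF c K nz'] by blast
  have z: "transpose (0 :: 'n rmat) = 0" by (simp add: transpose_def vec_eq_iff)
  have "one_plus_i (0 :: 'n rmat) = mat 1"
    by (simp add: one_plus_i_def map_matrix_def vec_eq_iff matrix_matrix_mult_def)
  then have "exp (g 0) = 1" using g(2)[of 0] z by simp
  then show ?thesis
    using g by (intro that[of "\<lambda>B. g B - g 0"]) (auto intro!: continuous_intros simp: exp_diff)
qed

lemma exp_log_one_plus_i: "exp (Complex (ln (1 + x\<^sup>2) / 2) (arctan x)) = Complex 1 x"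
proof -
  have p: "0 < 1 + x\<^sup>2" by (simp add: add_pos_nonneg)
  have "exp (ln (1 + x\<^sup>2) / 2) = sqrt (1 + x\<^sup>2)"
    using p by (simp add: ln_sqrt[symmetric])
  then show ?thesis using p by (simp add: exp_eq_polar cis_conv_exp[symmetric] complex_eq_iff cos_arctan sin_arctan Re_exp Im_exp)
qed

text \<open>The imaginary part is the sum of the \<open>arctan (s b)\<close> over the eigenvalues \<open>b\<close> of \<open>B\<close>. None of them is
  negative, so each is below \<open>\<pi> / 4 = arctan 1\<close>, that is \<open>s b < 1\<close>.\<close>

lemma sym_log_psd:
  assumes g: "continuous_on {B :: ('n::finite) rmat. transpose B = B} g" "g 0 = 0"
    "\<And>B. transpose B = B \<Longrightarrow> exp (g B) = det (one_plus_i B)"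
    and B: "psd (B :: 'n rmat)" and s: "0 < s" and small: "Im (g (s *\<^sub>R B)) \<le> pi / 8"
  shows "norm (B *v x) \<le> (1 / s) * norm x"
proof -
  obtain T d where T: "orthogonal_matrix T" and H: "B = T ** diagmat d ** transpose T"
    using spectral_theorem B by (metis psd_def)
  have TT: "transpose T ** T = mat 1" "T ** transpose T = mat 1" using T by (auto simp: orthogonal_matrix_def)
  have "transpose T ** B ** T = (transpose T ** T) ** diagmat d ** (transpose T ** T)"
    unfolding H by (simp add: matrix_mul_assoc)
  then have D: "transpose T ** B ** T = diagmat d" by (simp add: TT)
  have dn: "0 \<le> d $ j" for j
    using congruence_diag_entry[OF D, of j] B by (simp add: psd_def)
  define l where "l = (\<lambda>x. Complex (ln (1 + x\<^sup>2) / 2) (arctan x))"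
  have sym: "transpose (t *\<^sub>R B) = t *\<^sub>R B" for t using B by (simp add: psd_def transpose_scalar)
  have dets: "det (one_plus_i (t *\<^sub>R B)) = (\<Prod>j\<in>UNIV. Complex 1 (t * d $ j))" for t
  proof -
    have "one_plus_i (t *\<^sub>R B) = complexify T ** (mat 1 + mat \<i> ** complexify (t *\<^sub>R diagmat d)) ** complexify (transpose T)"
    proof -
      have tB: "t *\<^sub>R B = T ** (t *\<^sub>R diagmat d) ** transpose T" unfolding H by (simp add: mring)
      have c: "complexify T ** (mat \<i> ** C) ** complexify (transpose T) = mat \<i> ** (complexify T ** C ** complexify (transpose T))" for C
        by (simp add: matrix_mul_assoc mat_commute[of \<i> "complexify T"])
      have "one_plus_i (t *\<^sub>R B) = mat 1 + mat \<i> ** (complexify T ** complexify (t *\<^sub>R diagmat d) ** complexify (transpose T))"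
        by (simp only: one_plus_i_def complexify_def[symmetric] tB complexify_mult)
      also have "mat 1 = complexify T ** mat 1 ** complexify (transpose T)"
        by (simp add: complexify_mult[symmetric] TT complexify_mat_1)
      finally show ?thesis unfolding c[symmetric] by (simp add: matrix_add_ldistrib matrix_add_rdistrib)
    qed
    also have "mat 1 + mat \<i> ** complexify (t *\<^sub>R diagmat d) = diagmat (\<chi> j. Complex 1 (t * d $ j))"
    proof -
      have "complexify (t *\<^sub>R diagmat d) = diagmat (\<chi> j. complex_of_real (t * d $ j))"
        by (simp add: complexify_def map_matrix_def diagmat_def vec_eq_iff)
      then show ?thesis
        by (simp add: mat_mult_diagmat) (simp add: diagmat_def mat_def vec_eq_iff complex_eq_iff)
    qed
    finally have "det (one_plus_i (t *\<^sub>R B)) = det (complexify T ** complexify (transpose T)) * det (diagmat (\<chi> j. Complex 1 (t * d $ j)))"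
      by (simp add: det_mul)
    then show ?thesis by (simp add: complexify_mult[symmetric] TT complexify_mat_1 det_diagmat)
  qed
  have "g (s *\<^sub>R B) - (\<Sum>j\<in>UNIV. l (s * d $ j)) = g (0 *\<^sub>R B) - (\<Sum>j\<in>UNIV. l (0 * d $ j))"
  proof (rule continuous_logs_agree[of "{0..s}" "\<lambda>t. g (t *\<^sub>R B)" "\<lambda>t. \<Sum>j\<in>UNIV. l (t * d $ j)"])
    show "continuous_on {0..s} (\<lambda>t. g (t *\<^sub>R B))"
      by (rule continuous_on_compose2[OF g(1)]) (auto intro!: continuous_intros simp: sym)
    have "1 + x\<^sup>2 \<noteq> 0" for x :: real by (metis add_pos_nonneg less_irrefl zero_le_power2 zero_less_one)
    then show "continuous_on {0..s} (\<lambda>t. \<Sum>j\<in>UNIV. l (t * d $ j))"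
      unfolding l_def by (intro continuous_intros continuous_on_Complex) auto
    show "exp (g (t *\<^sub>R B)) = exp (\<Sum>j\<in>UNIV. l (t * d $ j))" for t
      using g(3)[OF sym] by (simp add: dets exp_sum l_def exp_log_one_plus_i)
  qed (use s in auto)
  then have "g (s *\<^sub>R B) = (\<Sum>j\<in>UNIV. l (s * d $ j))"
    by (simp add: g(2) l_def complex_eq_iff)
  then have "Im (g (s *\<^sub>R B)) = (\<Sum>j\<in>UNIV. arctan (s * d $ j))" by (simp add: l_def)
  moreover have "arctan (s * d $ j) \<le> (\<Sum>j\<in>UNIV. arctan (s * d $ j))" for j
    using dn s by (intro member_le_sum) auto
  ultimately have "arctan (s * d $ j) \<le> pi / 8" for j using small order_trans by metis
  then have "arctan (s * d $ j) < arctan 1" for j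
    by (rule le_less_trans) (simp add: arctan_one)
  then have "s * d $ j < 1" for j unfolding arctan_less_iff .
  then have d1: "d $ j \<le> 1 / s" for j
    using s by (simp add: field_simps less_imp_le)
  have iso: "norm (T *v y) = norm y" "norm (transpose T *v y) = norm y" for y
  proof -
    have "(T *v y) \<bullet> (T *v y) = y \<bullet> (transpose T ** T *v y)"
      by (metis inner_transpose matrix_vector_mul_assoc transpose_transpose)
    then show "norm (T *v y) = norm y" by (simp add: TT norm_eq_sqrt_inner)
    have "(transpose T *v y) \<bullet> (transpose T *v y) = y \<bullet> (T ** transpose T *v y)"
      by (metis inner_transpose matrix_vector_mul_assoc transpose_transpose)
    then show "norm (transpose T *v y) = norm y" by (simp add: TT norm_eq_sqrt_inner)
  qed
  define y where "y = transpose T *v x"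
  have "norm (B *v x) = norm (diagmat d *v y)"
    unfolding H by (simp add: matrix_vector_mul_assoc[symmetric] iso y_def)
  also have "\<dots> \<le> norm ((1 / s) *\<^sub>R y)"
    unfolding diagmat_mult_vec
  proof (rule norm_le_componentwise_cart)
    fix j show "norm ((\<chi> i. d $ i * y $ i) $ j) \<le> norm (((1 / s) *\<^sub>R y) $ j)"
      using mult_right_mono[OF d1[of j], of "\<bar>y $ j\<bar>"] dn[of j] s by (simp add: abs_mult)
  qed
  also have "\<dots> = (1 / s) * norm x" using s iso(2)[of x] by (simp add: y_def)
  finally show ?thesis .
qed

definition sym_log :: "('n::finite) rmat \<Rightarrow> complex"
  where "sym_log = (SOME g. continuous_on {B. transpose B = B} g \<and> g 0 = 0 \<and>
    (\<forall>B. transpose B = B \<longrightarrow> exp (g B) = det (one_plus_i B)))"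

lemma sym_log:
  "continuous_on {B :: ('n::finite) rmat. transpose B = B} sym_log" "sym_log (0 :: 'n rmat) = 0"
  "\<And>B :: 'n rmat. transpose B = B \<Longrightarrow> exp (sym_log B) = det (one_plus_i B)"
proof -
  have "\<exists>g. continuous_on {B :: 'n rmat. transpose B = B} g \<and> g 0 = 0 \<and>
    (\<forall>B. transpose B = B \<longrightarrow> exp (g B) = det (one_plus_i B))"
    by (rule sym_log_exists) blast
  from someI_ex[OF this]
  show "continuous_on {B :: 'n rmat. transpose B = B} sym_log" "sym_log (0 :: 'n rmat) = 0"
    "\<And>B :: 'n rmat. transpose B = B \<Longrightarrow> exp (sym_log B) = det (one_plus_i B)"
    unfolding sym_log_def[symmetric] by blast+
qed

lemma maslov_det_one: "maslov_det s (mat 1 :: ('n::finite) rmat) = of_real (2 ^ CARD('n + 'n))"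
proof -
  have "maslov_mat s (mat 1 :: 'n rmat) = complexify (2 *\<^sub>R mat 1)"
    by (simp add: maslov_mat_def scaleR_2 complexify_def map_matrix_def vec_eq_iff matrix_matrix_mult_def)
  then show ?thesis by (simp add: maslov_det_def det_complexify det_scaleR)
qed

lemma maslov_det_chart:
  assumes inv: "invertible (W + mat 1)"
  shows "maslov_det s W = det (one_plus_i (s *\<^sub>R (Om ** cayley_inv W))) * of_real (det (W + mat 1))"
proof -
  have "cayley_inv W ** (W + mat 1) = W - mat 1"
    unfolding cayley_inv_def by (simp add: matrix_mul_assoc[symmetric] matrix_inv_left inv)
  then have e: "Om ** (W - mat 1) = (Om ** cayley_inv W) ** (W + mat 1)"
    by (simp add: matrix_mul_assoc[symmetric])
  have sc: "mat (\<i> * complex_of_real s) ** complexify A = mat \<i> ** complexify (s *\<^sub>R A)" for A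
    by (simp add: matrix_matrix_mult_def mat_def vec_eq_iff complexify_def map_matrix_def
        if_distrib[of "\<lambda>z. z * _"] cong: if_cong)
  have "maslov_mat s W = one_plus_i (s *\<^sub>R (Om ** cayley_inv W)) ** complexify (W + mat 1)"
    unfolding maslov_mat_def e one_plus_i_def complexify_def[symmetric] sc[symmetric] complexify_mult
    by (simp add: matrix_add_rdistrib matrix_mul_assoc)
  then show ?thesis by (simp add: maslov_det_def det_mul det_complexify)
qed

text \<open>As long as -1 is not an eigenvalue, \<open>det (W + 1)\<close> stays positive, so \<open>sym_log\<close> alone
  determines the argument of \<open>maslov_det s\<close>.\<close>

lemma chart_log_path:
  fixes W :: "real \<Rightarrow> ('n::finite) rmat" and s :: real
  assumes cW: "continuous_on {a..b} W" and Sp: "\<And>t. t \<in> {a..b} \<Longrightarrow> W t \<in> Sp" and Wa: "W a = mat 1"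
    and inv: "\<And>t. t \<in> {a..b} \<Longrightarrow> invertible (W t + mat 1)" and ab: "a \<le> b"
  defines "L \<equiv> \<lambda>t. sym_log (s *\<^sub>R (Om ** cayley_inv (W t))) + of_real (ln (det (W t + mat 1)))"
  shows "continuous_on {a..b} L" "\<And>t. t \<in> {a..b} \<Longrightarrow> exp (L t) = maslov_det s (W t)"
    "L a = of_real (ln (2 ^ CARD('n + 'n)))"
proof -
  have W2: "W a + mat 1 = 2 *\<^sub>R mat 1" by (simp add: Wa scaleR_2)
  have pos: "0 < det (W t + mat 1)" if t: "t \<in> {a..b}" for t
  proof (rule ccontr)
    assume "\<not> 0 < det (W t + mat 1)"
    then have le: "det (W t + mat 1) \<le> 0" by simp
    have "connected ((\<lambda>t. det (W t + mat 1)) ` {a..b})"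
      by (intro connected_continuous_image continuous_intros cW) auto
    moreover have "det (W t + mat 1) \<in> (\<lambda>t. det (W t + mat 1)) ` {a..b}" using t by blast
    moreover have "det (W a + mat 1) \<in> (\<lambda>t. det (W t + mat 1)) ` {a..b}" using ab by auto
    moreover have "0 \<le> det (W a + mat 1)" unfolding W2 by (simp add: det_scaleR)
    ultimately have "0 \<in> (\<lambda>t. det (W t + mat 1)) ` {a..b}"
      using le by (meson connectedD_interval)
    then show False using inv by (auto simp: invertible_det_nz)
  qed
  have sym: "transpose (s *\<^sub>R (Om ** cayley_inv (W t))) = s *\<^sub>R (Om ** cayley_inv (W t))" if "t \<in> {a..b}" for t
    using cayley_inv_sp[OF Sp[OF that] inv[OF that]] by (simp add: sp_iff transpose_scalar)
  have cM: "continuous_on {a..b} (\<lambda>t. cayley_inv (W t))"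
    unfolding cayley_inv_def by (intro continuous_intros cW inv)
  have "continuous_on {a..b} (\<lambda>t. sym_log (s *\<^sub>R (Om ** cayley_inv (W t))))"
    by (rule continuous_on_compose2[OF sym_log(1)]) (auto intro!: continuous_intros cM sym)
  moreover have "continuous_on {a..b} (\<lambda>t. complex_of_real (ln (det (W t + mat 1))))"
    using pos by (intro continuous_intros cW) force
  ultimately show "continuous_on {a..b} L" unfolding L_def by (rule continuous_on_add)
  show "exp (L t) = maslov_det s (W t)" if t: "t \<in> {a..b}" for t
    unfolding L_def maslov_det_chart[OF inv[OF t]] using pos[OF t]
    by (simp add: exp_add sym_log(3)[OF sym[OF t]] exp_of_real)
  have "cayley_inv (W a) = 0"
    by (simp add: Wa cayley_inv_def vec_eq_iff matrix_matrix_mult_def)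
  then show "L a = of_real (ln (2 ^ CARD('n + 'n)))"
    unfolding L_def W2 by (simp add: sym_log(2) det_scaleR)
qed

lemma form_increasing:
  fixes B B' :: "real \<Rightarrow> real^'m^'m"
  assumes B: "\<And>t. t \<in> {a..b} \<Longrightarrow> (B has_vector_derivative B' t) (at t within {a..b})"
    and B': "\<And>t. t \<in> {a..b} \<Longrightarrow> psd (B' t)" and uv: "a \<le> u" "u \<le> v" "v \<le> b"
  shows "x \<bullet> (B u *v x) \<le> x \<bullet> (B v *v x)"
    and "pd (B' u) \<Longrightarrow> u < v \<Longrightarrow> x \<noteq> 0 \<Longrightarrow> x \<bullet> (B u *v x) < x \<bullet> (B v *v x)"
proof -
  have bl: "bounded_linear (\<lambda>A :: real^'m^'m. x \<bullet> (A *v x))"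
    unfolding linear_conv_bounded_linear[symmetric]
    by (rule linearI) (simp_all add: mvec inner_add_right)
  have d: "((\<lambda>t. x \<bullet> (B t *v x)) has_vector_derivative x \<bullet> (B' t *v x)) (at t within {a..b})" if "t \<in> {a..b}" for t
    using bounded_linear.has_vector_derivative[OF bl B[OF that]] .
  have mono: "x \<bullet> (B u *v x) \<le> x \<bullet> (B v *v x)" if "a \<le> u" "u \<le> v" "v \<le> b" for u v
  proof -
    have "((\<lambda>t. x \<bullet> (B' t *v x)) has_integral (x \<bullet> (B v *v x) - x \<bullet> (B u *v x))) {u..v}"
      by (rule fundamental_theorem_of_calculus[OF that(2)])
        (rule has_vector_derivative_within_subset[OF d], use that in auto)
    then have "0 \<le> x \<bullet> (B v *v x) - x \<bullet> (B u *v x)"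
      by (rule has_integral_nonneg) (use B' that in \<open>auto simp: psd_def\<close>)
    then show ?thesis by simp
  qed
  show "x \<bullet> (B u *v x) \<le> x \<bullet> (B v *v x)" by (rule mono[OF uv])
  show "x \<bullet> (B u *v x) < x \<bullet> (B v *v x)" if pdu: "pd (B' u)" and lt: "u < v" and x: "x \<noteq> 0"
  proof (rule ccontr)
    assume "\<not> ?thesis"
    then have eq: "x \<bullet> (B t *v x) = x \<bullet> (B u *v x)" if "t \<in> {u..v}" for t
      using mono[of u t] mono[of t v] uv that by auto
    have "((\<lambda>t. x \<bullet> (B t *v x)) has_vector_derivative x \<bullet> (B' u *v x)) (at u within {u..v})"
      by (rule has_vector_derivative_within_subset[OF d]) (use uv in auto)
    then have "((\<lambda>t. x \<bullet> (B u *v x)) has_vector_derivative x \<bullet> (B' u *v x)) (at u within {u..v})"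
      by (rule has_vector_derivative_transform[rotated 2]) (use lt in simp, rule eq[symmetric])
    then have "x \<bullet> (B' u *v x) = 0"
      using vector_derivative_unique_within_closed_interval[OF lt, of u "\<lambda>t. x \<bullet> (B u *v x)" _ 0] lt by simp
    then show False using pdu x by (auto simp: pd_def)
  qed
qed

text \<open>With \<open>M = cayley_inv W\<close> the matrix \<open>1 + M = 2 W (W + 1)\<^sup>-\<^sup>1\<close> is invertible, so the
  congruence transform preserves positive definiteness too.\<close>

lemma chart_derivative:
  fixes W :: "real \<Rightarrow> ('n::finite) rmat" and X :: "'n rmat"
  assumes W: "(W has_vector_derivative X ** W t) (at t within S)" and Sp: "W t \<in> Sp"
    and inv: "invertible (W t + mat 1)"
  shows "((\<lambda>t. Om ** cayley_inv (W t)) has_vector_derivative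
     (1/2) *\<^sub>R (transpose (mat 1 + cayley_inv (W t)) ** (Om ** X) ** (mat 1 + cayley_inv (W t)))) (at t within S)"
    and "psd (Om ** X) \<Longrightarrow>
      psd ((1/2) *\<^sub>R (transpose (mat 1 + cayley_inv (W t)) ** (Om ** X) ** (mat 1 + cayley_inv (W t))))"
    and "pd (Om ** X) \<Longrightarrow>
      pd ((1/2) *\<^sub>R (transpose (mat 1 + cayley_inv (W t)) ** (Om ** X) ** (mat 1 + cayley_inv (W t))))"
proof -
  let ?D = "(1/2) *\<^sub>R (transpose (mat 1 + cayley_inv (W t)) ** (Om ** X) ** (mat 1 + cayley_inv (W t)))"
  show "((\<lambda>t. Om ** cayley_inv (W t)) has_vector_derivative ?D) (at t within S)"
    using has_vector_derivative_matrix_mult[OF has_vector_derivative_const has_vector_derivative_cayley_inv[OF W inv], of Om]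
      Om_cayley_derivative[OF cayley_inv_sp[OF Sp inv]] by simp
  show "psd ?D" if "psd (Om ** X)" by (intro psd_scaleR psd_congruence that) simp
  have "invertible (mat 1 + cayley_inv (W t))"
    unfolding cayley_inv_one_minus(2)[OF inv]
    by (intro scalar_invertible invertible_mult Sp_invertible[OF Sp] invertible_matrix_inv inv) simp
  then show "pd ?D" if "pd (Om ** X)" by (intro pd_scaleR pd_congruence that) simp_all
qed

lemma chart_increasing:
  fixes W X :: "real \<Rightarrow> ('n::finite) rmat"
  assumes W: "\<And>t. t \<in> {a..b} \<Longrightarrow> (W has_vector_derivative X t ** W t) (at t within {a..b})"
    and Sp: "\<And>t. t \<in> {a..b} \<Longrightarrow> W t \<in> Sp" and Xp: "\<And>t. t \<in> {a..b} \<Longrightarrow> psd (Om ** X t)"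
    and inv: "\<And>t. t \<in> {a..b} \<Longrightarrow> invertible (W t + mat 1)"
    and Ba: "psd (Om ** cayley_inv (W a))"
  shows "t \<in> {a..b} \<Longrightarrow> psd (Om ** cayley_inv (W t))"
    and "a \<le> u \<Longrightarrow> u < t \<Longrightarrow> t \<le> b \<Longrightarrow> pd (Om ** X u) \<Longrightarrow> pd (Om ** cayley_inv (W t))"
proof -
  let ?B = "\<lambda>t. Om ** cayley_inv (W t)"
  have sym: "transpose (?B t) = ?B t" if "t \<in> {a..b}" for t
    using cayley_inv_sp[OF Sp[OF that] inv[OF that]] by (simp add: sp_iff)
  note inc = form_increasing[of a b ?B, OF chart_derivative(1)[OF W Sp inv] chart_derivative(2)[OF W Sp inv Xp]]
  show ps: "psd (?B t)" if t: "t \<in> {a..b}" for t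
  proof -
    have "0 \<le> x \<bullet> (?B t *v x)" for x
    proof -
      have "0 \<le> x \<bullet> (?B a *v x)" using Ba by (simp add: psd_def)
      also have "\<dots> \<le> x \<bullet> (?B t *v x)" by (rule inc(1)) (use t in auto)
      finally show ?thesis .
    qed
    then show ?thesis using sym[OF t] by (simp add: psd_def)
  qed
  show "pd (?B t)" if ut: "a \<le> u" "u < t" "t \<le> b" and X: "pd (Om ** X u)"
  proof -
    have u: "u \<in> {a..b}" using ut by auto
    have "0 < x \<bullet> (?B t *v x)" if x: "x \<noteq> 0" for x
    proof -
      have "0 \<le> x \<bullet> (?B u *v x)" using ps[OF u] by (simp add: psd_def)
      also have "\<dots> < x \<bullet> (?B t *v x)"
        by (rule inc(2)) (use ut x chart_derivative(3)[OF W[OF u] Sp[OF u] inv[OF u] X] in auto)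
      finally show ?thesis .
    qed
    then show ?thesis using sym[of t] ut by (simp add: pd_def)
  qed
qed

text \<open>A positive curve from the identity whose total argument agrees, for all \<open>s\<close>, with the
  argument of a positive semidefinite form in the chart never meets the eigenvalue -1: for small
  \<open>s\<close> the total argument is small, whereas at a crossing of -1 the argument would be at least
  \<open>pi / 2\<close> for every \<open>s\<close>.\<close>

theorem no_crossing:
  fixes W X :: "real \<Rightarrow> ('n::finite) rmat"
  assumes ab: "a \<le> b"
    and W: "\<And>t. t \<in> {a..b} \<Longrightarrow> (W has_vector_derivative X t ** W t) (at t within {a..b})"
    and X: "continuous_on {a..b} X" and Sp: "\<And>t. t \<in> {a..b} \<Longrightarrow> W t \<in> Sp"
    and Xp: "\<And>t. t \<in> {a..b} \<Longrightarrow> psd (Om ** X t)" and Wa: "W a = mat 1"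
    and B1: "psd B1"
    and total: "\<And>s L. 0 < s \<Longrightarrow> continuous_on {a..b} L \<Longrightarrow> (\<And>t. t \<in> {a..b} \<Longrightarrow> exp (L t) = maslov_det s (W t)) \<Longrightarrow>
      L a = of_real (ln (2 ^ CARD('n + 'n))) \<Longrightarrow> Im (L b) = Im (sym_log (s *\<^sub>R B1))"
    and t: "t \<in> {a..b}"
  shows "invertible (W t + mat 1)" and "psd (Om ** cayley_inv (W t))"
proof -
  have cW: "continuous_on {a..b} W" by (rule continuous_on_has_vector_derivative[OF W])
  have symB1: "transpose (s *\<^sub>R B1) = s *\<^sub>R B1" for s using B1 by (simp add: psd_def transpose_scalar)
  \<comment> \<open>Any bound below \<open>\<pi> / 4\<close> serves to keep the eigenvalues of \<open>s B\<close> below 1 along the curve.\<close>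
  obtain s where s: "0 < s" and small: "Im (sym_log (s *\<^sub>R B1)) \<le> pi / 8"
  proof -
    have "continuous_on {0..1} (\<lambda>s. Im (sym_log (s *\<^sub>R B1)))"
      by (intro continuous_on_Im continuous_on_compose2[OF sym_log(1)]) (auto intro!: continuous_intros simp: symB1)
    then have "((\<lambda>s. Im (sym_log (s *\<^sub>R B1))) \<longlongrightarrow> Im (sym_log (0 *\<^sub>R B1))) (at_right 0)"
      by (rule continuous_on_Icc_at_rightD) simp
    then have "((\<lambda>s. Im (sym_log (s *\<^sub>R B1))) \<longlongrightarrow> 0) (at_right 0)" by (simp add: sym_log(2))
    then have "\<forall>\<^sub>F s in at_right 0. Im (sym_log (s *\<^sub>R B1)) < pi / 8"
      by (rule order_tendstoD(2)) simp
    moreover have "\<forall>\<^sub>F s in at_right 0. (0::real) < s" by (simp add: eventually_at_filter)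
    ultimately have "\<forall>\<^sub>F s in at_right 0. 0 < s \<and> Im (sym_log (s *\<^sub>R B1)) \<le> pi / 8"
      by eventually_elim auto
    then show thesis using that eventually_happens trivial_limit_at_right_real by (metis (mono_tags, lifting))
  qed
  have c: "exp (complex_of_real (ln (2 ^ CARD('n + 'n)))) = maslov_det s (W a)"
    unfolding Wa maslov_det_one by (simp add: exp_of_real del: of_real_power)
  obtain L where L: "continuous_on {a..b} L" "\<And>t. t \<in> {a..b} \<Longrightarrow> exp (L t) = maslov_det s (W t)"
    "L a = of_real (ln (2 ^ CARD('n + 'n)))" "\<And>t u. a \<le> t \<Longrightarrow> t \<le> u \<Longrightarrow> u \<le> b \<Longrightarrow> Im (L t) \<le> Im (L u)"
    using monotone_log_exists[OF W X Sp Xp s ab c] by metis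
  have Lb: "Im (L b) = Im (sym_log (s *\<^sub>R B1))" by (rule total[OF s L(1,2,3)])
  have psd_a: "psd (Om ** cayley_inv (W a))"
  proof -
    have "cayley_inv (W a) = 0" by (simp add: Wa cayley_inv_def vec_eq_iff matrix_matrix_mult_def)
    then have "Om ** cayley_inv (W a) = 0" by (simp add: vec_eq_iff matrix_matrix_mult_def)
    then show ?thesis by (simp add: psd_def) (simp add: transpose_def vec_eq_iff)
  qed
  have restrict: "(W has_vector_derivative X t ** W t) (at t within {a..u})" if "t \<in> {a..u}" "u \<le> b" for t u
    by (rule has_vector_derivative_within_subset[OF W]) (use that in auto)
  have chart: "psd (Om ** cayley_inv (W u)) \<and> (\<forall>x. norm ((W u - mat 1) *v x) \<le> (1 / s) * norm ((W u + mat 1) *v x))"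
    if u: "u \<in> {a..b}" and inv: "\<And>t. t \<in> {a..u} \<Longrightarrow> invertible (W t + mat 1)" for u
  proof -
    have uu: "u \<in> {a..u}" using u by auto
    have Spu: "W t \<in> Sp" "psd (Om ** X t)" if "t \<in> {a..u}" for t using that u Sp Xp by auto
    have ps: "psd (Om ** cayley_inv (W u))"
      by (rule chart_increasing(1)[of a u W X, OF restrict Spu inv psd_a uu]) (use u in auto)
    define K where "K = (\<lambda>t. sym_log (s *\<^sub>R (Om ** cayley_inv (W t))) + of_real (ln (det (W t + mat 1))))"
    have cWu: "continuous_on {a..u} W" by (rule continuous_on_subset[OF cW]) (use u in auto)
    have au: "a \<le> u" using u by auto
    have K: "continuous_on {a..u} K" "\<And>t. t \<in> {a..u} \<Longrightarrow> exp (K t) = maslov_det s (W t)"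
      "K a = of_real (ln (2 ^ CARD('n + 'n)))"
      unfolding K_def using chart_log_path[OF cWu Spu(1) Wa inv au, where s = s] by blast+
    have "L u - K u = L a - K a"
    proof (rule continuous_logs_agree[of "{a..u}"])
      show "continuous_on {a..u} L" by (rule continuous_on_subset[OF L(1)]) (use u in auto)
      show "exp (L x) = exp (K x)" if "x \<in> {a..u}" for x using that u L(2)[of x] K(2)[of x] by auto
    qed (use u au K(1) in auto)
    then have "L u = K u" by (simp add: L(3) K(3))
    then have "Im (sym_log (s *\<^sub>R (Om ** cayley_inv (W u)))) = Im (L u)" by (simp add: K_def)
    also have "\<dots> \<le> Im (L b)" using L(4) u by auto
    also have "\<dots> \<le> pi / 8" using small Lb by simp
    finally have im: "Im (sym_log (s *\<^sub>R (Om ** cayley_inv (W u)))) \<le> pi / 8" .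
    have n: "norm ((Om ** cayley_inv (W u)) *v x) \<le> (1 / s) * norm x" for x
      by (rule sym_log_psd[OF sym_log(1,2) _ ps s im]) (rule sym_log(3))
    have invu: "invertible (W u + mat 1)" by (rule inv[OF uu])
    have cw: "cayley_inv (W u) ** (W u + mat 1) = W u - mat 1"
      unfolding cayley_inv_def by (simp add: matrix_mul_assoc[symmetric] matrix_inv_left invu)
    have "norm ((W u - mat 1) *v x) \<le> (1 / s) * norm ((W u + mat 1) *v x)" for x
    proof -
      have "norm ((W u - mat 1) *v x) = norm (Om *v ((W u - mat 1) *v x))"
        by (simp add: norm_eq_sqrt_inner Om_isometry)
      also have "Om *v ((W u - mat 1) *v x) = (Om ** cayley_inv (W u)) *v ((W u + mat 1) *v x)"
        unfolding cw[symmetric] by (simp add: matrix_vector_mul_assoc matrix_mul_assoc)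
      finally show ?thesis using n by simp
    qed
    then show ?thesis using ps by blast
  qed
  have all: "invertible (W t + mat 1)" if t: "t \<in> {a..b}" for t
  proof (rule ccontr)
    assume nt: "\<not> invertible (W t + mat 1)"
    \<comment> \<open>At the first crossing \<open>z\<close>, the bound which holds before \<open>z\<close> passes to the limit and makes
      every vector in the kernel of \<open>W z + 1\<close> a fixed vector of \<open>W z\<close>.\<close>
    define Z where "Z = {t \<in> {a..b}. det (W t + mat 1) = 0}"
    have "closed Z"
      unfolding Z_def by (intro continuous_closed_preimage_constant continuous_intros cW closed_atLeastAtMost)
    then have "compact Z" unfolding compact_eq_bounded_closed
      by (auto simp: Z_def intro: bounded_subset[of "{a..b}"])
    moreover have "Z \<noteq> {}" using nt t by (auto simp: Z_def invertible_det_nz)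
    ultimately obtain z where z: "z \<in> Z" and zmin: "\<And>y. y \<in> Z \<Longrightarrow> z \<le> y"
      using compact_attains_inf by metis
    have zab: "z \<in> {a..b}" "det (W z + mat 1) = 0" using z by (auto simp: Z_def)
    have "det (W a + mat 1) \<noteq> 0"
    proof -
      have "W a + mat 1 = 2 *\<^sub>R mat 1" by (simp add: Wa scaleR_2)
      then show ?thesis by (simp add: det_scaleR)
    qed
    then have az: "a < z" using zab by (cases "a = z") auto
    have before: "norm ((W u - mat 1) *v x) \<le> (1 / s) * norm ((W u + mat 1) *v x)" if "a \<le> u" "u < z" for u x
    proof -
      have "invertible (W t + mat 1)" if "t \<in> {a..u}" for t
      proof -
        have "t \<notin> Z" using zmin[of t] that \<open>u < z\<close> by auto
        then show ?thesis using that \<open>u < z\<close> zab by (auto simp: Z_def invertible_det_nz)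
      qed
      then show ?thesis using chart[of u] that zab by auto
    qed
    have "\<not> invertible (W z + mat 1)" using zab by (simp add: invertible_det_nz)
    then obtain x where x: "x \<noteq> 0" "(W z + mat 1) *v x = 0" by (auto simp: invertible_iff_ker)
    have cz: "continuous_on {a..z} W" by (rule continuous_on_subset[OF cW]) (use zab in auto)
    have lim: "((\<lambda>u. norm ((W u - mat 1) *v x)) \<longlongrightarrow> norm ((W z - mat 1) *v x)) (at_left z)"
      "((\<lambda>u. (1 / s) * norm ((W u + mat 1) *v x)) \<longlongrightarrow> (1 / s) * norm ((W z + mat 1) *v x)) (at_left z)"
      by (rule continuous_on_Icc_at_leftD[OF _ az], intro continuous_intros cz)+
    have "\<forall>\<^sub>F u in at_left z. a \<le> u \<and> u < z"
      using az eventually_at_left[OF az] by (auto intro!: exI[of _ a])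
    then have "\<forall>\<^sub>F u in at_left z. norm ((W u - mat 1) *v x) \<le> (1 / s) * norm ((W u + mat 1) *v x)"
      by eventually_elim (use before in auto)
    from tendsto_le[OF _ lim(2,1) this]
    have "norm ((W z - mat 1) *v x) \<le> 0" using x(2) by simp
    then have "(W z - mat 1) *v x = 0" by simp
    with x(2) have "W z *v x - x = 0" "W z *v x + x = 0" by (simp_all add: mvec)
    then have "2 *\<^sub>R x = 0" by (simp add: scaleR_2 algebra_simps)
    then show False using x(1) by simp
  qed
  show "invertible (W t + mat 1)" by (rule all[OF t])
  show "psd (Om ** cayley_inv (W t))" using chart[OF t] all t by auto
qed

text \<open>At the identity the form of the Cayley transform is zero, and the time function is not available
  before the form has become positive definite. But up to the last time at which the form is
  degenerate, the generator is degenerate as well, because a positive definite generator would make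
  the form positive definite at all later times. This part of the curve has length zero.\<close>

theorem length_le_eigprod:
  fixes W X :: "real \<Rightarrow> ('n::finite) rmat"
  assumes ab: "a \<le> b"
    and W: "\<And>t. t \<in> {a..b} \<Longrightarrow> (W has_vector_derivative X t ** W t) (at t within {a..b})"
    and X: "continuous_on {a..b} X" and Sp: "\<And>t. t \<in> {a..b} \<Longrightarrow> W t \<in> Sp"
    and Xp: "\<And>t. t \<in> {a..b} \<Longrightarrow> psd (Om ** X t)" and Wa: "W a = mat 1"
    and inv: "\<And>t. t \<in> {a..b} \<Longrightarrow> invertible (W t + mat 1)" and Wb: "W b \<in> Sp_ell_plus"
  shows "integral {a..b} (\<lambda>t. G_id (X t)) \<le> root (2 * CARD('n)) (eigprod (W b))"
proof -
  let ?N = "2 * CARD('n)"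
  define M where "M = (\<lambda>t. cayley_inv (W t))"
  define G where "G = (\<lambda>t. G_id (X t))"
  have cW: "continuous_on {a..b} W" by (rule continuous_on_has_vector_derivative[OF W])
  have cM: "continuous_on {a..b} M" unfolding M_def cayley_inv_def by (intro continuous_intros cW inv)
  have cG: "continuous_on {a..b} G" unfolding G_def G_id_def by (intro continuous_intros X)
  have M0: "M a = 0" by (simp add: M_def Wa cayley_inv_def vec_eq_iff matrix_matrix_mult_def)
  have Z0: "Om ** M a = 0" unfolding M0 by (simp add: vec_eq_iff matrix_matrix_mult_def)
  have psd_a: "psd (Om ** cayley_inv (W a))"
    using Z0 unfolding M_def by (simp add: psd_def) (simp add: transpose_def vec_eq_iff)
  have inc: "t \<in> {a..b} \<Longrightarrow> psd (Om ** M t)"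
    "a \<le> u \<Longrightarrow> u < t \<Longrightarrow> t \<le> b \<Longrightarrow> pd (Om ** X u) \<Longrightarrow> pd (Om ** M t)" for t u
    unfolding M_def using chart_increasing[OF W Sp Xp inv psd_a] by blast+
  have pdb: "pd (Om ** M b)" unfolding M_def by (rule Sp_ell_plus_imp_pd[OF Wb])
  have pos: "0 < time_det (M t)" if t: "pd (Om ** M t)" for t
  proof -
    obtain T d where nf: "normal_form (M t) T d" using normal_form_exists[OF t] by blast
    show ?thesis
      unfolding normal_form.time_det_eq[OF nf]
      using pd_det_pos[OF normal_form.logM_pd[OF nf]] by (simp add: det_sp)
  qed
  have end_eq: "time_det (M b) = eigprod (W b)"
  proof -
    obtain T d where nf: "normal_form (M b) T d" using normal_form_exists[OF pdb] by blast
    show ?thesis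
      using normal_form.time_det_eq[OF nf] normal_form.eigprod_cayley[OF nf] cayley_cayley_inv[OF inv[of b]] ab
      by (simp add: M_def)
  qed
  define R where "R = root ?N (time_det (M b))"
  have after: "integral {c..b} G \<le> R" if c: "c \<in> {a..b}" "pd (Om ** M c)" for c
  proof -
    have pdt: "pd (Om ** M t)" if t: "t \<in> {c..b}" for t
    proof -
      have sub: "(W has_vector_derivative X t ** W t) (at t within {c..b})" if "t \<in> {c..b}" for t
        by (rule has_vector_derivative_within_subset[OF W]) (use that c in auto)
      have Spc: "W t \<in> Sp" "psd (Om ** X t)" "invertible (W t + mat 1)" if "t \<in> {c..b}" for t
        using that c Sp Xp inv by auto
      have "x \<bullet> ((Om ** M c) *v x) \<le> x \<bullet> ((Om ** M t) *v x)" for x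
        unfolding M_def by (rule form_increasing(1)[of c b, OF chart_derivative(1)[OF sub Spc(1,3)] chart_derivative(2)[OF sub Spc(1,3,2)]])
          (use t in auto)
      moreover have "t \<in> {a..b}" using t c by auto
      then have "psd (Om ** M t)" by (rule inc(1))
      ultimately show ?thesis using c(2) unfolding pd_def psd_def by (meson less_le_trans)
    qed
    have "integral {c..b} G \<le> R - root ?N (time_det (M c))"
      unfolding G_def R_def
    proof (rule length_le_time_increase)
      show "c \<le> b" using c by auto
      show "(M has_vector_derivative (1/2) *\<^sub>R ((mat 1 - M t) ** X t ** (mat 1 + M t))) (at t within {c..b})" if t: "t \<in> {c..b}" for t
        unfolding M_def
        by (rule has_vector_derivative_cayley_inv[OF has_vector_derivative_within_subset[OF W] inv]) (use t c in auto)
      show "continuous_on {c..b} X" by (rule continuous_on_subset[OF X]) (use c in auto)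
      show "pd (Om ** M t)" if "t \<in> {c..b}" for t by (rule pdt[OF that])
      show "psd (Om ** X t)" if "t \<in> {c..b}" for t using that c Xp by auto
    qed
    moreover have "0 < root ?N (time_det (M c))" using pos[OF c(2)] by simp
    ultimately show ?thesis by linarith
  qed
  have zero: "integral {a..c} G = 0" if c: "c \<in> {a..b}" "\<not> pd (Om ** M c)" for c
  proof -
    have "G t = 0" if t: "t \<in> {a..c} - {c}" for t
    proof -
      have "\<not> pd (Om ** X t)" using inc(2)[of t c] c t by auto
      then have "det (Om ** X t) = 0" using psd_not_pd_det[OF Xp[of t]] t c by auto
      then show ?thesis by (simp add: G_def G_id_def det_sp)
    qed
    then show ?thesis
      using integral_spike[of "{c}" "{a..c}" G "\<lambda>_. 0"] by simp
  qed
  \<comment> \<open>The maximum of \<open>Z\<close> is the last time at which the form is degenerate.\<close>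
  define Z where "Z = {t \<in> {a..b}. det (Om ** M t) = 0}"
  have Zpd: "t \<in> Z \<longleftrightarrow> t \<in> {a..b} \<and> \<not> pd (Om ** M t)" for t
    using inc(1)[of t] psd_not_pd_det[of "Om ** M t"] pd_det_pos[of "Om ** M t"] by (auto simp: Z_def)
  have "closed Z"
    unfolding Z_def by (intro continuous_closed_preimage_constant continuous_intros cM closed_atLeastAtMost)
  then have "compact Z" unfolding compact_eq_bounded_closed
    by (auto simp: Z_def intro: bounded_subset[of "{a..b}"])
  moreover have "a \<in> Z"
    using ab Z0 unfolding Z_def by (simp add: det_0[unfolded mat_0])
  ultimately obtain c where c: "c \<in> Z" and cmax: "\<And>y. y \<in> Z \<Longrightarrow> y \<le> c"
    using compact_attains_sup[of Z] by blast
  have cab: "c \<in> {a..b}" "\<not> pd (Om ** M c)" using c Zpd by auto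
  have cb: "c < b" using cab pdb by (cases "c = b") auto
  have int: "G integrable_on {a..b}" by (rule integrable_continuous_interval[OF cG])
  have "integral {a..b} G = integral {a..c} G + integral {c..b} G"
    by (rule Henstock_Kurzweil_Integration.integral_combine[symmetric, OF _ _ int]) (use cab in auto)
  also have "\<dots> = integral {c..b} G" using zero[OF cab] by simp
  also have "\<dots> \<le> R"
  proof -
    have "G integrable_on {c..b}"
      by (intro integrable_continuous_interval continuous_on_subset[OF cG]) (use cab in auto)
    then have "continuous_on {c..b} (\<lambda>x. integral {x..b} G)" by (rule indefinite_integral_continuous_1')
    then have "((\<lambda>x. integral {x..b} G) \<longlongrightarrow> integral {c..b} G) (at_right c)"
      by (rule continuous_on_Icc_at_rightD[OF _ cb])
    moreover have "\<forall>\<^sub>F x in at_right c. integral {x..b} G \<le> R"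
    proof -
      have "integral {x..b} G \<le> R" if "c < x" "x < b" for x
      proof -
        have "x \<notin> Z" using cmax[of x] that by auto
        then show ?thesis using after[of x] Zpd[of x] that cab by auto
      qed
      then show ?thesis unfolding eventually_at_right[OF cb] using cb by blast
    qed
    ultimately show ?thesis by (rule tendsto_upperbound) simp
  qed
  finally show ?thesis unfolding G_def R_def end_eq .
qed

section \<open>Local structure of the elliptic region\<close>

lemma Sp_ell_plus_subset: "Sp_ell_plus \<subseteq> Sp"
  by (auto simp: Sp_ell_plus_def)

text \<open>The involution \<open>W \<mapsto> - W\<^sup>-\<^sup>1\<close> exchanges the eigenvalues 1 and -1 and preserves the
  elliptic region. It provides a chart around the boundary points without eigenvalue 1.\<close>

definition flip :: "real^'n^'n \<Rightarrow> real^'n^'n"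
  where "flip W = - matrix_inv W"

lemma flip_Sp: "W \<in> Sp \<Longrightarrow> flip W \<in> Sp"
  using Sp_inv[of W] by (simp add: flip_def Sp_def matrix_vector_minus_left) (simp add: omega_def)

lemma flip_flip: "W \<in> Sp \<Longrightarrow> flip (flip W) = W"
proof -
  assume "W \<in> Sp"
  then have "flip W ** - W = mat 1"
    by (simp add: flip_def matrix_minus_left matrix_minus_right matrix_inv_left Sp_invertible)
  then have "matrix_inv (flip W) = - W" by (rule matrix_inv_eqI)
  then show ?thesis by (simp add: flip_def[of "flip W"])
qed

lemma flip_plus_one_invertible:
  assumes W: "W \<in> Sp" and inv: "invertible (W - mat 1)"
  shows "invertible (flip W + mat 1)"
proof -
  have "flip W + mat 1 = matrix_inv W ** (W - mat 1)"
    by (simp add: flip_def matrix_sub_ldistrib matrix_inv_left Sp_invertible W)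
  then show ?thesis using W inv by (simp add: invertible_mult invertible_matrix_inv Sp_invertible)
qed

lemma continuous_on_flip [continuous_intros]:
  "continuous_on S f \<Longrightarrow> (\<And>x. x \<in> S \<Longrightarrow> f x \<in> Sp) \<Longrightarrow> continuous_on S (\<lambda>x. flip (f x))"
  unfolding flip_def by (intro continuous_intros Sp_invertible)

text \<open>In the Cayley chart the involution is \<open>M \<mapsto> - M\<^sup>-\<^sup>1\<close>.\<close>

lemma flip_Sp_ell_plus:
  assumes W: "(W :: ('n::finite) rmat) \<in> Sp_ell_plus"
  shows "flip W \<in> Sp_ell_plus"
proof -
  define M where "M = cayley_inv W"
  have M: "pd (Om ** M)" unfolding M_def by (rule Sp_ell_plus_imp_pd[OF W])
  have WM: "W = cayley M" unfolding M_def by (simp add: cayley_cayley_inv[OF Sp_ell_plus_plus_one_invertible[OF W]])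
  have i1: "invertible (mat 1 - M)" "invertible (mat 1 + M)" by (rule pd_one_minus_invertible[OF M])+
  have iM: "invertible M" using pd_invertible[OF M] by (simp add: invertible_det_nz det_sp)
  define K where "K = - matrix_inv M"
  have MK: "M ** K = - mat 1" by (simp add: K_def matrix_minus_right matrix_inv_right iM)
  have KM: "K ** M = - mat 1" by (simp add: K_def matrix_minus_left matrix_inv_left iM)
  have K: "pd (Om ** K)"
  proof -
    have "Om ** K = transpose K ** (Om ** M) ** K"
    proof -
      have "transpose M ** Om = - (Om ** M)" using M by (simp add: sp_transpose[symmetric] sp_iff pd_def)
      then have "transpose K ** (Om ** M) = - (transpose K ** transpose M ** Om)"
        by (simp add: matrix_mul_assoc[symmetric] matrix_minus_right)
      also have "transpose K ** transpose M = - mat 1"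
        by (simp add: matrix_transpose_mul[symmetric] MK transpose_minus)
      finally show ?thesis by (simp add: matrix_minus_left)
    qed
    moreover have "invertible K"
      using invertibleI[of K "- M"] KM by (simp add: matrix_minus_right)
    ultimately show ?thesis using pd_congruence[OF M] by simp
  qed
  have iK: "invertible (mat 1 - K)" by (rule pd_one_minus_invertible[OF K])
  have "W ** (mat 1 - M) = mat 1 + M"
    unfolding WM cayley_def by (simp add: matrix_mul_assoc[symmetric] matrix_inv_left i1)
  moreover have "W ** (mat 1 + K) = W ** (mat 1 - M) ** K"
    by (simp add: matrix_mul_assoc[symmetric]) (simp add: matrix_sub_rdistrib MK add.commute)
  ultimately have e: "W ** (mat 1 + K) = - (mat 1 - K)"
    by (simp add: matrix_add_rdistrib MK)
  have "W ** - cayley K = - (W ** (mat 1 + K)) ** matrix_inv (mat 1 - K)"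
    by (simp add: cayley_def matrix_mul_assoc matrix_minus_right matrix_minus_left)
  also have "\<dots> = mat 1"
    unfolding e minus_minus by (rule matrix_inv_right[OF iK])
  finally have "W ** - cayley K = mat 1" .
  then have "matrix_inv W = - cayley K" by (rule matrix_inv_eqI)
  then have "flip W = cayley K" by (simp add: flip_def)
  then show ?thesis using pd_imp_Sp_ell_plus[OF K] by simp
qed

lemma continuous_on_cayley:
  "continuous_on S f \<Longrightarrow> (\<And>x. x \<in> S \<Longrightarrow> invertible (mat 1 - f x)) \<Longrightarrow> continuous_on S (\<lambda>x. cayley (f x))"
  unfolding cayley_def by (intro continuous_intros)

lemma convex_pd: "convex {M :: real^'n^'n. pd (A ** M)}"
proof (rule convexI)
  fix M N :: "real^'n^'n" and u v :: real
  assume MN: "M \<in> {M. pd (A ** M)}" "N \<in> {M. pd (A ** M)}" and uv: "0 \<le> u" "0 \<le> v" "u + v = 1"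
  have "pd (u *\<^sub>R (A ** M) + v *\<^sub>R (A ** N))"
  proof (cases "u = 0")
    case True then show ?thesis using MN uv by simp
  next
    case False
    then show ?thesis using MN uv by (intro pd_add pd_scaleR psd_scaleR) (auto intro: pd_imp_psd)
  qed
  then show "u *\<^sub>R M + v *\<^sub>R N \<in> {M. pd (A ** M)}" by (simp add: mring)
qed

lemma openin_cayley_ball:
  "openin (top_of_set Sp) {W \<in> (Sp :: ('n::finite) rmat set). invertible (W + mat 1) \<and> dist (cayley_inv W) M0 < r}"
    (is "openin _ ?T")
proof -
  define S1 where "S1 = {W \<in> (Sp :: 'n rmat set). det (W + mat 1) \<noteq> 0}"
  have "S1 = Sp \<inter> (\<lambda>W. det (W + mat 1)) -` (- {0})" by (auto simp: S1_def)
  moreover have "openin (top_of_set Sp) (Sp \<inter> (\<lambda>W :: 'n rmat. det (W + mat 1)) -` (- {0}))"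
    by (intro continuous_openin_preimage_gen continuous_intros)
  ultimately have "openin (top_of_set Sp) S1" by simp
  moreover have "openin (top_of_set S1) (S1 \<inter> cayley_inv -` ball M0 r)"
    by (intro continuous_openin_preimage_gen open_ball, unfold cayley_inv_def, intro continuous_intros)
      (auto simp: S1_def invertible_det_nz)
  ultimately have "openin (top_of_set Sp) (S1 \<inter> cayley_inv -` ball M0 r)" by (rule openin_trans[rotated])
  moreover have "?T = S1 \<inter> cayley_inv -` ball M0 r"
    by (auto simp: S1_def invertible_det_nz dist_commute)
  ultimately show ?thesis by simp
qed

text \<open>In the Cayley chart the elliptic region is convex, so it meets a small ball around a boundary
  point in a connected set. The involution transfers this to boundary points with the eigenvalue -1
  which do not have the eigenvalue 1.\<close>

lemma elliptic_locally_connected_chart: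
  fixes y :: "('n::finite) rmat"
  assumes y: "y \<in> Sp" and inv: "invertible (y + mat 1)"
    and T: "openin (top_of_set Sp) T" "y \<in> T"
  shows "\<exists>T' E. openin (top_of_set Sp) T' \<and> y \<in> T' \<and> connected E \<and> E \<subseteq> T \<inter> Sp_ell_plus \<and> T' \<inter> Sp_ell_plus \<subseteq> E"
proof -
  define M0 where "M0 = cayley_inv y"
  have i0: "invertible (mat 1 - M0)" unfolding M0_def by (rule cayley_inv_one_minus[OF inv])
  have c0: "cayley M0 = y" unfolding M0_def by (rule cayley_cayley_inv[OF inv])
  obtain e where e: "0 < e" "ball y e \<inter> Sp \<subseteq> T"
    using T unfolding openin_contains_ball by blast
  have "(cayley \<longlongrightarrow> cayley M0) (at M0)"
    unfolding cayley_def by (intro tendsto_intros i0)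
  then obtain r where r: "0 < r" "\<And>M. M \<noteq> M0 \<Longrightarrow> dist M M0 < r \<Longrightarrow> dist (cayley M) y < e"
    using e(1) unfolding c0 LIM_def by blast
  have r': "dist (cayley M) y < e" if "dist M M0 < r" for M
    using r(2)[OF _ that] e(1) c0 by (cases "M = M0") auto
  define E where "E = cayley ` ({M. pd (Om ** M)} \<inter> ball M0 r)"
  define T' where "T' = {W \<in> Sp. invertible (W + mat 1) \<and> dist (cayley_inv W) M0 < r}"
  have "connected E"
    unfolding E_def
    by (intro connected_continuous_image continuous_on_cayley continuous_intros convex_connected convex_Int convex_pd convex_ball)
      (auto intro: pd_one_minus_invertible)
  moreover have "E \<subseteq> T \<inter> Sp_ell_plus"
  proof
    fix W assume "W \<in> E"
    then obtain M where M: "pd (Om ** M)" "dist M M0 < r" "W = cayley M"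
      by (auto simp: E_def dist_commute)
    then have W: "W \<in> Sp_ell_plus" by (simp add: pd_imp_Sp_ell_plus)
    moreover have "W \<in> ball y e" using r'[OF M(2)] M(3) by (simp add: dist_commute)
    ultimately show "W \<in> T \<inter> Sp_ell_plus" using e(2) Sp_ell_plus_subset by blast
  qed
  moreover have "T' \<inter> Sp_ell_plus \<subseteq> E"
  proof
    fix W assume W: "W \<in> T' \<inter> Sp_ell_plus"
    then have "W = cayley (cayley_inv W)" by (simp add: T'_def cayley_cayley_inv)
    moreover have "pd (Om ** cayley_inv W)" using W by (simp add: Sp_ell_plus_imp_pd)
    ultimately show "W \<in> E" using W unfolding E_def T'_def by (auto simp: dist_commute)
  qed
  moreover have "openin (top_of_set Sp) T'" unfolding T'_def by (rule openin_cayley_ball)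
  moreover have "y \<in> T'" using y inv r(1) by (simp add: T'_def M0_def)
  ultimately show ?thesis by blast
qed

lemma elliptic_locally_connected:
  fixes y :: "('n::finite) rmat"
  assumes y: "y \<in> Sp" and inv: "invertible (y + mat 1) \<or> invertible (y - mat 1)"
    and T: "openin (top_of_set Sp) T" "y \<in> T"
  shows "\<exists>T' E. openin (top_of_set Sp) T' \<and> y \<in> T' \<and> connected E \<and> E \<subseteq> T \<inter> Sp_ell_plus \<and> T' \<inter> Sp_ell_plus \<subseteq> E"
proof (cases "invertible (y + mat 1)")
  case True then show ?thesis by (rule elliptic_locally_connected_chart[OF y _ T])
next
  case False
  with inv have i: "invertible (flip y + mat 1)" by (intro flip_plus_one_invertible y) simp
  have op: "openin (top_of_set Sp) (Sp \<inter> flip -` V)" if "openin (top_of_set Sp) V" for V :: "'n rmat set"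
    by (rule continuous_openin_preimage[OF _ _ that]) (auto intro!: continuous_intros flip_Sp)
  have fy: "flip y \<in> Sp \<inter> flip -` T" using T y by (simp add: flip_Sp flip_flip)
  obtain T1 E1 where 1: "openin (top_of_set Sp) T1" "flip y \<in> T1" "connected E1"
    "E1 \<subseteq> (Sp \<inter> flip -` T) \<inter> Sp_ell_plus" "T1 \<inter> Sp_ell_plus \<subseteq> E1"
    using elliptic_locally_connected_chart[OF flip_Sp[OF y] i op[OF T(1)] fy] by blast
  have ES: "E1 \<subseteq> Sp" using 1(4) by blast
  show ?thesis
  proof (intro exI conjI)
    show "openin (top_of_set Sp) (Sp \<inter> flip -` T1)" by (rule op[OF 1(1)])
    show "y \<in> Sp \<inter> flip -` T1" using y 1 by simp
    show "connected (flip ` E1)"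
      by (intro connected_continuous_image 1(3) continuous_intros) (use ES in auto)
    show "flip ` E1 \<subseteq> T \<inter> Sp_ell_plus" using 1(4) flip_Sp_ell_plus by auto
    show "Sp \<inter> flip -` T1 \<inter> Sp_ell_plus \<subseteq> flip ` E1"
    proof
      fix W assume W: "W \<in> Sp \<inter> flip -` T1 \<inter> Sp_ell_plus"
      then have "flip W \<in> E1" using 1(5) flip_Sp_ell_plus by auto
      moreover have "W = flip (flip W)" using W by (simp add: flip_flip)
      ultimately show "W \<in> flip ` E1" by blast
    qed
  qed
qed

section \<open>Rotations\<close>

text \<open>The sign makes the generator \<open>- Om\<close> positive: its form is the identity matrix.\<close>

definition rot :: "real \<Rightarrow> ('n::finite) rmat"
  where "rot t = cos t *\<^sub>R mat 1 - sin t *\<^sub>R Om"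

lemma rot_0: "rot 0 = mat 1"
  by (simp add: rot_def)

lemma rot_Sp: "rot t \<in> Sp"
proof -
  have "transpose (rot t) ** Om ** rot t = (cos t * cos t) *\<^sub>R Om + (sin t * sin t) *\<^sub>R Om"
    by (simp add: rot_def mtrans transpose_Om mring Om_Om scaleR_diff_right scaleR_minus_right mult.commute)
  also have "\<dots> = ((sin t)\<^sup>2 + (cos t)\<^sup>2) *\<^sub>R Om"
    by (simp only: scaleR_add_left[symmetric] power2_eq_square add.commute)
  finally show ?thesis unfolding Sp_iff by simp
qed

lemma continuous_on_rot: "continuous_on S rot"
  unfolding rot_def by (intro continuous_intros)

lemma rot_has_vector_derivative:
  "((\<lambda>t. rot (c * t)) has_vector_derivative rot (c * t) ** (- c *\<^sub>R Om)) (at t within S)"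
proof -
  have c: "((\<lambda>t. cos (c * t)) has_real_derivative - sin (c * t) * c) (at t within S)"
    by (auto intro!: derivative_eq_intros)
  have s: "((\<lambda>t. sin (c * t)) has_real_derivative cos (c * t) * c) (at t within S)"
    by (auto intro!: derivative_eq_intros)
  have "((\<lambda>t. cos (c * t) *\<^sub>R mat 1 - sin (c * t) *\<^sub>R (Om :: 'a rmat)) has_vector_derivative
      (cos (c * t) *\<^sub>R 0 + (- sin (c * t) * c) *\<^sub>R mat 1) - (sin (c * t) *\<^sub>R 0 + (cos (c * t) * c) *\<^sub>R Om)) (at t within S)"
    by (intro has_vector_derivative_diff has_vector_derivative_scaleR c s has_vector_derivative_const)
  moreover have "(cos (c * t) *\<^sub>R 0 + (- sin (c * t) * c) *\<^sub>R mat 1) - (sin (c * t) *\<^sub>R 0 + (cos (c * t) * c) *\<^sub>R Om)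
     = rot (c * t) ** (- c *\<^sub>R (Om :: 'a rmat))"
    unfolding rot_def by (simp add: mring Om_Om) (simp add: scaleR_add_right scaleR_diff_right mult.commute)
  ultimately show ?thesis unfolding rot_def by simp
qed

lemma pd_conj: "W \<in> Sp \<Longrightarrow> pd (Om ** X) \<Longrightarrow> pd (Om ** (W ** X ** matrix_inv W))"
  unfolding Om_conj by (intro pd_congruence invertible_matrix_inv Sp_invertible)

text \<open>The involution \<open>flip\<close> turns the backward rotation of \<open>y\<close> into the curve \<open>flip y ** rot t\<close>, which
  has a positive definite generator. It starts at a point with a positive semidefinite form in the
  Cayley chart, and the form becomes positive definite immediately.\<close>

lemma rotate_back_into_elliptic:
  fixes y :: "('n::finite) rmat"
  assumes y: "y \<in> Sp" and inv: "invertible (y - mat 1)"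
    and yj: "\<And>j. Y j \<in> Sp_ell_plus" "Y \<longlonglongrightarrow> y"
  shows "\<exists>e>0. \<forall>t. 0 < t \<and> t \<le> e \<longrightarrow> matrix_inv (rot t) ** y \<in> Sp_ell_plus"
proof -
  have iy: "invertible y" by (rule Sp_invertible[OF y])
  have fy: "flip y \<in> Sp" by (rule flip_Sp[OF y])
  have f1: "invertible (flip y + mat 1)" by (rule flip_plus_one_invertible[OF y inv])
  have ps: "psd (Om ** cayley_inv (flip y))"
  proof -
    have "0 \<le> x \<bullet> ((Om ** cayley_inv (flip y)) *v x)" for x
    proof -
      have "(\<lambda>j. x \<bullet> ((Om ** cayley_inv (flip (Y j))) *v x)) \<longlonglongrightarrow> x \<bullet> ((Om ** cayley_inv (flip y)) *v x)"
        unfolding cayley_inv_def using f1 unfolding flip_def by (intro tendsto_intros yj iy)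
      moreover have "0 \<le> x \<bullet> ((Om ** cayley_inv (flip (Y j))) *v x)" for j
        using pd_imp_psd[OF Sp_ell_plus_imp_pd[OF flip_Sp_ell_plus[OF yj(1)]]] by (simp add: psd_def)
      ultimately show ?thesis by (intro LIMSEQ_le_const) auto
    qed
    then show ?thesis using cayley_inv_sp[OF fy f1] by (simp add: psd_def sp_iff)
  qed
  define D where "D = (\<lambda>t. flip y ** rot t)"
  define X where "X = flip y ** (- Om) ** matrix_inv (flip y)"
  have X: "pd (Om ** X)"
    unfolding X_def by (rule pd_conj[OF fy]) (simp add: matrix_minus_right Om_Om pd_mat_1)
  have Dd: "(D has_vector_derivative X ** D t) (at t within S)" for t S
  proof -
    have "(rot has_vector_derivative rot t ** (- Om)) (at t within S)"
      using rot_has_vector_derivative[of 1 t S] by simp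
    from has_vector_derivative_matrix_mult[OF has_vector_derivative_const this, of "flip y"]
    have "(D has_vector_derivative flip y ** (rot t ** (- Om))) (at t within S)" by (simp add: D_def)
    moreover have "flip y ** (rot t ** (- Om)) = flip y ** (- Om) ** rot t"
      unfolding matrix_mul_assoc[symmetric] by (simp add: rot_def mring)
    moreover have "X ** D t = flip y ** (- Om) ** (matrix_inv (flip y) ** flip y) ** rot t"
      unfolding X_def D_def by (simp add: matrix_mul_assoc)
    ultimately show ?thesis
      by (simp add: matrix_inv_left Sp_invertible fy)
  qed
  have D_Sp: "D t \<in> Sp" for t unfolding D_def by (intro Sp_mult fy rot_Sp)
  have D0: "D 0 = flip y" by (simp add: D_def rot_0)
  have "continuous_on UNIV (\<lambda>t. det (D t + mat 1))"
    unfolding D_def by (intro continuous_intros continuous_on_rot)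
  then have "((\<lambda>t. det (D t + mat 1)) \<longlongrightarrow> det (D 0 + mat 1)) (at 0)"
    by (simp add: continuous_on_def)
  then have "\<forall>\<^sub>F t in at 0. det (D t + mat 1) \<noteq> 0"
    by (rule tendsto_imp_eventually_ne) (use f1 D0 in \<open>simp add: invertible_det_nz\<close>)
  then obtain e where e: "0 < e" "\<And>t. t \<noteq> 0 \<Longrightarrow> dist t 0 < e \<Longrightarrow> det (D t + mat 1) \<noteq> 0"
    unfolding eventually_at by auto
  have iD: "invertible (D t + mat 1)" if "t \<in> {0..e/2}" for t
    using e(2)[of t] that e(1) f1 D0 by (cases "t = 0") (auto simp: invertible_det_nz)
  have "matrix_inv (rot t) ** y \<in> Sp_ell_plus" if t: "0 < t" "t \<le> e / 2" for t
  proof -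
    have "pd (Om ** cayley_inv (D t))"
      by (rule chart_increasing(2)[of 0 "e/2" D "\<lambda>_. X" 0 t, OF Dd D_Sp pd_imp_psd[OF X] iD])
        (use ps D0 t X in auto)
    then have "cayley (cayley_inv (D t)) \<in> Sp_ell_plus" by (rule pd_imp_Sp_ell_plus)
    then have "flip (D t) \<in> Sp_ell_plus"
      using cayley_cayley_inv[OF iD[of t]] t flip_Sp_ell_plus by simp
    moreover have "flip (D t) = matrix_inv (rot t) ** flip (flip y)"
      unfolding D_def flip_def[of "flip y ** rot t"]
      by (simp add: matrix_inv_mult Sp_invertible fy rot_Sp flip_def[of "flip y"] matrix_minus_right)
    ultimately show ?thesis by (simp add: flip_flip y)
  qed
  then show ?thesis using e(1) by (intro exI[of _ "e / 2"]) auto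
qed

text \<open>Every derivative has the form \<open>A t ** P ** E t\<close> with a constant matrix \<open>P\<close>.\<close>

lemma smooth_product_curve:
  fixes A E :: "real \<Rightarrow> ('n::finite) rmat"
  assumes A: "\<And>t. (A has_vector_derivative A t ** J) (at t within {a..b})"
    and E: "\<And>t. (E has_vector_derivative Y ** E t) (at t within {a..b})"
  shows "smooth_on_Icc a b (\<lambda>t. A t ** E t)"
    "((\<lambda>t. A t ** E t) has_vector_derivative A t ** (J + Y) ** E t) (at t within {a..b})"
proof -
  define P where "P = rec_nat (mat 1 :: 'n rmat) (\<lambda>_ Q. J ** Q + Q ** Y)"
  have P: "P 0 = mat 1" "P (Suc k) = J ** P k + P k ** Y" for k by (simp_all add: P_def)
  define D where "D = (\<lambda>k t. A t ** P k ** E t)"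
  have D: "(D k has_vector_derivative D (Suc k) t) (at t within {a..b})" for k t
  proof -
    have "(D k has_vector_derivative (A t ** P k) ** (Y ** E t) + ((A t ** J) ** P k) ** E t) (at t within {a..b})"
      unfolding D_def
      using has_vector_derivative_matrix_mult[OF has_vector_derivative_matrix_mult[OF A has_vector_derivative_const] E] by simp
    moreover have "(A t ** P k) ** (Y ** E t) + ((A t ** J) ** P k) ** E t = D (Suc k) t"
      by (simp add: D_def P mring)
    ultimately show ?thesis by simp
  qed
  then show "smooth_on_Icc a b (\<lambda>t. A t ** E t)"
    unfolding smooth_on_Icc_def by (intro exI[of _ D]) (simp add: D_def P(1))
  show "((\<lambda>t. A t ** E t) has_vector_derivative A t ** (J + Y) ** E t) (at t within {a..b})"
    using D[of 0 t] unfolding D_def by (simp add: P)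
qed

section \<open>Perturbing the end point of a positive curve\<close>

text \<open>For positive semidefinite \<open>H\<close> this is a continuous lower bound for the smallest eigenvalue, which
  is positive as soon as the determinant is: every other eigenvalue is at most \<open>1 + trace H\<close>.\<close>

definition low :: "real^'n^'n \<Rightarrow> real"
  where "low H = det H / (1 + trace H) ^ (CARD('n) - 1)"

lemma low_bound:
  fixes H :: "real^'n^'n"
  assumes H: "psd H"
  shows "0 \<le> trace H" "0 \<le> low H" "low H * (x \<bullet> x) \<le> x \<bullet> (H *v x)"
proof -
  obtain T d where T: "orthogonal_matrix T" and He: "H = T ** diagmat d ** transpose T"
    using spectral_theorem H by (metis psd_def)
  have TT: "transpose T ** T = mat 1" "T ** transpose T = mat 1" using T by (auto simp: orthogonal_matrix_def)
  have "transpose T ** H ** T = (transpose T ** T) ** diagmat d ** (transpose T ** T)"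
    unfolding He by (simp add: matrix_mul_assoc)
  then have D: "transpose T ** H ** T = diagmat d" by (simp add: TT)
  have dn: "0 \<le> d $ j" for j
    using congruence_diag_entry[OF D, of j] H by (simp add: psd_def)
  have "trace H = trace (transpose T ** (T ** diagmat d))" unfolding He by (rule trace_mul_sym)
  then have tr: "trace H = (\<Sum>j\<in>UNIV. d $ j)" by (simp add: matrix_mul_assoc TT trace_diagmat)
  show t0: "0 \<le> trace H" using dn by (simp add: tr sum_nonneg)
  have "det H = det (T ** transpose T) * det (diagmat d)" unfolding He by (simp add: det_mul)
  then have dt: "det H = (\<Prod>j\<in>UNIV. d $ j)" by (simp add: TT det_diagmat)
  show "0 \<le> low H" using t0 dn by (simp add: low_def dt prod_nonneg)
  have lowd: "low H \<le> d $ j" for j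
  proof -
    have le: "d $ i \<le> 1 + trace H" for i
      unfolding tr using member_le_sum[of i UNIV "\<lambda>i. d $ i"] dn by simp
    have "det H = d $ j * (\<Prod>i\<in>UNIV - {j}. d $ i)" unfolding dt by (simp add: prod.remove[of UNIV j])
    also have "\<dots> \<le> d $ j * (\<Prod>i\<in>UNIV - {j}. 1 + trace H)"
      by (intro mult_left_mono prod_mono) (auto simp: dn le)
    also have "\<dots> = d $ j * (1 + trace H) ^ (CARD('n) - 1)" by (simp add: card_Diff_singleton)
    finally show ?thesis using t0 by (simp add: low_def divide_le_eq)
  qed
  define y where "y = transpose T *v x"
  have "x \<bullet> (H *v x) = y \<bullet> (diagmat d *v y)"
    unfolding He y_def by (simp add: matrix_vector_mul_assoc[symmetric] inner_transpose[of x T] del: transpose_matrix_vector)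
  also have "\<dots> = (\<Sum>j\<in>UNIV. d $ j * (y $ j * y $ j))"
    by (simp add: diagmat_mult_vec inner_vec_def mult.left_commute)
  also have "\<dots> \<ge> (\<Sum>j\<in>UNIV. low H * (y $ j * y $ j))"
    by (intro sum_mono mult_right_mono lowd) simp
  also have "(\<Sum>j\<in>UNIV. low H * (y $ j * y $ j)) = low H * (y \<bullet> y)"
    by (simp add: inner_vec_def sum_distrib_left)
  also have "y \<bullet> y = x \<bullet> x"
  proof -
    have "y \<bullet> y = (T *v y) \<bullet> x" unfolding y_def by (simp add: inner_transpose[of _ "transpose T"] del: transpose_matrix_vector)
    then show ?thesis unfolding y_def by (simp add: matrix_vector_mul_assoc TT del: transpose_matrix_vector)
  qed
  finally show "low H * (x \<bullet> x) \<le> x \<bullet> (H *v x)" .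
qed

lemma continuous_on_low [continuous_intros]:
  fixes f :: "_ \<Rightarrow> real^'n^'n"
  assumes "continuous_on S f" "\<And>x. x \<in> S \<Longrightarrow> psd (f x)"
  shows "continuous_on S (\<lambda>x. low (f x))"
proof -
  have "1 + trace (f x) \<noteq> 0" if "x \<in> S" for x using low_bound(1)[OF assms(2)[OF that]] by simp
  then show ?thesis unfolding low_def by (intro continuous_intros assms) auto
qed

text \<open>The logarithmic derivative of \<open>cayley (s Z)\<close> from the right.\<close>

definition cayley_gen :: "real^'n^'n \<Rightarrow> real \<Rightarrow> real^'n^'n"
  where "cayley_gen Z s = 2 *\<^sub>R (matrix_inv (mat 1 + s *\<^sub>R Z) ** Z ** matrix_inv (mat 1 - s *\<^sub>R Z))"

lemma small_matrix:
  fixes Z :: "('n::finite) rmat"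
  assumes Z: "Z \<in> sp" and e: "\<And>u. norm (Z *v u) \<le> e * norm u" "0 \<le> e" "e \<le> 1/2"
    and s: "0 \<le> s" "s \<le> 1"
  shows "invertible (mat 1 - s *\<^sub>R Z)" "invertible (mat 1 + s *\<^sub>R Z)" "cayley (s *\<^sub>R Z) \<in> Sp"
    "((\<lambda>s. cayley (s *\<^sub>R Z)) has_vector_derivative cayley (s *\<^sub>R Z) ** cayley_gen Z s) (at s within S)"
    "transpose (Om ** cayley_gen Z s) = Om ** cayley_gen Z s"
    "\<bar>x \<bullet> ((Om ** cayley_gen Z s) *v x)\<bar> \<le> 8 * e * (x \<bullet> x)"
proof -
  have half: "norm (s *\<^sub>R (Z *v u)) \<le> (1/2) * norm u" for u
  proof -
    have "norm (s *\<^sub>R (Z *v u)) \<le> 1 * norm (Z *v u)" using s mult_right_mono[of s 1 "norm (Z *v u)"] by simp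
    also have "\<dots> \<le> e * norm u" using e(1) by simp
    also have "\<dots> \<le> (1/2) * norm u" by (intro mult_right_mono e) simp
    finally show ?thesis .
  qed
  have low: "norm u \<le> 2 * norm ((mat 1 - s *\<^sub>R Z) *v u)" "norm u \<le> 2 * norm ((mat 1 + s *\<^sub>R Z) *v u)" for u
    using half[of u] norm_triangle_ineq2[of u "s *\<^sub>R (Z *v u)"] norm_diff_ineq[of u "s *\<^sub>R (Z *v u)"]
    by (simp_all add: mvec)
  have "u = 0" if "(mat 1 - s *\<^sub>R Z) *v u = 0" for u using low(1)[of u] that by simp
  moreover have "u = 0" if "(mat 1 + s *\<^sub>R Z) *v u = 0" for u using low(2)[of u] that by simp
  ultimately show i: "invertible (mat 1 - s *\<^sub>R Z)" "invertible (mat 1 + s *\<^sub>R Z)"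
    unfolding invertible_iff_ker by blast+
  have sZ: "s *\<^sub>R Z \<in> sp" using Z by (simp add: sp_iff scaleR_matrix_right transpose_scalar)
  show "cayley (s *\<^sub>R Z) \<in> Sp" by (rule cayley_Sp[OF sZ i(1)])
  let ?R = "matrix_inv (mat 1 - s *\<^sub>R Z)" and ?Q = "matrix_inv (mat 1 + s *\<^sub>R Z)"
  have R: "(mat 1 - s *\<^sub>R Z) ** ?R = mat 1" "?R ** (mat 1 - s *\<^sub>R Z) = mat 1"
    using i by (simp_all add: matrix_inv_right matrix_inv_left)
  have Q: "(mat 1 + s *\<^sub>R Z) ** ?Q = mat 1" using i by (simp add: matrix_inv_right)
  have comm: "(mat 1 + s *\<^sub>R Z) ** ?R = ?R ** (mat 1 + s *\<^sub>R Z)"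
  proof -
    have e: "mat 1 + s *\<^sub>R Z = 2 *\<^sub>R mat 1 - (mat 1 - s *\<^sub>R Z)" by (simp add: scaleR_2)
    have "(2 *\<^sub>R mat 1 - N) ** Q = Q ** (2 *\<^sub>R mat 1 - N)"
      if "N ** Q = mat 1" "Q ** N = mat 1" for N Q :: "'n rmat"
      by (simp add: mring that)
    from this[OF R] show ?thesis unfolding e .
  qed
  show "((\<lambda>s. cayley (s *\<^sub>R Z)) has_vector_derivative cayley (s *\<^sub>R Z) ** cayley_gen Z s) (at s within S)"
  proof -
    have p: "((\<lambda>s. mat 1 + s *\<^sub>R Z) has_vector_derivative Z) (at s within S)"
      and m: "((\<lambda>s. mat 1 - s *\<^sub>R Z) has_vector_derivative - Z) (at s within S)"
      by (auto intro!: derivative_eq_intros)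
    have "((\<lambda>s. cayley (s *\<^sub>R Z)) has_vector_derivative
        (mat 1 + s *\<^sub>R Z) ** (- (?R ** (- Z) ** ?R)) + Z ** ?R) (at s within S)"
      unfolding cayley_def by (rule has_vector_derivative_matrix_mult[OF p has_vector_derivative_matrix_inv[OF m i(1)]])
    moreover have "(mat 1 + s *\<^sub>R Z) ** (- (?R ** (- Z) ** ?R)) + Z ** ?R = 2 *\<^sub>R (?R ** Z ** ?R)"
    proof -
      have "(mat 1 + s *\<^sub>R Z) ** (- (?R ** (- Z) ** ?R)) = ?R ** (mat 1 + s *\<^sub>R Z) ** Z ** ?R"
        by (simp add: matrix_minus_left matrix_minus_right matrix_mul_assoc comm)
      moreover have "Z ** ?R = ?R ** (mat 1 - s *\<^sub>R Z) ** Z ** ?R" by (simp add: R)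
      moreover have "?R ** (mat 1 + s *\<^sub>R Z) ** Z ** ?R + ?R ** (mat 1 - s *\<^sub>R Z) ** Z ** ?R = 2 *\<^sub>R (?R ** Z ** ?R)"
        by (simp add: mring scaleR_2)
      ultimately show ?thesis by simp
    qed
    moreover have "cayley (s *\<^sub>R Z) ** cayley_gen Z s = 2 *\<^sub>R (?R ** Z ** ?R)"
    proof -
      have "cayley (s *\<^sub>R Z) ** cayley_gen Z s = 2 *\<^sub>R (?R ** ((mat 1 + s *\<^sub>R Z) ** ?Q) ** Z ** ?R)"
        unfolding cayley_def cayley_gen_def comm by (simp add: scaleR_matrix_right matrix_mul_assoc)
      then show ?thesis by (simp add: Q)
    qed
    ultimately show ?thesis by simp
  qed
  have "transpose ?R ** (transpose (mat 1 - s *\<^sub>R Z) ** Om) ** ?Q = transpose ?R ** Om ** ((mat 1 + s *\<^sub>R Z) ** ?Q)"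
    unfolding sp_one_minus_transpose[OF sZ] by (simp add: matrix_mul_assoc)
  moreover have "transpose ?R ** (transpose (mat 1 - s *\<^sub>R Z) ** Om) ** ?Q = transpose ((mat 1 - s *\<^sub>R Z) ** ?R) ** Om ** ?Q"
    by (simp only: matrix_transpose_mul matrix_mul_assoc)
  ultimately have OQ: "Om ** ?Q = transpose ?R ** Om" by (simp add: R Q)
  have OG: "Om ** cayley_gen Z s = 2 *\<^sub>R (transpose ?R ** (Om ** Z) ** ?R)"
    unfolding cayley_gen_def by (simp add: scaleR_matrix_right matrix_mul_assoc OQ)
  show "transpose (Om ** cayley_gen Z s) = Om ** cayley_gen Z s"
    using Z unfolding OG by (simp add: transpose_scalar matrix_transpose_mul[of _ ?R] matrix_transpose_mul[of "transpose ?R"] sp_iff)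
      (simp add: matrix_mul_assoc)
  define u where "u = ?R *v x"
  have xu: "(mat 1 - s *\<^sub>R Z) *v u = x" unfolding u_def by (simp add: matrix_vector_mul_assoc R)
  have nu: "norm u \<le> 2 * norm x" using low(1)[of u] by (simp add: xu)
  have "x \<bullet> ((Om ** cayley_gen Z s) *v x) = 2 * (u \<bullet> (Om *v (Z *v u)))"
    unfolding OG u_def by (simp add: scaleR_matrix_vector matrix_vector_mul_assoc[symmetric] inner_vector_matrix)
  then have "\<bar>x \<bullet> ((Om ** cayley_gen Z s) *v x)\<bar> = 2 * \<bar>u \<bullet> (Om *v (Z *v u))\<bar>" by (simp add: abs_mult)
  also have "\<dots> \<le> 2 * (norm u * norm (Om *v (Z *v u)))"
    using Cauchy_Schwarz_ineq2[of u "Om *v (Z *v u)"] by simp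
  also have "norm (Om *v (Z *v u)) = norm (Z *v u)" by (simp add: norm_eq_sqrt_inner Om_isometry)
  also have "2 * (norm u * norm (Z *v u)) \<le> 2 * (norm u * (e * norm u))"
    by (intro mult_left_mono e) auto
  also have "\<dots> = 2 * e * (norm u)\<^sup>2" by (simp add: power2_eq_square)
  also have "\<dots> \<le> 2 * e * (2 * norm x)\<^sup>2" by (intro mult_left_mono power_mono nu) (use e in auto)
  also have "\<dots> = 8 * e * (x \<bullet> x)" by (simp add: power_mult_distrib power2_norm_eq_inner)
  finally show "\<bar>x \<bullet> ((Om ** cayley_gen Z s) *v x)\<bar> \<le> 8 * e * (x \<bullet> x)" .
qed

text \<open>Multiplication by \<open>cayley (f(t) Z)\<close> moves the end point of a positive curve by \<open>cayley Z\<close>. If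
  \<open>f\<close> grows only where the generator is positive definite, at a rate proportional to \<open>low\<close>, the curve
  stays positive and its length decreases by at most the factor \<open>1 - 8 e / c\<close>.\<close>

lemma perturbed_curve:
  fixes W X :: "real \<Rightarrow> ('n::finite) rmat"
  assumes W: "\<And>t. t \<in> {a..b} \<Longrightarrow> (W has_vector_derivative X t ** W t) (at t within {a..b})"
    and X: "continuous_on {a..b} X" and Xp: "\<And>t. t \<in> {a..b} \<Longrightarrow> psd (Om ** X t)" and ab: "a \<le> b"
    and Z: "Z \<in> sp" and e: "\<And>u. norm (Z *v u) \<le> e * norm u" "0 \<le> e" "e \<le> 1/2"
    and c: "c = integral {a..b} (\<lambda>t. low (Om ** X t))" "8 * e < c"
    and f_def: "f = (\<lambda>t. integral {a..t} (\<lambda>t. low (Om ** X t)) / c)"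
  obtains X' where
    "\<And>t. t \<in> {a..b} \<Longrightarrow> ((\<lambda>t. cayley (f t *\<^sub>R Z) ** W t) has_vector_derivative X' t ** (cayley (f t *\<^sub>R Z) ** W t)) (at t within {a..b})"
    "continuous_on {a..b} X'" "\<And>t. t \<in> {a..b} \<Longrightarrow> psd (Om ** X' t)"
    "\<And>t. t \<in> {a..b} \<Longrightarrow> (1 - 8 * e / c) * G_id (X t) \<le> G_id (X' t)"
    "continuous_on {a..b} f" "f a = 0" "f b = 1" "\<And>t. t \<in> {a..b} \<Longrightarrow> f t \<in> {0..1}"
proof -
  define m where "m = (\<lambda>t. low (Om ** X t))"
  have cm: "continuous_on {a..b} m" unfolding m_def by (intro continuous_intros X Xp)
  have m0: "0 \<le> m t" if "t \<in> {a..b}" for t unfolding m_def by (rule low_bound[OF Xp[OF that]])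
  have c0: "0 < c" using c(2) e(2) by linarith
  have fd: "(f has_vector_derivative m t / c) (at t within {a..b})" if "t \<in> {a..b}" for t
  proof -
    have "((\<lambda>t. (1 / c) *\<^sub>R integral {a..t} m) has_vector_derivative (1 / c) *\<^sub>R m t) (at t within {a..b})"
      by (intro bounded_linear.has_vector_derivative[OF bounded_linear_scaleR_right] integral_has_vector_derivative[OF cm that])
    then show ?thesis unfolding f_def m_def by simp
  qed
  have cf: "continuous_on {a..b} f" by (rule continuous_on_has_vector_derivative[OF fd])
  have fa: "f a = 0" by (simp add: f_def)
  have fb: "f b = 1" using c0 c(1) by (simp add: f_def)
  have f01: "f t \<in> {0..1}" if t: "t \<in> {a..b}" for t
  proof -
    have i: "m integrable_on {u..v}" if "a \<le> u" "v \<le> b" for u v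
      by (intro integrable_continuous_interval continuous_on_subset[OF cm]) (use that in auto)
    have n1: "0 \<le> integral {a..t} m"
      by (rule Henstock_Kurzweil_Integration.integral_nonneg[OF i]) (use t m0 in auto)
    have n2: "0 \<le> integral {t..b} m"
      by (rule Henstock_Kurzweil_Integration.integral_nonneg[OF i]) (use t m0 in auto)
    have "integral {a..t} m + integral {t..b} m = c"
      unfolding c(1) m_def[symmetric] by (rule Henstock_Kurzweil_Integration.integral_combine) (use t i ab in auto)
    then show ?thesis using n1 n2 c0 by (simp add: f_def m_def[symmetric] divide_le_eq)
  qed
  note sm = small_matrix[OF Z e]
  define C where "C = (\<lambda>t. cayley (f t *\<^sub>R Z))"
  define Y where "Y = (\<lambda>t. X t + (m t / c) *\<^sub>R cayley_gen Z (f t))"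
  define X' where "X' = (\<lambda>t. C t ** Y t ** matrix_inv (C t))"
  have CSp: "C t \<in> Sp" if "t \<in> {a..b}" for t unfolding C_def using f01[OF that] by (intro sm(3)) auto
  have iC: "invertible (C t)" if "t \<in> {a..b}" for t by (rule Sp_invertible[OF CSp[OF that]])
  have Cd: "(C has_vector_derivative (m t / c) *\<^sub>R (C t ** cayley_gen Z (f t))) (at t within {a..b})" if t: "t \<in> {a..b}" for t
  proof -
    have "((\<lambda>s. cayley (s *\<^sub>R Z)) has_vector_derivative C t ** cayley_gen Z (f t)) (at (f t) within f ` {a..b})"
      unfolding C_def using f01[OF t] by (intro sm(4)) auto
    from vector_diff_chain_within[OF fd[OF t] this]
    show ?thesis by (simp add: C_def[abs_def] o_def)
  qed
  have cC: "continuous_on {a..b} C" by (rule continuous_on_has_vector_derivative[OF Cd])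
  have cY: "continuous_on {a..b} Y"
    unfolding Y_def cayley_gen_def
    by (intro continuous_intros X cm cf) (use c0 f01 sm(1,2) in auto)
  have d: "((\<lambda>t. C t ** W t) has_vector_derivative X' t ** (C t ** W t)) (at t within {a..b})" if t: "t \<in> {a..b}" for t
  proof -
    have "((\<lambda>t. C t ** W t) has_vector_derivative C t ** (X t ** W t) + ((m t / c) *\<^sub>R (C t ** cayley_gen Z (f t))) ** W t) (at t within {a..b})"
      by (rule has_vector_derivative_matrix_mult[OF Cd[OF t] W[OF t]])
    moreover have "X' t ** (C t ** W t) = C t ** Y t ** (matrix_inv (C t) ** C t) ** W t"
      by (simp add: X'_def matrix_mul_assoc)
    then have "X' t ** (C t ** W t) = C t ** (X t ** W t) + ((m t / c) *\<^sub>R (C t ** cayley_gen Z (f t))) ** W t"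
      by (simp add: matrix_inv_left iC[OF t] Y_def mring)
    ultimately show ?thesis by simp
  qed
  have Ybound: "(1 - 8 * e / c) * (x \<bullet> ((Om ** X t) *v x)) \<le> x \<bullet> ((Om ** Y t) *v x)" if t: "t \<in> {a..b}" for t x
  proof -
    have "\<bar>x \<bullet> ((Om ** cayley_gen Z (f t)) *v x)\<bar> \<le> 8 * e * (x \<bullet> x)"
      using f01[OF t] by (intro sm(6)) auto
    then have "(m t / c) * - (8 * e * (x \<bullet> x)) \<le> (m t / c) * (x \<bullet> ((Om ** cayley_gen Z (f t)) *v x))"
      using m0[OF t] c0 by (intro mult_left_mono) auto
    moreover have "(8 * e / c) * (m t * (x \<bullet> x)) \<le> (8 * e / c) * (x \<bullet> ((Om ** X t) *v x))"
      unfolding m_def using e(2) c0 low_bound(3)[OF Xp[OF t]] by (intro mult_left_mono) auto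
    moreover have "x \<bullet> ((Om ** Y t) *v x) = x \<bullet> ((Om ** X t) *v x) + (m t / c) * (x \<bullet> ((Om ** cayley_gen Z (f t)) *v x))"
      by (simp add: Y_def mring mvec inner_add_right)
    ultimately show ?thesis by (simp add: algebra_simps)
  qed
  have frac: "0 \<le> 1 - 8 * e / c" using c(2) c0 by simp
  have Ysym: "transpose (Om ** Y t) = Om ** Y t" if t: "t \<in> {a..b}" for t
  proof -
    have "transpose (Om ** cayley_gen Z (f t)) = Om ** cayley_gen Z (f t)"
      using f01[OF t] by (intro sm(5)) auto
    then show ?thesis using Xp[OF t]
      by (simp add: Y_def matrix_add_ldistrib scaleR_matrix_right transpose_add transpose_scalar psd_def)
  qed
  have Ypsd: "psd (Om ** Y t)" if t: "t \<in> {a..b}" for t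
  proof -
    have "0 \<le> (1 - 8 * e / c) * (x \<bullet> ((Om ** X t) *v x))" for x
      using frac Xp[OF t] by (simp add: psd_def)
    then show ?thesis unfolding psd_def using Ysym[OF t] Ybound[OF t] order_trans by blast
  qed
  have G: "(1 - 8 * e / c) * G_id (X t) \<le> G_id (X' t)" if t: "t \<in> {a..b}" for t
  proof -
    have "(1 - 8 * e / c) ^ CARD('n + 'n) * det (Om ** X t) \<le> det (Om ** Y t)"
      by (rule psd_det_mono[OF Xp[OF t] Ysym[OF t] frac Ybound[OF t]])
    then have "(1 - 8 * e / c) ^ (2 * CARD('n)) * det (X t) \<le> det (Y t)"
      by (simp add: det_sp mult_2)
    then have "root (2 * CARD('n)) ((1 - 8 * e / c) ^ (2 * CARD('n)) * det (X t)) \<le> root (2 * CARD('n)) (det (Y t))"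
      by (intro real_root_le_mono) simp_all
    moreover have "det (X' t) = det (Y t)" unfolding X'_def by (rule det_conj[OF iC[OF t]])
    ultimately show ?thesis
      using frac by (simp add: G_id_def real_root_mult real_root_power_cancel)
  qed
  show thesis
  proof (rule that[of X'])
    show "continuous_on {a..b} X'" unfolding X'_def by (intro continuous_intros cC cY iC)
    show "psd (Om ** X' t)" if "t \<in> {a..b}" for t
      unfolding X'_def by (rule psd_conj[OF CSp[OF that] Ypsd[OF that]])
  qed (use d G cf fa fb f01 in \<open>simp_all add: C_def\<close>)
qed

section \<open>Lifting to the universal cover\<close>

locale sp_cover =
  fixes S :: "('a::topological_space) monoid" and p :: "'a \<Rightarrow> ('n::finite) rmat" and U :: "'a set"
  assumes cover: "universal_cover_Sp S p" and lift: "is_Sp_ell_plus_lift S p U"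
begin

sublocale group S
  using cover by (simp add: universal_cover_Sp_def)

lemma mult_continuous: "continuous_on (carrier S \<times> carrier S) (\<lambda>(x, y). x \<otimes>\<^bsub>S\<^esub> y)"
  and inv_continuous: "continuous_on (carrier S) (\<lambda>x. inv\<^bsub>S\<^esub> x)"
  and simply_connected: "simply_connected (carrier S)"
  and covering: "covering_space (carrier S) p Sp"
  using cover by (auto simp: universal_cover_Sp_def)

lemma p_continuous: "continuous_on (carrier S) p"
  by (rule covering_space_imp_continuous[OF covering])

lemma p_image: "p ` carrier S = Sp"
  by (rule covering_space_imp_surjective[OF covering])

lemma p_Sp: "x \<in> carrier S \<Longrightarrow> p x \<in> Sp"
  using p_image by blast

lemma p_mult: "x \<in> carrier S \<Longrightarrow> y \<in> carrier S \<Longrightarrow> p (x \<otimes>\<^bsub>S\<^esub> y) = p x ** p y"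
  using cover hom_mult[of p S Sp_group x y] by (simp add: universal_cover_Sp_def Sp_group_def)

lemma p_one: "p \<one>\<^bsub>S\<^esub> = mat 1"
proof -
  let ?P = "p \<one>\<^bsub>S\<^esub>"
  have "?P = ?P ** ?P" using p_mult[of "\<one>\<^bsub>S\<^esub>" "\<one>\<^bsub>S\<^esub>"] by simp
  moreover have "invertible ?P" by (intro Sp_invertible p_Sp) simp
  ultimately have "matrix_inv ?P ** ?P = matrix_inv ?P ** ?P ** ?P" by (metis matrix_mul_assoc)
  then show ?thesis using \<open>invertible ?P\<close> by (simp add: matrix_inv_left)
qed

lemma p_inv: "x \<in> carrier S \<Longrightarrow> p (inv\<^bsub>S\<^esub> x) = matrix_inv (p x)"
  using p_mult[of x "inv\<^bsub>S\<^esub> x"] p_one by (intro matrix_inv_eqI[symmetric]) simp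

lemma continuous_on_mult_curves:
  assumes "continuous_on I f" "continuous_on I g" "f ` I \<subseteq> carrier S" "g ` I \<subseteq> carrier S"
  shows "continuous_on I (\<lambda>t. f t \<otimes>\<^bsub>S\<^esub> g t)"
  using continuous_on_compose2[OF mult_continuous continuous_on_Pair[OF assms(1,2)]] assms(3,4)
  by (auto simp: image_subset_iff)

definition sec :: "'n rmat \<Rightarrow> 'a"
  where "sec = (SOME q. homeomorphism U Sp_ell_plus p q)"

lemma sec: "homeomorphism U Sp_ell_plus p sec"
  using lift unfolding is_Sp_ell_plus_lift_def sec_def by (metis someI_ex)

lemma U_subset: "U \<subseteq> carrier S"
  using lift by (simp add: is_Sp_ell_plus_lift_def)

lemma p_U: "u \<in> U \<Longrightarrow> p u \<in> Sp_ell_plus"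
  using sec by (auto simp: homeomorphism_def)

lemma sec_p: "u \<in> U \<Longrightarrow> sec (p u) = u"
  using sec by (simp add: homeomorphism_def)

lemma p_sec: "z \<in> Sp_ell_plus \<Longrightarrow> p (sec z) = z"
  using sec by (simp add: homeomorphism_def)

lemma sec_U: "z \<in> Sp_ell_plus \<Longrightarrow> sec z \<in> U"
  using sec by (auto simp: homeomorphism_def)

lemma sec_continuous: "continuous_on Sp_ell_plus sec"
  using sec by (simp add: homeomorphism_def)

lemma one_closure: "\<one>\<^bsub>S\<^esub> \<in> top_of_set (carrier S) closure_of U"
  using lift by (simp add: is_Sp_ell_plus_lift_def frontier_of_def)

lemma openin_p_preimage: "openin (top_of_set Sp) T \<Longrightarrow> openin (top_of_set (carrier S)) (carrier S \<inter> p -` T)"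
  by (rule continuous_openin_preimage[OF p_continuous]) (auto simp: p_Sp)

lemma closure_meets:
  assumes "x \<in> top_of_set (carrier S) closure_of U" "openin (top_of_set (carrier S)) V" "x \<in> V"
  obtains u where "u \<in> U" "u \<in> V"
  using assms unfolding in_closure_of by blast

text \<open>A sheet above an evenly covered neighbourhood is open and closed in the preimage, so it contains
  every connected set above the neighbourhood which it meets.\<close>

lemma sheet:
  assumes x: "x \<in> carrier S"
  obtains V T q where "x \<in> V" "openin (top_of_set (carrier S)) V" "openin (top_of_set Sp) T"
    "homeomorphism V T p q"
    "\<And>A. connected A \<Longrightarrow> A \<subseteq> carrier S \<Longrightarrow> p ` A \<subseteq> T \<Longrightarrow> A \<inter> V \<noteq> {} \<Longrightarrow> A \<subseteq> V"
proof -
  have "p x \<in> Sp" by (rule p_Sp[OF x])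
  then obtain T v where T: "p x \<in> T" "openin (top_of_set Sp) T" and v: "\<Union>v = carrier S \<inter> p -` T"
    "\<forall>u\<in>v. openin (top_of_set (carrier S)) u" "pairwise disjnt v" "\<forall>u\<in>v. \<exists>q. homeomorphism u T p q"
    using covering unfolding covering_space_def by meson
  have "x \<in> \<Union>v" unfolding v(1) using x T(1) by simp
  then obtain V where V: "V \<in> v" "x \<in> V" by blast
  obtain q where q: "homeomorphism V T p q" using v(4) V(1) by blast
  have "A \<subseteq> V" if A: "connected A" "A \<subseteq> carrier S" "p ` A \<subseteq> T" "A \<inter> V \<noteq> {}" for A
  proof -
    define O2 where "O2 = \<Union>(v - {V})"
    have op: "openin (top_of_set A) (A \<inter> Q)" if "openin (top_of_set (carrier S)) Q" for Q
      using that A(2) unfolding openin_open by blast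
    have "openin (top_of_set (carrier S)) O2" unfolding O2_def using v(2) by (intro openin_Union) auto
    then have 2: "openin (top_of_set A) (A \<inter> O2)" by (rule op)
    have 1: "openin (top_of_set A) (A \<inter> V)" using op v(2) V(1) by blast
    have cov: "A \<subseteq> (A \<inter> V) \<union> (A \<inter> O2)"
    proof
      fix y assume "y \<in> A"
      then have "y \<in> \<Union>v" unfolding v(1) using A(2,3) by auto
      then show "y \<in> (A \<inter> V) \<union> (A \<inter> O2)" using \<open>y \<in> A\<close> unfolding O2_def by blast
    qed
    have "V \<inter> O2 = {}"
      using v(3) V(1) unfolding O2_def pairwise_def disjnt_def by blast
    then have "(A \<inter> V) \<inter> (A \<inter> O2) = {}" by blast
    then have "A \<inter> O2 = {}"
      using A(1,4) 1 2 cov unfolding connected_openin by blast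
    then show ?thesis using cov by blast
  qed
  moreover have "openin (top_of_set (carrier S)) V" using v(2) V(1) by blast
  ultimately show ?thesis using that V(2) T(2) q by blast
qed

text \<open>Near a point of the closure of \<open>U\<close> which does not have both eigenvalues 1 and -1, the section
  \<open>sec\<close> is the inverse of \<open>p\<close> on the sheet of this point. Indeed the image under \<open>sec\<close> of a connected
  part of the elliptic region lies in one sheet, and \<open>U\<close> has points in the sheet of \<open>x\<close>.\<close>

lemma elliptic_sheet:
  assumes x: "x \<in> carrier S" and cl: "x \<in> top_of_set (carrier S) closure_of U"
    and inv: "invertible (p x + mat 1) \<or> invertible (p x - mat 1)"
  obtains V T q T' where "x \<in> V" "openin (top_of_set (carrier S)) V" "openin (top_of_set Sp) T'" "p x \<in> T'" "T' \<subseteq> T"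
    "homeomorphism V T p q" "\<And>z. z \<in> T' \<Longrightarrow> z \<in> Sp_ell_plus \<Longrightarrow> sec z = q z"
proof -
  obtain V T q where V: "x \<in> V" "openin (top_of_set (carrier S)) V" "openin (top_of_set Sp) T"
    "homeomorphism V T p q"
    and conn: "\<And>A. connected A \<Longrightarrow> A \<subseteq> carrier S \<Longrightarrow> p ` A \<subseteq> T \<Longrightarrow> A \<inter> V \<noteq> {} \<Longrightarrow> A \<subseteq> V"
    using sheet[OF x] by metis
  have pxT: "p x \<in> T" using V by (auto simp: homeomorphism_def)
  obtain T1 E where T1: "openin (top_of_set Sp) T1" "p x \<in> T1" and E: "connected E"
    "E \<subseteq> T \<inter> Sp_ell_plus" "T1 \<inter> Sp_ell_plus \<subseteq> E"
    using elliptic_locally_connected[OF p_Sp[OF x] inv V(3) pxT] by blast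
  have "sec ` E \<subseteq> V"
  proof (rule conn)
    show "connected (sec ` E)"
      using E by (intro connected_continuous_image continuous_on_subset[OF sec_continuous]) auto
    show "sec ` E \<subseteq> carrier S" using E(2) sec_U U_subset by blast
    have "p (sec z) \<in> T" if "z \<in> E" for z
    proof -
      have "z \<in> T" "z \<in> Sp_ell_plus" using that E(2) by auto
      then show ?thesis using p_sec[of z] by simp
    qed
    then show "p ` sec ` E \<subseteq> T" by blast
    have "openin (top_of_set (carrier S)) (V \<inter> (carrier S \<inter> p -` T1))"
      by (intro openin_Int V(2) openin_p_preimage T1)
    then obtain u where u: "u \<in> U" "u \<in> V \<inter> (carrier S \<inter> p -` T1)"
      using closure_meets[OF cl] V(1) x T1(2) by (metis IntI vimageI)
    then have "p u \<in> E" using E(3) p_U by blast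
    then have "sec (p u) \<in> sec ` E" by blast
    then show "sec ` E \<inter> V \<noteq> {}" using u sec_p by auto
  qed
  then have "sec z = q z" if "z \<in> T1 \<inter> T" "z \<in> Sp_ell_plus" for z
  proof -
    have "sec z \<in> V" using \<open>sec ` E \<subseteq> V\<close> E(3) that by blast
    then have "q (p (sec z)) = sec z" using V(4) by (simp add: homeomorphism_def)
    then show ?thesis using p_sec[OF that(2)] by simp
  qed
  then show ?thesis
    using that[of V "T1 \<inter> T" T q] V T1 pxT by (auto intro: openin_Int)
qed

lemma openin_curve_near_0:
  fixes c :: "real \<Rightarrow> 'b::topological_space"
  assumes c: "continuous_on {0..r} c" "c ` {0..r} \<subseteq> A" and T: "openin (top_of_set A) T" "c 0 \<in> T" and r: "0 \<le> r"
  obtains e where "0 < e" "\<And>t. 0 \<le> t \<Longrightarrow> t \<le> r \<Longrightarrow> t < e \<Longrightarrow> c t \<in> T"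
proof -
  have "openin (top_of_set {0..r}) ({0..r} \<inter> c -` T)"
    by (rule continuous_openin_preimage[OF c(1) _ T(1)]) (use c(2) in auto)
  moreover have "0 \<in> {0..r} \<inter> c -` T" using T(2) r by auto
  ultimately obtain e where e: "0 < e" "ball 0 e \<inter> {0..r} \<subseteq> {0..r} \<inter> c -` T"
    unfolding openin_contains_ball by blast
  show ?thesis by (rule that[OF e(1)]) (use e(2) in \<open>auto simp: subset_iff dist_real_def\<close>)
qed

text \<open>A curve which starts at a point of the closure and runs inside the elliptic region afterwards is
  lifted by \<open>sec\<close>; the lift is continuous at the starting point because \<open>sec\<close> is the inverse
  of a sheet there.\<close>

lemma lift_elliptic_curve:
  assumes x: "x \<in> carrier S" and cl: "x \<in> top_of_set (carrier S) closure_of U"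
    and inv: "invertible (p x + mat 1) \<or> invertible (p x - mat 1)"
    and c: "continuous_on {0..1} c" "c 0 = p x" "\<And>t. 0 < t \<Longrightarrow> t \<le> 1 \<Longrightarrow> c t \<in> Sp_ell_plus"
  defines "e \<equiv> \<lambda>t::real. if t = 0 then x else sec (c t)"
  shows "continuous_on {0..1} e" "e ` {0..1} \<subseteq> carrier S" "\<And>t. t \<in> {0..1} \<Longrightarrow> p (e t) = c t"
proof -
  obtain V T q T' where V: "x \<in> V" "openin (top_of_set Sp) T'" "p x \<in> T'" "T' \<subseteq> T"
    "homeomorphism V T p q" "\<And>z. z \<in> T' \<Longrightarrow> z \<in> Sp_ell_plus \<Longrightarrow> sec z = q z"
    using elliptic_sheet[OF x cl inv] by metis
  have cSp: "c ` {0..1} \<subseteq> Sp"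
  proof
    fix z assume "z \<in> c ` {0..1}"
    then obtain t where "t \<in> {0..1}" "z = c t" by blast
    then show "z \<in> Sp" using c(2) c(3)[of t] p_Sp[OF x] Sp_ell_plus_subset by (cases "t = 0") auto
  qed
  obtain d where d: "0 < d" "\<And>t. 0 \<le> t \<Longrightarrow> t \<le> 1 \<Longrightarrow> t < d \<Longrightarrow> c t \<in> T'"
    using openin_curve_near_0[OF c(1) cSp V(2)] V(3) c(2) by auto
  let ?A = "{0..1} \<inter> {..<d}" and ?B = "{0..1} \<inter> {0<..} :: real set"
  have AB: "{0..1} = ?A \<union> ?B" using d(1) by auto
  have eA: "e t = q (c t)" if "t \<in> ?A" for t
  proof (cases "t = 0")
    case True
    then show ?thesis using V(1,5) c(2) by (simp add: e_def homeomorphism_def)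
  next
    case False
    then show ?thesis using that d(2)[of t] c(3)[of t] V(6)[of "c t"] by (simp add: e_def)
  qed
  have "continuous_on ?A (\<lambda>t. q (c t))"
  proof (rule continuous_on_compose2[of T q])
    show "continuous_on T q" using V(5) by (simp add: homeomorphism_def)
    show "continuous_on ?A c" by (rule continuous_on_subset[OF c(1)]) auto
    show "c ` ?A \<subseteq> T" using d(2) V(4) by auto
  qed
  then have 1: "continuous_on ?A e" by (rule continuous_on_eq) (simp add: eA)
  have "continuous_on ?B (\<lambda>t. sec (c t))"
    by (rule continuous_on_compose2[OF sec_continuous continuous_on_subset[OF c(1)]]) (auto intro: c(3))
  then have 2: "continuous_on ?B e" by (rule continuous_on_eq) (auto simp: e_def)
  have "openin (top_of_set (?A \<union> ?B)) ?A" "openin (top_of_set (?A \<union> ?B)) ?B"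
    unfolding AB[symmetric] by (simp_all add: openin_open_Int)
  then have "continuous_on (?A \<union> ?B) e" by (rule continuous_on_Un_local_open[OF _ _ 1 2])
  then show "continuous_on {0..1} e" unfolding AB[symmetric] .
  show "e ` {0..1} \<subseteq> carrier S"
  proof
    fix y assume "y \<in> e ` {0..1}"
    then obtain t where t: "t \<in> {0..1}" "y = e t" by blast
    then show "y \<in> carrier S" using x sec_U[OF c(3)[of t]] U_subset by (cases "t = 0") (auto simp: e_def)
  qed
  show "p (e t) = c t" if "t \<in> {0..1}" for t
    using that c(2) p_sec[OF c(3)[of t]] by (cases "t = 0") (auto simp: e_def)
qed

text \<open>The curve is compared with the lift of the ray \<open>t \<mapsto> cayley (t M)\<close>, which has the same end
  points in the cover. Hence both have the same total increase of the argument, and \<open>no_crossing\<close>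
  applies.\<close>

lemma length_le_interior:
  assumes ab: "a < b" and \<gamma>: "continuous_on {a..b} \<gamma>" "\<gamma> ` {a..b} \<subseteq> carrier S" "\<gamma> a = \<one>\<^bsub>S\<^esub>" "\<gamma> b \<in> U"
    and Wp: "\<And>t. t \<in> {a..b} \<Longrightarrow> p (\<gamma> t) = W t"
    and W: "\<And>t. t \<in> {a..b} \<Longrightarrow> (W has_vector_derivative X t ** W t) (at t within {a..b})"
    and X: "continuous_on {a..b} X" and Xp: "\<And>t. t \<in> {a..b} \<Longrightarrow> psd (Om ** X t)"
  shows "integral {a..b} (\<lambda>t. G_id (X t)) \<le> root (2 * CARD('n)) (eigprod (W b))"
proof -
  have Sp: "W t \<in> Sp" if "t \<in> {a..b}" for t
  proof -
    have "\<gamma> t \<in> carrier S" using \<gamma>(2) that by blast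
    then show ?thesis using p_Sp[of "\<gamma> t"] Wp[OF that] by simp
  qed
  have Wa: "W a = mat 1" using Wp[of a] \<gamma>(3) p_one ab by simp
  have Wb: "W b \<in> Sp_ell_plus" using Wp[of b] p_U[OF \<gamma>(4)] ab by simp
  define M1 where "M1 = cayley_inv (W b)"
  have B1: "pd (Om ** M1)" unfolding M1_def by (rule Sp_ell_plus_imp_pd[OF Wb])
  have cM1: "cayley M1 = W b" unfolding M1_def by (rule cayley_cayley_inv[OF Sp_ell_plus_plus_one_invertible[OF Wb]])
  define c where "c = (\<lambda>s. cayley (s *\<^sub>R M1))"
  have pds: "pd (Om ** (s *\<^sub>R M1))" if "0 < s" for s
    using pd_scaleR[OF B1 that] by (simp add: scaleR_matrix_right)
  have i1: "invertible (mat 1 - s *\<^sub>R M1)" if "0 \<le> s" for s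
    using pd_one_minus_invertible(1)[OF pds, of s] that by (cases "s = 0") (auto simp: invertible_det_nz)
  have cc: "continuous_on {0..1} c"
    unfolding c_def by (intro continuous_on_cayley continuous_intros i1) auto
  have c0: "c 0 = p \<one>\<^bsub>S\<^esub>"
  proof -
    have "matrix_inv (mat 1 :: 'n rmat) = mat 1" by (rule matrix_inv_eqI) simp
    then show ?thesis by (simp add: c_def cayley_def p_one)
  qed
  have cE: "c t \<in> Sp_ell_plus" if "0 < t" "t \<le> 1" for t
    unfolding c_def by (rule pd_imp_Sp_ell_plus[OF pds[OF that(1)]])
  have inv1: "invertible (p \<one>\<^bsub>S\<^esub> + mat 1)"
  proof -
    have "p \<one>\<^bsub>S\<^esub> + mat 1 = 2 *\<^sub>R mat 1" by (simp add: p_one scaleR_2)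
    then show ?thesis by (simp add: invertible_det_nz det_scaleR)
  qed
  define e where "e = (\<lambda>t::real. if t = 0 then \<one>\<^bsub>S\<^esub> else sec (c t))"
  have e: "continuous_on {0..1} e" "e ` {0..1} \<subseteq> carrier S" "\<And>t. t \<in> {0..1} \<Longrightarrow> p (e t) = c t"
    unfolding e_def using lift_elliptic_curve[OF one_closed one_closure disjI1[OF inv1] cc c0 cE] by blast+
  have e1: "e 1 = \<gamma> b" using sec_p[OF \<gamma>(4)] Wp[of b] ab cM1 by (simp add: e_def c_def)
  have total: "Im (L b) = Im (sym_log (s *\<^sub>R (Om ** M1)))"
    if s: "0 < s" and L: "continuous_on {a..b} L" "\<And>t. t \<in> {a..b} \<Longrightarrow> exp (L t) = maslov_det s (W t)"
      "L a = of_real (ln (2 ^ CARD('n + 'n)))" for s L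
  proof -
    define K where "K = (\<lambda>t. sym_log (s *\<^sub>R (Om ** cayley_inv (c t))) + of_real (ln (det (c t + mat 1))))"
    have cSp: "c t \<in> Sp" if "t \<in> {0..1}" for t
    proof -
      have "e t \<in> carrier S" using e(2) that by blast
      then show ?thesis using p_Sp e(3)[OF that] by metis
    qed
    have ic: "invertible (c t + mat 1)" if "t \<in> {0..1}" for t
      unfolding c_def by (rule cayley_plus_one(3)[OF i1]) (use that in auto)
    have K: "continuous_on {0..1} K" "\<And>t. t \<in> {0..1} \<Longrightarrow> exp (K t) = maslov_det s (c t)"
      "K 0 = of_real (ln (2 ^ CARD('n + 'n)))"
      unfolding K_def using chart_log_path[OF cc cSp c0[unfolded p_one] ic, where s = s] by auto
    let ?l = "\<lambda>t::real. a + t * (b - a)"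
    have l: "?l t \<in> {a..b}" if "t \<in> {0..1}" for t
    proof -
      have "t * (b - a) \<le> 1 * (b - a)" "0 \<le> t * (b - a)"
        using that ab by (auto intro!: mult_right_mono)
      then show ?thesis by auto
    qed
    have cl: "continuous_on {0..1} ?l" by (intro continuous_intros)
    have "L (?l 1) - L (?l 0) = K 1 - K 0"
    proof (rule log_increment_path_independent[OF simply_connected, where F = "\<lambda>x. maslov_det s (p x)" and p = "\<lambda>t. \<gamma> (?l t)" and q = e])
      show "continuous_on (carrier S) (\<lambda>x. maslov_det s (p x))"
        unfolding maslov_det_def by (intro continuous_intros p_continuous)
      show "maslov_det s (p x) \<noteq> 0" if "x \<in> carrier S" for x
        using maslov_invertible[OF p_Sp[OF that] s] by (simp add: maslov_det_def invertible_det_nz)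
      show "continuous_on {0..1} (\<lambda>t. \<gamma> (?l t))"
        by (rule continuous_on_compose2[OF \<gamma>(1) cl]) (use l in auto)
      show "(\<lambda>t. \<gamma> (?l t)) ` {0..1} \<subseteq> carrier S" using \<gamma>(2) l by blast
      show "\<gamma> (?l 0) = e 0" by (simp add: \<gamma>(3) e_def)
      show "\<gamma> (?l 1) = e 1" by (simp add: e1)
      show "continuous_on {0..1} (\<lambda>t. L (?l t))"
        by (rule continuous_on_compose2[OF L(1) cl]) (use l in auto)
      show "exp (L (?l t)) = maslov_det s (p (\<gamma> (?l t)))" if "t \<in> {0..1}" for t
        using L(2)[OF l[OF that]] Wp[OF l[OF that]] by simp
      show "exp (K t) = maslov_det s (p (e t))" if "t \<in> {0..1}" for t
        using K(2)[OF that] e(3)[OF that] by simp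
    qed (use e K in auto)
    then have "L b = K 1" using L(3) K(3) by simp
    moreover have "cayley_inv (c 1) = M1" using cayley_inv_cayley[OF i1[of 1]] by (simp add: c_def)
    ultimately show ?thesis by (simp add: K_def)
  qed
  have inv: "invertible (W t + mat 1)" if "t \<in> {a..b}" for t
    by (rule no_crossing(1)[where W = W and X = X and a = a and b = b and ?B1.0 = "Om ** M1" and t = t])
      (use ab W X Sp Xp Wa pd_imp_psd[OF B1] that total in \<open>simp_all only: less_imp_le\<close>)
  show ?thesis by (rule length_le_eigprod[OF less_imp_le[OF ab] W X Sp Xp Wa inv Wb])
qed

section \<open>Length of curves to the closure of the lift\<close>

lemma tangent_curve_generator:
  assumes t: "tangent_curve S p a b \<gamma>"
  obtains X where
    "\<And>t. t \<in> {a..b} \<Longrightarrow> ((\<lambda>t. p (\<gamma> t)) has_vector_derivative X t ** p (\<gamma> t)) (at t within {a..b})"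
    "continuous_on {a..b} X" "\<And>t. t \<in> {a..b} \<Longrightarrow> psd (Om ** X t)"
    "curve_length p a b \<gamma> = integral {a..b} (\<lambda>t. G_id (X t))"
proof -
  have ab: "a < b" and g: "continuous_on {a..b} \<gamma>" "\<gamma> ` {a..b} \<subseteq> carrier S"
    and cone: "\<And>t. t \<in> {a..b} \<Longrightarrow> velocity a b (p \<circ> \<gamma>) t \<in> cone (p (\<gamma> t))"
    using t by (auto simp: tangent_curve_def)
  obtain D where D': "\<forall>t\<in>{a..b}. D 0 t = (p \<circ> \<gamma>) t"
    "\<forall>k. \<forall>t\<in>{a..b}. (D k has_vector_derivative D (Suc k) t) (at t within {a..b})"
    using t unfolding tangent_curve_def smooth_on_Icc_def by blast
  have D0: "D 0 t = p (\<gamma> t)" if "t \<in> {a..b}" for t using D'(1) that by simp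
  have D: "(D k has_vector_derivative D (Suc k) t) (at t within {a..b})" if "t \<in> {a..b}" for k t
    using D'(2) that by blast
  have d: "((\<lambda>t. p (\<gamma> t)) has_vector_derivative D 1 t) (at t within {a..b})" if "t \<in> {a..b}" for t
  proof -
    have "(D 0 has_vector_derivative D 1 t) (at t within {a..b})" using D[OF that, of 0] by simp
    then show ?thesis by (rule has_vector_derivative_transform[OF that, rotated]) (simp add: D0)
  qed
  have v: "velocity a b (p \<circ> \<gamma>) t = D 1 t" if "t \<in> {a..b}" for t
    unfolding velocity_def o_def using vector_derivative_within_cbox[of a b t "\<lambda>t. p (\<gamma> t)" "D 1 t"] d[OF that] that ab by simp
  have Sp: "p (\<gamma> t) \<in> Sp" if "t \<in> {a..b}" for t using p_Sp[of "\<gamma> t"] g(2) that by blast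
  define X where "X = (\<lambda>t. D 1 t ** matrix_inv (p (\<gamma> t)))"
  have XW: "X t ** p (\<gamma> t) = D 1 t" and Xc: "X t \<in> cone_id" if t: "t \<in> {a..b}" for t
  proof -
    obtain X0 where X0: "X0 \<in> cone_id" "D 1 t = X0 ** p (\<gamma> t)"
      using cone[OF t] v[OF t] by (auto simp: cone_def)
    have "X t = X0"
      unfolding X_def X0(2) by (simp add: matrix_mul_assoc[symmetric] matrix_inv_right Sp_invertible Sp[OF t])
    then show "X t ** p (\<gamma> t) = D 1 t" "X t \<in> cone_id" using X0 by simp_all
  qed
  have cW: "continuous_on {a..b} (\<lambda>t. p (\<gamma> t))" by (rule continuous_on_has_vector_derivative[OF d])
  have cD: "continuous_on {a..b} (D 1)" by (rule continuous_on_has_vector_derivative[OF D])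
  show thesis
  proof (rule that[of X])
    show "continuous_on {a..b} X" unfolding X_def by (intro continuous_intros cD cW Sp_invertible Sp)
    show "psd (Om ** X t)" if "t \<in> {a..b}" for t using Xc[OF that] by (simp add: cone_id_iff)
    show "curve_length p a b \<gamma> = integral {a..b} (\<lambda>t. G_id (X t))"
      unfolding curve_length_def by (rule integral_cong) (simp add: G_at_def v X_def)
  qed (use d XW in simp)
qed

lemma G_id_nonneg: "psd (Om ** X) \<Longrightarrow> 0 \<le> G_id X"
  using psd_det_nonneg[of "Om ** X"] by (simp add: G_id_def det_sp)

lemma curve_length_nonneg:
  assumes "tangent_curve S p a b \<gamma>" shows "0 \<le> curve_length p a b \<gamma>"
proof -
  obtain X where "\<And>t. t \<in> {a..b} \<Longrightarrow> ((\<lambda>t. p (\<gamma> t)) has_vector_derivative X t ** p (\<gamma> t)) (at t within {a..b})"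
    and X: "continuous_on {a..b} X" "\<And>t. t \<in> {a..b} \<Longrightarrow> psd (Om ** X t)"
    "curve_length p a b \<gamma> = integral {a..b} (\<lambda>t. G_id (X t))"
    by (rule tangent_curve_generator[OF assms]) (rule that)
  show ?thesis unfolding X(3)
    by (rule Henstock_Kurzweil_Integration.integral_nonneg)
      (auto simp: G_id_nonneg X(2), auto simp: G_id_def intro!: integrable_continuous_interval continuous_intros X(1))
qed

lemma eigprod_nonneg: "0 \<le> eigprod W"
proof -
  have "0 \<le> (\<Prod>z\<in>#S. \<bar>Arg z\<bar>)" for S by (induction S) auto
  then show ?thesis unfolding eigprod_def .
qed

lemma cayley_0: "cayley 0 = mat 1"
proof -
  have "matrix_inv (mat 1 :: real^'m^'m) = mat 1" by (rule matrix_inv_eqI) simp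
  then show ?thesis by (simp add: cayley_def)
qed

lemma cayley_tendsto_one:
  assumes "(f \<longlongrightarrow> 0) F" shows "((\<lambda>x. cayley (f x)) \<longlongrightarrow> mat 1) F"
proof -
  have "((\<lambda>x. cayley (f x)) \<longlongrightarrow> cayley 0) F"
    unfolding cayley_def by (intro tendsto_intros assms) (simp add: invertible_det_nz)
  then show ?thesis by (simp add: cayley_0)
qed

text \<open>Points of \<open>U\<close> close to \<open>w\<close> differ from \<open>w\<close> by a small factor, whose projection is \<open>cayley Z\<close> with
  small \<open>Z\<close>. The perturbing curve \<open>cayley (f(t) Z)\<close> stays near the identity, where it is lifted by the
  inverse of the sheet of the neutral element.\<close>

lemma perturbed_end:
  assumes t: "tangent_curve S p a b \<gamma>" and ga: "\<gamma> a = \<one>\<^bsub>S\<^esub>" and gb: "\<gamma> b = w"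
    and cl: "w \<in> top_of_set (carrier S) closure_of U"
    and W: "\<And>t. t \<in> {a..b} \<Longrightarrow> ((\<lambda>t. p (\<gamma> t)) has_vector_derivative X t ** p (\<gamma> t)) (at t within {a..b})"
    and X: "continuous_on {a..b} X" and Xp: "\<And>t. t \<in> {a..b} \<Longrightarrow> psd (Om ** X t)"
    and c: "c = integral {a..b} (\<lambda>t. low (Om ** X t))" and e: "0 < e" "e \<le> 1/2" "8 * e < c"
  obtains u Z where "u \<in> U" "p u = cayley Z ** p w" "\<And>v. norm (Z *v v) \<le> e * norm v"
    "(1 - 8 * e / c) * integral {a..b} (\<lambda>t. G_id (X t)) \<le> root (2 * CARD('n)) (eigprod (p u))"
proof -
  have ab: "a < b" and g: "continuous_on {a..b} \<gamma>" "\<gamma> ` {a..b} \<subseteq> carrier S"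
    using t by (auto simp: tangent_curve_def)
  have wC: "w \<in> carrier S" using gb g(2) ab by auto
  obtain V T q where V: "\<one>\<^bsub>S\<^esub> \<in> V" "openin (top_of_set (carrier S)) V" "openin (top_of_set Sp) T"
    "homeomorphism V T p q"
    using sheet[OF one_closed] by metis
  have q: "q (p y) = y" if "y \<in> V" for y using that V(4) by (simp add: homeomorphism_def)
  have pq: "p (q z) = z" "q z \<in> V" if "z \<in> T" for z using that V(4) by (auto simp: homeomorphism_def)
  have qc: "continuous_on T q" using V(4) by (simp add: homeomorphism_def)
  have VC: "V \<subseteq> carrier S" using openin_imp_subset[OF V(2)] .
  have 1: "mat 1 \<in> T" using V(1,4) p_one by (force simp: homeomorphism_def)
  obtain r1 where r1: "0 < r1" "ball (mat 1) r1 \<inter> Sp \<subseteq> T"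
    using V(3) 1 unfolding openin_contains_ball by blast
  have "(cayley \<longlongrightarrow> mat 1) (at (0 :: 'n rmat))" by (rule cayley_tendsto_one) (rule tendsto_ident_at)
  then obtain r2 where r2: "0 < r2" "\<And>M. M \<noteq> 0 \<Longrightarrow> dist M (0 :: 'n rmat) < r2 \<Longrightarrow> dist (cayley M) (mat 1) < r1"
    using r1(1) unfolding LIM_def by blast
  obtain K where K: "0 \<le> K" "\<And>(Z :: 'n rmat) v. norm (Z *v v) \<le> norm Z * norm v * K"
    using bounded_bilinear.nonneg_bounded[OF bounded_bilinear_matrix_vector_mult] by blast
  define r where "r = min r2 (e / (K + 1))"
  have r: "0 < r" using r2(1) e(1) K(1) by (simp add: r_def)
  define N where "N = {y \<in> Sp. invertible (y + mat 1) \<and> dist (cayley_inv y) (0 :: 'n rmat) < r}"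
  define h where "h = (\<lambda>x. x \<otimes>\<^bsub>S\<^esub> inv\<^bsub>S\<^esub> w)"
  have hC: "h x \<in> carrier S" if "x \<in> carrier S" for x using that wC by (simp add: h_def)
  have ch: "continuous_on (carrier S) h"
    unfolding h_def using wC by (intro continuous_on_mult_curves continuous_intros) auto
  have "openin (top_of_set (carrier S)) (V \<inter> (carrier S \<inter> p -` N))"
    unfolding N_def by (intro openin_Int V(2) openin_p_preimage openin_cayley_ball)
  then have "openin (top_of_set (carrier S)) (carrier S \<inter> h -` (V \<inter> (carrier S \<inter> p -` N)))"
    by (rule continuous_openin_preimage[OF ch, rotated]) (use hC in auto)
  moreover have "w \<in> carrier S \<inter> h -` (V \<inter> (carrier S \<inter> p -` N))"
  proof -
    have "mat 1 \<in> N"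
    proof -
      have "(mat 1 :: 'n rmat) + mat 1 = 2 *\<^sub>R mat 1" by (simp add: scaleR_2)
      then have "invertible ((mat 1 :: 'n rmat) + mat 1)" by (simp add: invertible_det_nz det_scaleR)
      moreover have "cayley_inv (mat 1) = (0 :: 'n rmat)"
        by (simp add: cayley_inv_def vec_eq_iff matrix_matrix_mult_def)
      ultimately show ?thesis using r by (simp add: N_def mat_1_Sp)
    qed
    then show ?thesis using wC V(1) by (simp add: h_def p_one)
  qed
  ultimately obtain u where u: "u \<in> U" "h u \<in> V" "p (h u) \<in> N"
    using closure_meets[OF cl] by blast
  have uC: "u \<in> carrier S" using u(1) U_subset by blast
  define Z where "Z = cayley_inv (p (h u))"
  have hS: "p (h u) \<in> Sp" "invertible (p (h u) + mat 1)" using u(3) by (auto simp: N_def)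
  have Zsp: "Z \<in> sp" unfolding Z_def by (rule cayley_inv_sp[OF hS])
  have cZ: "cayley Z = p (h u)" unfolding Z_def by (rule cayley_cayley_inv[OF hS(2)])
  have nZ: "norm Z < r" using u(3) by (simp add: N_def Z_def)
  have Ze: "norm (Z *v v) \<le> e * norm v" for v
  proof -
    have "norm Z * K \<le> r * K" using nZ K(1) by (intro mult_right_mono) auto
    also have "\<dots> \<le> e / (K + 1) * K" unfolding r_def using K(1) by (intro mult_right_mono) auto
    also have "\<dots> \<le> e" using K(1) e(1) by (simp add: field_simps)
    finally have "norm Z * K * norm v \<le> e * norm v" by (intro mult_right_mono) auto
    then show ?thesis using K(2)[of Z v] by (simp add: mult_ac)
  qed
  have hw: "h u \<otimes>\<^bsub>S\<^esub> w = u" using uC wC by (simp add: h_def m_assoc)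
  have pu: "p u = cayley Z ** p w"
    unfolding cZ using p_mult[OF hC[OF uC] wC] by (simp add: hw)
  have inT: "cayley (s *\<^sub>R Z) \<in> T" if s: "s \<in> {0..1}" for s
  proof -
    have "norm (s *\<^sub>R Z) \<le> 1 * norm Z" unfolding norm_scaleR using s by (intro mult_right_mono) auto
    then have "norm (s *\<^sub>R Z) < r2" using nZ by (simp add: r_def)
    then have "dist (cayley (s *\<^sub>R Z)) (mat 1) < r1"
      using r2(2)[of "s *\<^sub>R Z"] r1(1) by (cases "s *\<^sub>R Z = 0") (auto simp: cayley_0)
    moreover have "cayley (s *\<^sub>R Z) \<in> Sp"
      using s e by (intro small_matrix(3)[OF Zsp Ze]) auto
    ultimately show ?thesis using r1(2) by (auto simp: dist_commute)
  qed
  define f where "f = (\<lambda>t. integral {a..t} (\<lambda>t. low (Om ** X t)) / c)"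
  obtain X' where X': "\<And>t. t \<in> {a..b} \<Longrightarrow> ((\<lambda>t. cayley (f t *\<^sub>R Z) ** p (\<gamma> t)) has_vector_derivative X' t ** (cayley (f t *\<^sub>R Z) ** p (\<gamma> t))) (at t within {a..b})"
    "continuous_on {a..b} X'" "\<And>t. t \<in> {a..b} \<Longrightarrow> psd (Om ** X' t)"
    "\<And>t. t \<in> {a..b} \<Longrightarrow> (1 - 8 * e / c) * G_id (X t) \<le> G_id (X' t)"
    and f: "continuous_on {a..b} f" "f a = 0" "f b = 1" "\<And>t. t \<in> {a..b} \<Longrightarrow> f t \<in> {0..1}"
    by (rule perturbed_curve[OF W X Xp less_imp_le[OF ab] Zsp Ze less_imp_le[OF e(1)] e(2) c e(3) f_def])
      (assumption, assumption, rule that)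
  have fT: "cayley (f t *\<^sub>R Z) \<in> T" if "t \<in> {a..b}" for t by (rule inT[OF f(4)[OF that]])
  define \<gamma>' where "\<gamma>' = (\<lambda>t. q (cayley (f t *\<^sub>R Z)) \<otimes>\<^bsub>S\<^esub> \<gamma> t)"
  have "integral {a..b} (\<lambda>t. G_id (X' t)) \<le> root (2 * CARD('n)) (eigprod (cayley (f b *\<^sub>R Z) ** p (\<gamma> b)))"
  proof (rule length_le_interior[OF ab, where \<gamma> = \<gamma>' and W = "\<lambda>t. cayley (f t *\<^sub>R Z) ** p (\<gamma> t)" and X = X'])
    have cq: "continuous_on {a..b} (\<lambda>t. q (cayley (f t *\<^sub>R Z)))"
    proof (rule continuous_on_compose2[OF qc])
      show "continuous_on {a..b} (\<lambda>t. cayley (f t *\<^sub>R Z))"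
        by (intro continuous_on_cayley continuous_intros f(1) small_matrix(1)[OF Zsp Ze]) (use f(4) e in auto)
    qed (use fT in auto)
    have qC: "q (cayley (f t *\<^sub>R Z)) \<in> carrier S" if "t \<in> {a..b}" for t using pq(2)[OF fT[OF that]] VC by blast
    show "continuous_on {a..b} \<gamma>'"
      unfolding \<gamma>'_def by (rule continuous_on_mult_curves[OF cq g(1) _ g(2)]) (use qC in auto)
    have gC: "\<gamma> t \<in> carrier S" if "t \<in> {a..b}" for t using g(2) that by blast
    show "\<gamma>' ` {a..b} \<subseteq> carrier S" unfolding \<gamma>'_def using qC gC by auto
    have "q (mat 1) = \<one>\<^bsub>S\<^esub>" using q[OF V(1)] by (simp add: p_one)
    then show "\<gamma>' a = \<one>\<^bsub>S\<^esub>" by (simp add: \<gamma>'_def f(2) ga cayley_0)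
    have "\<gamma>' b = u" using q[OF u(2)] by (simp add: \<gamma>'_def f(3) gb cZ hw)
    then show "\<gamma>' b \<in> U" using u(1) by simp
    show "p (\<gamma>' t) = cayley (f t *\<^sub>R Z) ** p (\<gamma> t)" if "t \<in> {a..b}" for t
      unfolding \<gamma>'_def using p_mult[OF qC[OF that] gC[OF that]] pq(1)[OF fT[OF that]] by simp
  qed (use X' in auto)
  then have "integral {a..b} (\<lambda>t. G_id (X' t)) \<le> root (2 * CARD('n)) (eigprod (p u))"
    by (simp add: f(3) gb pu)
  moreover have "(1 - 8 * e / c) * integral {a..b} (\<lambda>t. G_id (X t)) \<le> integral {a..b} (\<lambda>t. G_id (X' t))"
  proof -
    have "integral {a..b} (\<lambda>t. (1 - 8 * e / c) * G_id (X t)) \<le> integral {a..b} (\<lambda>t. G_id (X' t))"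
      using X'(4) unfolding G_id_def
      by (intro integral_le integrable_continuous_interval continuous_intros X X'(2)) auto
    then show ?thesis by simp
  qed
  ultimately show ?thesis using that[OF u(1) pu Ze] by linarith
qed

lemma matrix_small_tendsto_zero:
  fixes Z :: "nat \<Rightarrow> real^'m^'m"
  assumes Z: "\<And>j v. norm (Z j *v v) \<le> e j * norm v" and e: "e \<longlonglongrightarrow> 0"
  shows "Z \<longlonglongrightarrow> 0"
proof (intro vec_tendstoI)
  fix i k
  have "\<bar>Z j $ i $ k\<bar> \<le> e j" for j
  proof -
    have "Z j $ i $ k = (Z j *v axis k 1) $ i"
      by (simp add: matrix_vector_mult_def axis_def if_distrib cong: if_cong)
    then have "\<bar>Z j $ i $ k\<bar> \<le> norm (Z j *v axis k 1)" using component_le_norm_cart by metis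
    also have "\<dots> \<le> e j * norm (axis k (1::real))" by (rule Z)
    finally show ?thesis by simp
  qed
  then have "(\<lambda>j. Z j $ i $ k) \<longlonglongrightarrow> 0"
    by (intro tendsto_rabs_zero_cancel[OF tendsto_sandwich[OF _ _ tendsto_const e]]) auto
  then show "(\<lambda>j. Z j $ i $ k) \<longlonglongrightarrow> 0 $ i $ k" by simp
qed

text \<open>If the integral of \<open>low\<close> vanishes, then so does the determinant of the generator at all times, and
  the length is zero. Otherwise the curve can be perturbed to end in \<open>U\<close>, by less and
  less.\<close>

theorem curve_length_le:
  assumes t: "tangent_curve S p a b \<gamma>" and ga: "\<gamma> a = \<one>\<^bsub>S\<^esub>" and gb: "\<gamma> b = w"
    and cl: "w \<in> top_of_set (carrier S) closure_of U"
  shows "curve_length p a b \<gamma> \<le> root (2 * CARD('n)) (eigprod (p w))"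
proof -
  have ab: "a < b" using t by (auto simp: tangent_curve_def)
  obtain X where W: "\<And>t. t \<in> {a..b} \<Longrightarrow> ((\<lambda>t. p (\<gamma> t)) has_vector_derivative X t ** p (\<gamma> t)) (at t within {a..b})"
    and X: "continuous_on {a..b} X" and Xp: "\<And>t. t \<in> {a..b} \<Longrightarrow> psd (Om ** X t)"
    and len: "curve_length p a b \<gamma> = integral {a..b} (\<lambda>t. G_id (X t))"
    by (rule tangent_curve_generator[OF t]) (rule that)
  define c where "c = integral {a..b} (\<lambda>t. low (Om ** X t))"
  define l where "l = integral {a..b} (\<lambda>t. G_id (X t))"
  have cm: "continuous_on {a..b} (\<lambda>t. low (Om ** X t))" by (intro continuous_intros X Xp)
  have m0: "0 \<le> low (Om ** X t)" if "t \<in> {a..b}" for t by (rule low_bound[OF Xp[OF that]])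
  have "0 \<le> c" unfolding c_def
    by (rule Henstock_Kurzweil_Integration.integral_nonneg[OF integrable_continuous_interval[OF cm] m0])
  show ?thesis
  proof (cases "c = 0")
    case True
    have "((\<lambda>t. low (Om ** X t)) has_integral 0) (cbox a b)"
      using integrable_integral[OF integrable_continuous_interval[OF cm]] True by (simp add: c_def)
    then have z: "low (Om ** X t) = 0" if "t \<in> {a..b}" for t
      using has_integral_0_cbox_imp_0[of a b "\<lambda>t. low (Om ** X t)" t] cm m0 that ab by auto
    have "G_id (X t) = 0" if "t \<in> {a..b}" for t
    proof -
      have "1 + trace (Om ** X t) \<noteq> 0" using low_bound(1)[OF Xp[OF that]] by simp
      then have "det (Om ** X t) = 0" using z[OF that] by (simp add: low_def)
      then show ?thesis by (simp add: G_id_def det_sp)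
    qed
    then have "integral {a..b} (\<lambda>t. G_id (X t)) = integral {a..b} (\<lambda>t. 0)" by (intro integral_cong) auto
    then show ?thesis unfolding len by (simp add: eigprod_nonneg)
  next
    case False
    with \<open>0 \<le> c\<close> have c0: "0 < c" by simp
    define k where "k = min (1/2) (c / 16)"
    define e where "e = (\<lambda>j::nat. k * inverse (real (Suc j)))"
    have k0: "0 < k" using c0 by (simp add: k_def)
    have e: "0 < e j" "e j \<le> 1/2" "8 * e j < c" for j
    proof -
      have "inverse (real (Suc j)) \<le> 1" by (simp add: inverse_le_1_iff)
      then have ek: "e j \<le> k" unfolding e_def using k0 by (simp add: mult_left_le)
      show "0 < e j" using k0 by (simp add: e_def)
      show "e j \<le> 1/2" using ek by (simp add: k_def)
      show "8 * e j < c" using ek c0 by (simp add: k_def)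
    qed
    have e_lim: "e \<longlonglongrightarrow> 0"
      unfolding e_def using tendsto_mult_right_zero[OF LIMSEQ_inverse_real_of_nat, of k] by simp
    have "\<forall>j. \<exists>u Z. u \<in> U \<and> p u = cayley Z ** p w \<and> (\<forall>v. norm (Z *v v) \<le> e j * norm v) \<and>
      (1 - 8 * e j / c) * l \<le> root (2 * CARD('n)) (eigprod (p u))"
      unfolding l_def using perturbed_end[OF t ga gb cl W X Xp c_def e] by metis
    then obtain u Z where u: "\<And>j. u j \<in> U" "\<And>j. p (u j) = cayley (Z j) ** p w"
      "\<And>j v. norm (Z j *v v) \<le> e j * norm v"
      "\<And>j. (1 - 8 * e j / c) * l \<le> root (2 * CARD('n)) (eigprod (p (u j)))"
      by metis
    have "(\<lambda>j. cayley (Z j)) \<longlonglongrightarrow> mat 1"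
      by (rule cayley_tendsto_one[OF matrix_small_tendsto_zero[OF u(3) e_lim]])
    then have "(\<lambda>j. cayley (Z j) ** p w) \<longlonglongrightarrow> mat 1 ** p w" by (intro tendsto_intros)
    then have pw: "(\<lambda>j. p (u j)) \<longlonglongrightarrow> p w" by (simp add: u(2))
    obtain r where r: "strict_mono r" "(\<lambda>j. eigprod (p (u (r j)))) \<longlonglongrightarrow> eigprod (p w)"
      using eigprod_limit[of "\<lambda>j. p (u j)", OF p_U[OF u(1)] pw] by blast
    have "(\<lambda>j. root (2 * CARD('n)) (eigprod (p (u (r j))))) \<longlonglongrightarrow> root (2 * CARD('n)) (eigprod (p w))"
      by (intro tendsto_intros r(2))
    moreover have "(\<lambda>j. (1 - 8 * e (r j) / c) * l) \<longlonglongrightarrow> (1 - 8 * 0 / c) * l"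
      using LIMSEQ_subseq_LIMSEQ[OF e_lim r(1)] False by (intro tendsto_intros) (simp_all add: o_def)
    ultimately have "(1 - 8 * 0 / c) * l \<le> root (2 * CARD('n)) (eigprod (p w))"
      by (intro LIMSEQ_le) (use u(4) in auto)
    then show ?thesis by (simp add: len l_def)
  qed
qed

section \<open>Long curves\<close>

lemma closure_sequence:
  assumes w: "w \<in> top_of_set (carrier S) closure_of U"
  obtains u where "\<And>j::nat. u j \<in> U" "(\<lambda>j. p (u j)) \<longlonglongrightarrow> p w"
proof -
  have wC: "w \<in> carrier S" using w by (simp add: in_closure_of)
  have "\<exists>u\<in>U. dist (p u) (p w) < inverse (real (Suc j))" for j
  proof -
    have "openin (top_of_set (carrier S)) (carrier S \<inter> p -` ball (p w) (inverse (real (Suc j))))"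
      by (rule continuous_openin_preimage_gen[OF p_continuous open_ball])
    moreover have "w \<in> carrier S \<inter> p -` ball (p w) (inverse (real (Suc j)))" using wC by simp
    ultimately obtain u where "u \<in> U" "u \<in> carrier S \<inter> p -` ball (p w) (inverse (real (Suc j)))"
      using closure_meets[OF w] by blast
    then show ?thesis by (auto simp: dist_commute)
  qed
  then obtain u where u: "\<And>j. u j \<in> U" "\<And>j. dist (p (u j)) (p w) < inverse (real (Suc j))" by metis
  have "(\<lambda>j. dist (p (u j)) (p w)) \<longlonglongrightarrow> 0"
    by (rule tendsto_sandwich[OF _ _ tendsto_const LIMSEQ_inverse_real_of_nat]) (intro always_eventually allI, simp, intro always_eventually allI less_imp_le[OF u(2)])
  then have "(\<lambda>j. p (u j)) \<longlonglongrightarrow> p w" by (subst tendsto_dist_iff)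
  then show ?thesis by (rule that[OF u(1)])
qed

text \<open>The one-parameter curve to \<open>u\<close>, multiplied by a lifted rotation which moves \<open>u\<close> to \<open>w\<close>. The
  rotation adds a multiple of the identity matrix to the form of the generator, which can only
  increase its determinant.\<close>

lemma rotated_exponential_curve:
  assumes \<epsilon>: "0 < \<epsilon>" and r: "continuous_on {0..\<epsilon>} r" "r ` {0..\<epsilon>} \<subseteq> carrier S" "r 0 = \<one>\<^bsub>S\<^esub>"
    "\<And>t. t \<in> {0..\<epsilon>} \<Longrightarrow> p (r t) = rot t"
    and u: "u \<in> U" and w: "r \<epsilon> \<otimes>\<^bsub>S\<^esub> u = w"
  shows "\<exists>l\<in>curve_lengths S p \<one>\<^bsub>S\<^esub> w. root (2 * CARD('n)) (eigprod (p u)) \<le> l"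
proof -
  define M where "M = cayley_inv (p u)"
  have uE: "p u \<in> Sp_ell_plus" by (rule p_U[OF u])
  have cM: "cayley M = p u" unfolding M_def by (rule cayley_cayley_inv[OF Sp_ell_plus_plus_one_invertible[OF uE]])
  obtain T d where nf: "normal_form M T d"
    using normal_form_exists[of M] Sp_ell_plus_imp_pd[OF uE] unfolding M_def by blast
  interpret nf: normal_form M T d by (rule nf)
  let ?E = "nf.expM" and ?Y = "nf.logM"
  have cE: "continuous_on {0..1} ?E" by (rule continuous_on_has_vector_derivative[OF nf.expM_derivative])
  have E0: "?E 0 = p \<one>\<^bsub>S\<^esub>" by (simp add: nf.expM_0 p_one)
  have EE: "?E t \<in> Sp_ell_plus" if "0 < t" "t \<le> 1" for t
    unfolding nf.expM_cayley(2)[OF that] by (rule pd_imp_Sp_ell_plus[OF nf.expM_cayley(1)[OF that]])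
  have inv1: "invertible (p \<one>\<^bsub>S\<^esub> + mat 1)"
  proof -
    have "p \<one>\<^bsub>S\<^esub> + mat 1 = 2 *\<^sub>R mat 1" by (simp add: p_one scaleR_2)
    then show ?thesis by (simp add: invertible_det_nz det_scaleR)
  qed
  define e where "e = (\<lambda>t::real. if t = 0 then \<one>\<^bsub>S\<^esub> else sec (?E t))"
  have e: "continuous_on {0..1} e" "e ` {0..1} \<subseteq> carrier S" "\<And>t. t \<in> {0..1} \<Longrightarrow> p (e t) = ?E t"
    unfolding e_def using lift_elliptic_curve[OF one_closed one_closure disjI1[OF inv1] cE E0 EE] by blast+
  have e1: "e 1 = u" using sec_p[OF u] by (simp add: e_def nf.expM_1 cM)
  have eC: "e t \<in> carrier S" if "t \<in> {0..1}" for t using e(2) that by blast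
  define \<gamma> where "\<gamma> = (\<lambda>t. r (\<epsilon> * t) \<otimes>\<^bsub>S\<^esub> e t)"
  have et: "\<epsilon> * t \<in> {0..\<epsilon>}" if "t \<in> {0..1}" for t
    using that \<epsilon> by (auto simp: mult_left_le)
  have rC: "r (\<epsilon> * t) \<in> carrier S" if "t \<in> {0..1}" for t using r(2) et[OF that] by blast
  have pg: "p (\<gamma> t) = rot (\<epsilon> * t) ** ?E t" if "t \<in> {0..1}" for t
    unfolding \<gamma>_def using p_mult[OF rC[OF that] eC[OF that]] r(4)[OF et[OF that]] e(3)[OF that] by simp
  define J where "J = - \<epsilon> *\<^sub>R (Om :: 'n rmat)"
  have Ad: "((\<lambda>t. rot (\<epsilon> * t)) has_vector_derivative rot (\<epsilon> * t) ** J) (at t within {0..1})" for t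
    unfolding J_def by (rule rot_has_vector_derivative)
  note smooth = smooth_product_curve[OF Ad nf.expM_derivative]
  define X where "X = (\<lambda>t. rot (\<epsilon> * t) ** (J + ?Y) ** matrix_inv (rot (\<epsilon> * t)))"
  have JY: "Om ** (J + ?Y) = \<epsilon> *\<^sub>R mat 1 + Om ** ?Y"
    by (simp add: J_def mring Om_Om)
  have pdJY: "pd (Om ** (J + ?Y))"
    unfolding JY by (intro pd_add pd_scaleR pd_mat_1 \<epsilon> pd_imp_psd nf.logM_pd)
  have pdX: "pd (Om ** X t)" for t unfolding X_def by (rule pd_conj[OF rot_Sp pdJY])
  have Xcone: "X t \<in> cone_id" for t
  proof -
    have "X t \<noteq> 0"
    proof
      assume "X t = 0"
      then have "det (X t) = 0" using det_0[where 'n = "'n + 'n" and 'a = real] by (simp add: mat_0)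
      then show False using pd_det_pos[OF pdX[of t]] by (simp add: det_sp)
    qed
    then show ?thesis using pd_imp_psd[OF pdX] by (simp add: cone_id_iff)
  qed
  have XW: "X t ** p (\<gamma> t) = rot (\<epsilon> * t) ** (J + ?Y) ** ?E t" if "t \<in> {0..1}" for t
  proof -
    have "X t ** p (\<gamma> t) = rot (\<epsilon> * t) ** (J + ?Y) ** (matrix_inv (rot (\<epsilon> * t)) ** rot (\<epsilon> * t)) ** ?E t"
      unfolding pg[OF that] X_def by (simp only: matrix_mul_assoc)
    then show ?thesis by (simp add: matrix_inv_left Sp_invertible rot_Sp)
  qed
  have gC: "\<gamma> t \<in> carrier S" if "t \<in> {0..1}" for t unfolding \<gamma>_def using rC[OF that] eC[OF that] by simp
  have v: "velocity 0 1 (p \<circ> \<gamma>) t = X t ** p (\<gamma> t)" if t: "t \<in> {0..1}" for t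
  proof -
    have "((p \<circ> \<gamma>) has_vector_derivative X t ** p (\<gamma> t)) (at t within {0..1})"
      unfolding XW[OF t] by (rule has_vector_derivative_transform[OF t _ smooth(2)]) (simp add: pg)
    then show ?thesis unfolding velocity_def
      using vector_derivative_within_cbox[of 0 1 t "p \<circ> \<gamma>"] t by simp
  qed
  have tc: "tangent_curve S p 0 1 \<gamma>"
    unfolding tangent_curve_def
  proof (intro conjI ballI)
    show "continuous_on {0..1} \<gamma>"
      unfolding \<gamma>_def
    proof (rule continuous_on_mult_curves[OF _ e(1) _ e(2)])
      show "continuous_on {0..1} (\<lambda>t. r (\<epsilon> * t))"
        by (rule continuous_on_compose2[OF r(1)]) (use et in \<open>auto intro!: continuous_intros\<close>)
      show "(\<lambda>t. r (\<epsilon> * t)) ` {0..1} \<subseteq> carrier S" using rC by blast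
    qed
    show "\<gamma> ` {0..1} \<subseteq> carrier S" using gC by blast
    show "smooth_on_Icc 0 1 (p \<circ> \<gamma>)"
      using smooth(1) unfolding smooth_on_Icc_def by (simp add: pg)
    show "velocity 0 1 (p \<circ> \<gamma>) t \<in> cone (p (\<gamma> t))" if "t \<in> {0..1}" for t
      unfolding v[OF that] cone_def using Xcone by blast
  qed simp
  have len: "curve_length p 0 1 \<gamma> = G_id (J + ?Y)"
  proof -
    have "G_at (p (\<gamma> t)) (velocity 0 1 (p \<circ> \<gamma>) t) = G_id (J + ?Y)" if "t \<in> {0..1}" for t
    proof -
      have "X t ** p (\<gamma> t) ** matrix_inv (p (\<gamma> t)) = X t"
        unfolding matrix_mul_assoc[symmetric] using matrix_inv_right[OF Sp_invertible[OF p_Sp[OF gC[OF that]]]] by simp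
      moreover have "det (X t) = det (J + ?Y)"
        unfolding X_def by (rule det_conj[OF Sp_invertible[OF rot_Sp]])
      ultimately show ?thesis by (simp add: G_at_def v[OF that] G_id_def)
    qed
    then have "curve_length p 0 1 \<gamma> = integral {0..1} (\<lambda>t::real. G_id (J + ?Y))"
      unfolding curve_length_def by (intro integral_cong) auto
    then show ?thesis by simp
  qed
  have "1 ^ CARD('n + 'n) * det (Om ** ?Y) \<le> det (Om ** (J + ?Y))"
  proof (rule psd_det_mono[OF pd_imp_psd[OF nf.logM_pd]])
    show "transpose (Om ** (J + ?Y)) = Om ** (J + ?Y)" using pdJY by (simp add: pd_def)
    show "1 * (x \<bullet> ((Om ** ?Y) *v x)) \<le> x \<bullet> ((Om ** (J + ?Y)) *v x)" for x
      unfolding JY using \<epsilon> by (simp add: mvec inner_add_right)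
  qed simp
  then have "det ?Y \<le> det (J + ?Y)" by (simp add: det_sp)
  then have "root (2 * CARD('n)) (eigprod (p u)) \<le> curve_length p 0 1 \<gamma>"
    unfolding len G_id_def using nf.eigprod_cayley by (simp add: cM)
  moreover have "\<gamma> 0 = \<one>\<^bsub>S\<^esub>" by (simp add: \<gamma>_def r(3) e_def)
  moreover have "\<gamma> 1 = w" by (simp add: \<gamma>_def e1 w)
  ultimately show ?thesis using tc unfolding curve_lengths_def by blast
qed

text \<open>The backward rotation of \<open>w\<close> projects into the elliptic region and is close to \<open>w\<close>; by
  \<open>elliptic_sheet\<close> it then lies in \<open>U\<close> and not on another sheet above the elliptic region.\<close>

theorem long_curves_exist:
  assumes cl: "w \<in> top_of_set (carrier S) closure_of U" and inv: "invertible (p w - mat 1)"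
  shows "\<exists>e>0. \<forall>\<epsilon>. 0 < \<epsilon> \<and> \<epsilon> \<le> e \<longrightarrow> matrix_inv (rot \<epsilon>) ** p w \<in> Sp_ell_plus \<and>
    (\<exists>l\<in>curve_lengths S p \<one>\<^bsub>S\<^esub> w. root (2 * CARD('n)) (eigprod (matrix_inv (rot \<epsilon>) ** p w)) \<le> l)"
proof -
  have wC: "w \<in> carrier S" using cl by (simp add: in_closure_of)
  obtain v where v: "\<And>j::nat. v j \<in> U" "(\<lambda>j. p (v j)) \<longlonglongrightarrow> p w" using closure_sequence[OF cl] by metis
  obtain e1 where e1: "0 < e1" "\<And>t. 0 < t \<Longrightarrow> t \<le> e1 \<Longrightarrow> matrix_inv (rot t) ** p w \<in> Sp_ell_plus"
    using rotate_back_into_elliptic[OF p_Sp[OF wC] inv p_U[OF v(1)] v(2)] by blast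
  obtain V1 T1 q1 where V1: "\<one>\<^bsub>S\<^esub> \<in> V1" "openin (top_of_set (carrier S)) V1" "openin (top_of_set Sp) T1"
    "homeomorphism V1 T1 p q1"
    using sheet[OF one_closed] by metis
  have 1: "rot 0 \<in> T1" using V1(1,4) p_one by (force simp: homeomorphism_def rot_0)
  obtain e2 where e2: "0 < e2" "\<And>t. 0 \<le> t \<Longrightarrow> t \<le> 1 \<Longrightarrow> t < e2 \<Longrightarrow> rot t \<in> T1"
    using openin_curve_near_0[OF continuous_on_rot _ V1(3) 1, of 1] rot_Sp by auto
  define e3 where "e3 = min 1 (e2 / 2)"
  have e3: "0 < e3" "\<And>t. t \<in> {0..e3} \<Longrightarrow> rot t \<in> T1" using e2 by (auto simp: e3_def)
  define r where "r = (\<lambda>t. q1 (rot t))"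
  have rV: "r t \<in> V1" "p (r t) = rot t" if "t \<in> {0..e3}" for t
    using e3(2)[OF that] V1(4) by (auto simp: r_def homeomorphism_def)
  have V1C: "V1 \<subseteq> carrier S" by (rule openin_imp_subset[OF V1(2)])
  have rC: "r t \<in> carrier S" if "t \<in> {0..e3}" for t using rV(1)[OF that] V1C by blast
  have cr: "continuous_on {0..e3} r"
    unfolding r_def
    by (rule continuous_on_compose2[OF _ continuous_on_rot, of T1]) (use V1(4) e3(2) in \<open>auto simp: homeomorphism_def\<close>)
  have r0: "r 0 = \<one>\<^bsub>S\<^esub>" using V1(1,4) by (simp add: r_def rot_0 p_one[symmetric] homeomorphism_def)
  define W where "W = (\<lambda>t. inv\<^bsub>S\<^esub> (r t) \<otimes>\<^bsub>S\<^esub> w)"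
  have WC: "W t \<in> carrier S" if "t \<in> {0..e3}" for t using rC[OF that] wC by (simp add: W_def)
  have pW: "p (W t) = matrix_inv (rot t) ** p w" if "t \<in> {0..e3}" for t
    unfolding W_def using p_mult[of "inv\<^bsub>S\<^esub> (r t)" w] p_inv[OF rC[OF that]] rV(2)[OF that] rC[OF that] wC by simp
  have W0: "W 0 = w" using wC by (simp add: W_def r0)
  have cW: "continuous_on {0..e3} W"
    unfolding W_def
  proof (rule continuous_on_mult_curves[OF _ continuous_on_const])
    show "continuous_on {0..e3} (\<lambda>t. inv\<^bsub>S\<^esub> (r t))"
      by (rule continuous_on_compose2[OF inv_continuous cr]) (use rC in auto)
  qed (use rC wC in auto)
  obtain V T q T' where V: "w \<in> V" "openin (top_of_set (carrier S)) V" "openin (top_of_set Sp) T'" "p w \<in> T'" "T' \<subseteq> T"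
    "homeomorphism V T p q" "\<And>z. z \<in> T' \<Longrightarrow> z \<in> Sp_ell_plus \<Longrightarrow> sec z = q z"
    using elliptic_sheet[OF wC cl disjI2[OF inv]] by metis
  have op: "openin (top_of_set (carrier S)) (V \<inter> (carrier S \<inter> p -` T'))"
    by (intro openin_Int V(2) openin_p_preimage V(3))
  obtain e4 where e4: "0 < e4" "\<And>t. 0 \<le> t \<Longrightarrow> t \<le> e3 \<Longrightarrow> t < e4 \<Longrightarrow> W t \<in> V \<inter> (carrier S \<inter> p -` T')"
  proof (rule openin_curve_near_0[OF cW _ op])
    show "W ` {0..e3} \<subseteq> carrier S" using WC by blast
    show "W 0 \<in> V \<inter> (carrier S \<inter> p -` T')" using W0 V(1,4) wC by simp
    show "0 \<le> e3" using e3(1) by simp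
  qed (rule that)
  define e where "e = min (min e1 e3) (e4 / 2)"
  have "matrix_inv (rot \<epsilon>) ** p w \<in> Sp_ell_plus \<and>
    (\<exists>l\<in>curve_lengths S p \<one>\<^bsub>S\<^esub> w. root (2 * CARD('n)) (eigprod (matrix_inv (rot \<epsilon>) ** p w)) \<le> l)"
    if \<epsilon>: "0 < \<epsilon>" "\<epsilon> \<le> e" for \<epsilon>
  proof -
    have le: "\<epsilon> \<le> e1" "\<epsilon> \<le> e3" "\<epsilon> < e4" using \<epsilon> e4(1) by (auto simp: e_def)
    have ell: "matrix_inv (rot \<epsilon>) ** p w \<in> Sp_ell_plus" using e1(2) \<epsilon> le by simp
    have in3: "\<epsilon> \<in> {0..e3}" using \<epsilon> le by simp
    have "W \<epsilon> \<in> V" "p (W \<epsilon>) \<in> T'" using e4(2)[of \<epsilon>] \<epsilon> le by auto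
    moreover have "q (p y) = y" if "y \<in> V" for y using V(6) that by (simp add: homeomorphism_def)
    ultimately have "W \<epsilon> = q (p (W \<epsilon>))" "sec (p (W \<epsilon>)) = q (p (W \<epsilon>))"
      using V(7)[of "p (W \<epsilon>)"] ell pW[OF in3] by metis+
    then have WU: "W \<epsilon> \<in> U" using sec_U[of "p (W \<epsilon>)"] ell pW[OF in3] by simp
    have "\<exists>l\<in>curve_lengths S p \<one>\<^bsub>S\<^esub> w. root (2 * CARD('n)) (eigprod (p (W \<epsilon>))) \<le> l"
    proof (rule rotated_exponential_curve[where r = r, OF \<epsilon>(1) _ _ r0 _ WU])
      show "continuous_on {0..\<epsilon>} r" by (rule continuous_on_subset[OF cr]) (use le in auto)
      show "r ` {0..\<epsilon>} \<subseteq> carrier S" using rC le by auto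
      show "p (r t) = rot t" if "t \<in> {0..\<epsilon>}" for t using rV(2) that le by auto
      show "r \<epsilon> \<otimes>\<^bsub>S\<^esub> W \<epsilon> = w" unfolding W_def using rC[OF in3] wC by (simp add: m_assoc[symmetric])
    qed
    then show ?thesis using ell pW[OF in3] by simp
  qed
  moreover have "0 < e" using e1(1) e3(1) e4(1) by (simp add: e_def)
  ultimately show ?thesis by blast
qed

end

section \<open>The distance from the identity\<close>

lemma invertible_minus_one_if_no_eigenvalue:
  assumes "1 \<notin># eigenvalues W"
  shows "invertible (W - mat 1)"
proof (rule ccontr)
  assume "\<not> invertible (W - mat 1)"
  then obtain x where x: "x \<noteq> 0" "W *v x = x"
    by (auto simp: invertible_iff_ker mvec)
  define v where "v = (\<chi> i. complex_of_real (x $ i))"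
  have vp: "re_part v = x" "im_part v = 0" by (simp_all add: v_def re_part_def im_part_def vec_eq_iff)
  have "complexify W *v v = 1 *s v"
    using x(2) by (simp add: complex_vec_eq_iff vp)
  moreover have "v \<noteq> 0" using x vp by auto
  ultimately have "1 \<in># eigenvalues W" unfolding eigenvalues_iff by blast
  with assms show False by blast
qed

theorem corollary1p2:
  fixes S :: "('a::topological_space) monoid"
    and p :: "'a \<Rightarrow> ('n::finite) rmat"
    and U :: "'a set"
    and w :: 'a
    and \<theta> :: "'n \<Rightarrow> real"
  assumes "universal_cover_Sp S p"
    and "is_Sp_ell_plus_lift S p U"
    and "w \<in> top_of_set (carrier S) closure_of U"
    and "\<And>k. 0 \<le> \<theta> k \<and> \<theta> k \<le> pi"
    and "eigenvalues (p w) = (\<Sum>k\<in>UNIV. {#cis (\<theta> k), cis (- \<theta> k)#})"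
  shows "dist_G S p \<one>\<^bsub>S\<^esub> w = ereal (root CARD('n) (\<Prod>k\<in>UNIV. \<theta> k))"
proof -
  interpret sp_cover S p U using assms(1,2) by unfold_locales
  let ?L = "curve_lengths S p \<one>\<^bsub>S\<^esub> w"
  define R where "R = root CARD('n) (\<Prod>k\<in>UNIV. \<theta> k)"
  have prod0: "0 \<le> (\<Prod>k\<in>UNIV. \<theta> k)" using assms(4) by (simp add: prod_nonneg)
  have eR: "root (2 * CARD('n)) (eigprod (p w)) = R"
  proof -
    have "root (2 * CARD('n)) ((\<Prod>k\<in>UNIV. \<theta> k)\<^sup>2) = root CARD('n) (root 2 ((\<Prod>k\<in>UNIV. \<theta> k)\<^sup>2))"
      by (metis mult.commute real_root_mult_exp)
    also have "root 2 ((\<Prod>k\<in>UNIV. \<theta> k)\<^sup>2) = (\<Prod>k\<in>UNIV. \<theta> k)"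
      using prod0 by (simp add: real_root_power_cancel)
    finally show ?thesis unfolding R_def eigprod_of_eigenvalues[OF assms(5,4)] .
  qed
  have upper: "l \<le> R" and lower0: "0 \<le> l" if lL: "l \<in> ?L" for l
  proof -
    obtain a b \<gamma> where l: "l = curve_length p a b \<gamma>" "tangent_curve S p a b \<gamma>" "\<gamma> a = \<one>\<^bsub>S\<^esub>" "\<gamma> b = w"
      using lL unfolding curve_lengths_def by blast
    show "l \<le> R" unfolding l(1) eR[symmetric] by (rule curve_length_le[OF l(2-4) assms(3)])
    show "0 \<le> l" unfolding l(1) by (rule curve_length_nonneg[OF l(2)])
  qed
  show ?thesis
  proof (cases "\<exists>k. \<theta> k = 0")
    case True
    then have R0: "R = 0" by (auto simp: R_def)
    show ?thesis
    proof (cases "?L = {}")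
      case True then show ?thesis using R0 by (simp add: dist_G_def R_def)
    next
      case False
      then obtain l where l: "l \<in> ?L" by blast
      have "(SUP l\<in>?L. ereal l) \<le> ereal R" by (rule SUP_least) (simp add: upper)
      moreover have "ereal 0 \<le> (SUP l\<in>?L. ereal l)"
        by (rule SUP_upper2[OF l]) (simp add: lower0[OF l])
      ultimately show ?thesis using False R0 by (simp add: dist_G_def R_def[symmetric] zero_ereal_def)
    qed
  next
    case False
    then have pos: "0 < \<theta> k" for k using assms(4)[of k] by (metis less_le)
    have "cis (\<theta> k) \<noteq> 1" "cis (- \<theta> k) \<noteq> 1" for k
      using cos_monotone_0_pi[of 0 "\<theta> k"] pos[of k] assms(4)[of k] by (auto simp: complex_eq_iff)
    then have "1 \<notin># eigenvalues (p w)"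
      unfolding assms(5) by (auto simp: set_mset_sum)
    then have inv: "invertible (p w - mat 1)" by (rule invertible_minus_one_if_no_eigenvalue)
    obtain e where e: "0 < e" "\<And>\<epsilon>. 0 < \<epsilon> \<Longrightarrow> \<epsilon> \<le> e \<Longrightarrow> matrix_inv (rot \<epsilon>) ** p w \<in> Sp_ell_plus \<and>
      (\<exists>l\<in>?L. root (2 * CARD('n)) (eigprod (matrix_inv (rot \<epsilon>) ** p w)) \<le> l)"
      using long_curves_exist[OF assms(3) inv] by metis
    define s where "s = (\<lambda>j::nat. e * inverse (real (Suc j)))"
    have s: "0 < s j" "s j \<le> e" for j using e(1) by (auto simp: s_def inverse_le_1_iff mult_left_le)
    have s_lim: "s \<longlonglongrightarrow> 0"
      unfolding s_def using tendsto_mult_right_zero[OF LIMSEQ_inverse_real_of_nat, of e] by simp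
    have "(\<lambda>j. matrix_inv (rot (s j)) ** p w) \<longlonglongrightarrow> matrix_inv (rot 0) ** p w"
      unfolding rot_def by (intro tendsto_intros s_lim) (simp add: invertible_det_nz)
    moreover have "matrix_inv (rot 0 :: 'n rmat) = mat 1" by (rule matrix_inv_eqI) (simp add: rot_0)
    ultimately have lim: "(\<lambda>j. matrix_inv (rot (s j)) ** p w) \<longlonglongrightarrow> p w" by simp
    obtain r where r: "strict_mono r" "(\<lambda>j. eigprod (matrix_inv (rot (s (r j))) ** p w)) \<longlonglongrightarrow> eigprod (p w)"
      using eigprod_limit[of "\<lambda>j. matrix_inv (rot (s j)) ** p w" "p w"] lim e(2) s by blast
    have "(\<lambda>j. root (2 * CARD('n)) (eigprod (matrix_inv (rot (s (r j))) ** p w))) \<longlonglongrightarrow> R"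
      unfolding eR[symmetric] by (intro tendsto_intros r(2))
    then have rl: "(\<lambda>j. ereal (root (2 * CARD('n)) (eigprod (matrix_inv (rot (s (r j))) ** p w)))) \<longlonglongrightarrow> ereal R"
      by simp
    have "ereal (root (2 * CARD('n)) (eigprod (matrix_inv (rot (s (r j))) ** p w))) \<le> (SUP l\<in>?L. ereal l)" for j
    proof -
      obtain l where l: "l \<in> ?L" "root (2 * CARD('n)) (eigprod (matrix_inv (rot (s (r j))) ** p w)) \<le> l"
        using e(2)[OF s] by blast
      then show ?thesis by (intro SUP_upper2[OF l(1)]) simp
    qed
    then have "ereal R \<le> (SUP l\<in>?L. ereal l)" by (intro LIMSEQ_le_const2[OF rl]) auto
    moreover have "(SUP l\<in>?L. ereal l) \<le> ereal R" by (rule SUP_least) (simp add: upper)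
    moreover have "?L \<noteq> {}" using e(2)[OF e(1) order_refl] by blast
    ultimately show ?thesis by (simp add: dist_G_def R_def[symmetric])
  qed
qed

end
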